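(* Let $\pi^X\propto\exp(-f)$ on $\mathbb{R}^d$, where $f:\mathbb{R}^d\to\mathbb{R}$ is convex and $\beta$-smooth (i.e. $\nabla f$ is $\beta$-Lipschitz), $\beta>0$. Let $\varepsilon>0$. Take the step size $\eta\asymp\frac1{\beta d}$ and, in each iteration of the proximal sampler, implement the draw from $\pi^{X\mid Y}(\cdot\mid y)$ by rejection sampling. Then, for a suitable number $k$ of iterations, the proximal sampler started from $\rho_0^X$ outputs a sample with law $\rho_k^X$ satisfying $H_{\pi^X}(\rho_k^X)\le\varepsilon$, and the expected total number of calls to an oracle for $f$ is $$O\Bigl(\frac{\beta d\,W_2^2(\rho_0^X,\pi^X)}{\varepsilon}\Bigr),$$ with an absolute implied constant.
   Context: Probability measures are identified with their Lebesgue densities when these exist; $\pi^X$ is assumed to have finite second moment. Proximal sampler with step size $\eta>0$: let $\pi(x,y)\propto \exp(-f(x)-\frac{1}{2\eta}\|x-y\|^2)$ on $\mathbb{R}^d\times\mathbb{R}^d$, with conditionals $\pi^{Y\mid X}(\cdot\mid x)=\mathcal N(x,\eta I)$ and $\pi^{X\mid Y}(x\mid y)\propto_x \exp(-f(x)-\frac1{2\eta}\|x-y\|^2)$. Starting from $x_0\sim\rho_0^X$, for $k=0,1,\dots$: draw $y_k\mid x_k\sim\pi^{Y\mid X}(\cdot\mid x_k)$, then $x_{k+1}\mid y_k\sim \pi^{X\mid Y}(\cdot\mid y_k)$. $\rho_k^X$ denotes the law of $x_k$. Rejection sampling for $\tilde\pi\propto\exp(-\tilde f)$ with $\tilde f$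 being $\tilde\alpha$-strongly convex: compute the minimizer $x^\star$ of $\tilde f$; then repeat until acceptance: draw $Z\sim\mathcal N(x^\star,\tilde\alpha^{-1}I)$ and accept it with probability $\exp(-\tilde f(Z)+\tilde f(x^\star)+\frac{\tilde\alpha}{2}\|Z-x^\star\|^2)$; output the accepted $Z$, which has law $\tilde\pi$. Here it is applied with $\tilde f(x)=f(x)+\frac1{2\eta}\|x-y\|^2$, where $\eta<1/\beta$, so that $\tilde f$ is $(\frac1\eta-\beta)$-strongly convex and $(\frac1\eta+\beta)$-smooth. An oracle for $f$ can evaluate $f$ at a point and can compute the proximity operator of $f$, i.e. the exact minimizer of $x\mapsto f(x)+\frac1{2\eta}\|x-y\|^2$. The notation $\eta\asymp\frac1{\beta d}$ means $\eta=\frac{c}{\beta d}$ for a suitable (sufficiently small) absolute constant $c>0$. The $O(\cdot)$ bound is understood in the regime where the displayed quantity is bounded below by a positive absolute constant (so that rounding $k$ to an integer is immaterial). $H_\pi(\rho)=\int\rho\log\frac\rho\pi$ is the KL divergence; $W_2$ is the 2-Wasserstein distance. *)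

theory Defs
  imports "HOL-Probability.Probability"
begin

text \<open>
  The constants in the final bound are absolute, so the dimension \<open>d\<close> has to be quantified inside
  the statement and cannot be a type.  A point of \<open>d\<close>-dimensional space is therefore an extensional
  function on \<open>{..<d}\<close>, and functions on that space have type \<open>(nat \<Rightarrow> real) \<Rightarrow> real\<close> and are only
  ever constrained and used on the carrier.
\<close>

abbreviation Leb :: "nat \<Rightarrow> (nat \<Rightarrow> real) measure" where
  "Leb d \<equiv> PiM {..<d} (\<lambda>_. lborel)"

abbreviation Rn :: "nat \<Rightarrow> (nat \<Rightarrow> real) set" where
  "Rn d \<equiv> {..<d} \<rightarrow>\<^sub>E UNIV"

definition edist :: "nat \<Rightarrow> (nat \<Rightarrow> real) \<Rightarrow> (nat \<Rightarrow> real) \<Rightarrow> real" where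
  "edist d x y = L2_set (\<lambda>i. x i - y i) {..<d}"

definition convex_fun :: "nat \<Rightarrow> ((nat \<Rightarrow> real) \<Rightarrow> real) \<Rightarrow> bool" where
  "convex_fun d f \<longleftrightarrow>
     (\<forall>x\<in>Rn d. \<forall>y\<in>Rn d. \<forall>t\<in>{0..1}.
        f (\<lambda>i\<in>{..<d}. (1 - t) * x i + t * y i) \<le> (1 - t) * f x + t * f y)"

text \<open>\<open>g\<close> is the gradient of \<open>f\<close> at \<open>x\<close>, in the Frechet sense.\<close>

definition has_gradient ::
    "nat \<Rightarrow> ((nat \<Rightarrow> real) \<Rightarrow> real) \<Rightarrow> (nat \<Rightarrow> real) \<Rightarrow> (nat \<Rightarrow> real) \<Rightarrow> bool" where
  "has_gradient d f g x \<longleftrightarrow>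
     (\<forall>e>0. \<exists>\<delta>>0. \<forall>z\<in>Rn d. edist d z x < \<delta> \<longrightarrow>
        \<bar>f z - f x - (\<Sum>i<d. g i * (z i - x i))\<bar> \<le> e * edist d z x)"

definition smooth_fun :: "nat \<Rightarrow> real \<Rightarrow> ((nat \<Rightarrow> real) \<Rightarrow> real) \<Rightarrow> bool" where
  "smooth_fun d \<beta> f \<longleftrightarrow>
     (\<exists>g. (\<forall>x\<in>Rn d. has_gradient d f (g x) x) \<and>
          (\<forall>x\<in>Rn d. \<forall>y\<in>Rn d. edist d (g x) (g y) \<le> \<beta> * edist d x y))"

text \<open>The probability measure with density proportional to \<open>exp (- V)\<close>; meaningful only if
  \<open>exp (- V)\<close> is integrable.\<close>

definition gibbs :: "nat \<Rightarrow> ((nat \<Rightarrow> real) \<Rightarrow> real) \<Rightarrow> (nat \<Rightarrow> real) measure" where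
  "gibbs d V = density (Leb d) (\<lambda>x. ennreal (exp (- V x) / (\<integral>z. exp (- V z) \<partial>Leb d)))"

text \<open>The normal distribution with mean \<open>m\<close> and covariance \<open>\<sigma>\<^sup>2 I\<close>.\<close>

definition gaussian :: "nat \<Rightarrow> (nat \<Rightarrow> real) \<Rightarrow> real \<Rightarrow> (nat \<Rightarrow> real) measure" where
  "gaussian d m \<sigma> = density (Leb d) (\<lambda>x. ennreal (\<Prod>i<d. normal_density (m i) \<sigma> (x i)))"

text \<open>The library's Kullback-Leibler divergence is a Bochner integral, which is 0 when the
  integrand is not integrable, and ignores singular parts; in both cases the divergence is \<open>\<infinity>\<close>
  here.  The argument order is that of \<open>H\<^sub>\<pi>(\<rho>)\<close>.\<close>

definition rel_entropy :: "'a measure \<Rightarrow> 'a measure \<Rightarrow> ereal" where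
  "rel_entropy \<pi> \<rho> =
     (if absolutely_continuous \<pi> \<rho> \<and> integrable \<rho> (entropy_density (exp 1) \<pi> \<rho>)
      then ereal (KL_divergence (exp 1) \<pi> \<rho>) else \<infinity>)"

definition couplings :: "'a measure \<Rightarrow> 'b measure \<Rightarrow> ('a \<times> 'b) measure set" where
  "couplings \<mu> \<nu> =
     {\<gamma>. prob_space \<gamma> \<and> sets \<gamma> = sets (\<mu> \<Otimes>\<^sub>M \<nu>) \<and> distr \<gamma> \<mu> fst = \<mu> \<and> distr \<gamma> \<nu> snd = \<nu>}"

text \<open>The square of the 2-Wasserstein distance.\<close>

definition W2_sq :: "nat \<Rightarrow> (nat \<Rightarrow> real) measure \<Rightarrow> (nat \<Rightarrow> real) measure \<Rightarrow> ennreal" where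
  "W2_sq d \<mu> \<nu> = (INF \<gamma>\<in>couplings \<mu> \<nu>. \<integral>\<^sup>+p. ennreal ((edist d (fst p) (snd p))\<^sup>2) \<partial>\<gamma>)"

definition prox_potential ::
    "((nat \<Rightarrow> real) \<Rightarrow> real) \<Rightarrow> nat \<Rightarrow> real \<Rightarrow> (nat \<Rightarrow> real) \<Rightarrow> (nat \<Rightarrow> real) \<Rightarrow> real" where
  "prox_potential f d \<eta> y x = f x + (edist d x y)\<^sup>2 / (2 * \<eta>)"

text \<open>The law of the \<open>k\<close>-th iterate of the ideal proximal sampler.\<close>

primrec proximal_law ::
    "nat \<Rightarrow> ((nat \<Rightarrow> real) \<Rightarrow> real) \<Rightarrow> real \<Rightarrow> (nat \<Rightarrow> real) measure \<Rightarrow> nat \<Rightarrow> (nat \<Rightarrow> real) measure" where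
  "proximal_law d f \<eta> \<rho>0 0 = \<rho>0"
| "proximal_law d f \<eta> \<rho>0 (Suc k) =
     (proximal_law d f \<eta> \<rho>0 k \<bind> (\<lambda>x. gaussian d x (sqrt \<eta>)))
       \<bind> (\<lambda>y. gibbs d (prox_potential f d \<eta> y))"

text \<open>
  Rejection sampling for \<open>gibbs d V\<close> with \<open>V\<close> being \<open>\<alpha>\<close>-strongly convex: the joint law of the output
  and of the number of proposals drawn.  The randomness is an i.i.d. sequence of pairs of a proposal
  and a uniform variable deciding its acceptance.  On the event that no proposal is ever accepted the
  number of proposals is \<open>\<infinity>\<close> and the output is an arbitrary point.
\<close>

definition rejection_sampling ::
    "nat \<Rightarrow> ((nat \<Rightarrow> real) \<Rightarrow> real) \<Rightarrow> real \<Rightarrow> ((nat \<Rightarrow> real) \<times> ennreal) measure" where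
  "rejection_sampling d V \<alpha> =
     (let xs = arg_min_on V (Rn d);
          accepts = (\<lambda>(z, u). u \<le> exp (- V z + V xs + \<alpha> / 2 * (edist d z xs)\<^sup>2))
      in distr
           (PiM (UNIV :: nat set)
              (\<lambda>_. gaussian d xs (1 / sqrt \<alpha>) \<Otimes>\<^sub>M uniform_measure lborel {0..1::real}))
           (Leb d \<Otimes>\<^sub>M borel)
           (\<lambda>\<omega>. if \<exists>n. accepts (\<omega> n)
                then let n = (LEAST n. accepts (\<omega> n)) in (fst (\<omega> n), of_nat (Suc n))
                else (xs, \<infinity>)))"

text \<open>
  The joint law of the \<open>k\<close>-th iterate and the total number of oracle calls made so far, when the
  proximal sampler is implemented by rejection sampling.  One iteration costs one call to the
  proximity operator, one evaluation of \<open>f\<close> at the minimizer, and one evaluation of \<open>f\<close> per proposal.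
\<close>

primrec proximal_sampler ::
    "nat \<Rightarrow> ((nat \<Rightarrow> real) \<Rightarrow> real) \<Rightarrow> real \<Rightarrow> real \<Rightarrow> (nat \<Rightarrow> real) measure \<Rightarrow> nat
      \<Rightarrow> ((nat \<Rightarrow> real) \<times> ennreal) measure" where
  "proximal_sampler d f \<beta> \<eta> \<rho>0 0 = distr \<rho>0 (Leb d \<Otimes>\<^sub>M borel) (\<lambda>x. (x, 0))"
| "proximal_sampler d f \<beta> \<eta> \<rho>0 (Suc k) =
     proximal_sampler d f \<beta> \<eta> \<rho>0 k \<bind> (\<lambda>(x, calls).
       gaussian d x (sqrt \<eta>) \<bind> (\<lambda>y.
         distr (rejection_sampling d (prox_potential f d \<eta> y) (1 / \<eta> - \<beta>)) (Leb d \<Otimes>\<^sub>M borel)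
           (\<lambda>(x', n). (x', calls + 2 + n))))"

end

theory Submission
  imports Defs
begin

text \<open>
  One round of the proximal sampler moves \<open>x\<close> to \<open>y \<sim> N(x, \<eta> I)\<close> and then to a draw from the
  backward channel \<open>bwd y \<propto> exp (- f - \<bar>\<cdot> - y\<bar>\<^sup>2 / (2 \<eta>))\<close>.  Write \<open>P\<close> for the
  corresponding operator on functions and \<open>\<pi>\<close> for the target.

  Entropy.  The bound \<open>H\<^sub>\<pi>(\<rho>\<^sub>n) \<le> W\<^sub>2\<^sup>2(\<rho>\<^sub>0, \<pi>) / (2 n \<eta>)\<close> is the integrated form of the
  log-Harnack inequality \<open>P\<^sup>n (ln F) x \<le> ln (P\<^sup>n F y) + \<bar>x - y\<bar>\<^sup>2 / (2 n \<eta>)\<close>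
  (\<open>log_harnack\<close>).  Indeed, integrating it against a coupling of \<open>\<rho>\<^sub>0\<close> and \<open>\<pi>\<close>, and using
  Jensen and the stationarity of \<open>\<pi>\<close>, gives
  \<open>\<integral> ln F d\<rho>\<^sub>n \<le> ln (\<integral> F d\<pi>) + W\<^sub>2\<^sup>2 / (2 n \<eta>)\<close> for bounded positive \<open>F\<close>; letting \<open>F\<close>
  increase to the density of \<open>\<rho>\<^sub>n\<close> turns the left-hand side into the entropy.

  For \<open>n = 1\<close> the inequality holds because Gaussians with means \<open>x\<close> and \<open>y\<close> have relative
  entropy \<open>\<bar>x - y\<bar>\<^sup>2 / (2 \<eta>)\<close>.  In the inductive step the displacement is split: the new
  Gaussian pays for the fraction \<open>1 / (n + 1)\<close> of it, and the remaining fraction is first carried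
  along by translating the Gaussian and then by the backward channel into the induction hypothesis.
  The costs \<open>s\<^sup>2 / n + (1 - s)\<^sup>2\<close> add up to \<open>1 / (n + 1)\<close> at \<open>s = n / (n + 1)\<close>.
  This needs the backward channel not to expand distances at all, since a constant factor would be
  compounded over the rounds (\<open>bwd_contraction\<close>).

  Nonexpansiveness.  The measures \<open>bwd y\<close> are \<open>1/\<eta>\<close>-strongly log-concave, so the
  Prekopa-Leindler inequality gives Talagrand's transport inequality for them in dual form.
  Two of them differ by an exponential tilt, so their symmetrised relative entropy is a difference
  of means of an affine function, which is at most \<open>\<bar>y - y'\<bar>\<^sup>2 / \<eta>\<close> because the normalising
  constant is a log-concave function of \<open>y\<close>, again by Prekopa-Leindler.

  Cost.  The potential in a round is \<open>1/\<eta>\<close>-strongly convex and, up to a term of order \<open>\<beta>\<close>, as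
  smooth, so with \<open>\<beta> \<eta> = c / d\<close> its condition number is \<open>1 + O(c / d)\<close> and a proposal is
  accepted with probability at least \<open>(1 - 4 c / d)\<^sup>d \<ge> 1 / 2\<close> if \<open>c \<le> 1 / 8\<close>.  A round thus makes at most
  four calls in expectation, and \<open>k\<close> rounds of order \<open>W\<^sub>2\<^sup>2 / (\<eta> \<epsilon>)\<close> suffice.
\<close>

section \<open>The Prekopa-Leindler inequality\<close>

lemma measure_lborel_affine_image:
  fixes A :: "real set"
  assumes A: "A \<in> sets borel" and c: "c > 0"
  shows "(\<lambda>x. a + c * x) ` A \<in> sets borel"
    and "measure lborel ((\<lambda>x. a + c * x) ` A) = c * measure lborel A"
proof -
  have im: "(\<lambda>x. a + c * x) ` A = (\<lambda>y. (y - a) / c) -` A"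
    using c by (auto simp: image_iff field_simps intro!: bexI[of _ "(x - a) / c" for x])
  show *: "(\<lambda>x. a + c * x) ` A \<in> sets borel"
    unfolding im using measurable_sets[of "\<lambda>y::real. (y - a) / c" borel borel A] A by simp
  have pre: "(\<lambda>x. a + c * x) -` ((\<lambda>x. a + c * x) ` A) = A"
    using c by auto
  have "emeasure lborel ((\<lambda>x. a + c * x) ` A)
      = emeasure (density (distr lborel borel (\<lambda>x. a + c * x)) (\<lambda>_. ennreal \<bar>c\<bar>)) ((\<lambda>x. a + c * x) ` A)"
    using c by (subst lborel_real_affine[of c a]) auto
  also have "\<dots> = ennreal c * emeasure lborel A"
    using * c by (simp add: emeasure_density_const emeasure_distr pre)
  finally show "measure lborel ((\<lambda>x. a + c * x) ` A) = c * measure lborel A"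
    using c by (simp add: measure_def enn2real_mult)
qed

lemma fmeasurable_lborel_bounded:
  fixes A :: "real set"
  assumes "A \<in> sets borel" "A \<subseteq> {a..b}"
  shows "A \<in> fmeasurable lborel"
  using assms bounded_subset[OF bounded_closed_interval assms(2)]
  by (auto intro!: fmeasurableI emeasure_bounded_finite)

text \<open>Up to \<open>\<epsilon>\<close>, let \<open>a\<close> be the top point of \<open>A\<close> and \<open>b\<close> the bottom point of \<open>B\<close>.  The
  images \<open>(1 - t) A + t b\<close> and \<open>(1 - t) a + t B\<close> both lie in \<open>C\<close> and overlap in a set of
  length at most \<open>\<epsilon>\<close>.\<close>

lemma brunn_minkowski_line:
  fixes A B C :: "real set"
  assumes sets: "A \<in> sets borel" "B \<in> sets borel" "C \<in> sets borel"
    and bnd: "A \<subseteq> {-R..R}" "B \<subseteq> {-R..R}" "C \<subseteq> {-R..R}"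
    and ne: "A \<noteq> {}" "B \<noteq> {}"
    and t: "0 < t" "t < 1"
    and C: "\<And>a b. a \<in> A \<Longrightarrow> b \<in> B \<Longrightarrow> (1 - t) * a + t * b \<in> C"
  shows "(1 - t) * measure lborel A + t * measure lborel B \<le> measure lborel C"
proof (rule field_le_epsilon)
  fix e :: real assume e: "e > 0"
  have bddA: "bdd_above A" using bnd(1) by (meson bdd_above_Icc bdd_above_mono)
  have bddB: "bdd_below B" using bnd(2) by (meson bdd_below_Icc bdd_below_mono)
  obtain a where a: "a \<in> A" "Sup A - e < a"
    using less_cSupE[of "Sup A - e" A] ne e by auto
  obtain b where b: "b \<in> B" "b < Inf B + e"
    using cInf_lessD[of B "Inf B + e"] ne e by auto
  define S where "S = (\<lambda>x. t * b + (1 - t) * x) ` A"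
  define T where "T = (\<lambda>x. (1 - t) * a + t * x) ` B"
  have S: "S \<in> sets borel" "measure lborel S = (1 - t) * measure lborel A"
    and T: "T \<in> sets borel" "measure lborel T = t * measure lborel B"
    unfolding S_def T_def using sets t by (auto intro!: measure_lborel_affine_image)
  have SC: "S \<union> T \<subseteq> C" using C a(1) b(1) by (auto simp: S_def T_def add.commute)
  have fin: "X \<in> fmeasurable lborel" if "X \<in> sets borel" "X \<subseteq> {-R..R}" for X
    using that by (rule fmeasurable_lborel_bounded)
  have fS: "S \<in> fmeasurable lborel" and fT: "T \<in> fmeasurable lborel"
    using fin[of S] fin[of T] S T SC bnd by auto
  define p q where "p = (1 - t) * a + t * Inf B" and "q = (1 - t) * Sup A + t * b"
  have "x \<le> q" if "x \<in> S" for x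
    using that bddA t by (auto simp: S_def q_def intro: cSup_upper)
  moreover have "p \<le> x" if "x \<in> T" for x
    using that bddB t by (auto simp: T_def p_def intro: cInf_lower)
  ultimately have sub: "S \<inter> T \<subseteq> {p..q}" by auto
  have "measure lborel (S \<inter> T) \<le> measure lborel {p..q}"
    using sub S T by (intro measure_mono_fmeasurable) (auto intro: fmeasurable_lborel_bounded)
  also have "\<dots> \<le> max 0 (q - p)" by (cases "p \<le> q") (auto simp: measure_def)
  also have "\<dots> \<le> e"
  proof -
    have "q - p = (1 - t) * (Sup A - a) + t * (b - Inf B)" by (simp add: p_def q_def algebra_simps)
    also have "\<dots> \<le> (1 - t) * e + t * e"
      using a b t by (intro add_mono mult_left_mono) auto
    finally show ?thesis using e by (simp add: algebra_simps)
  qed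
  finally have "measure lborel (S \<inter> T) \<le> e" .
  moreover have "measure lborel (S \<union> T) = measure lborel S + measure lborel T - measure lborel (S \<inter> T)"
    using fS fT by (simp add: measure_Un3)
  moreover have "measure lborel (S \<union> T) \<le> measure lborel C"
    using SC S T fin[of C] sets bnd by (intro measure_mono_fmeasurable) auto
  ultimately show "(1 - t) * measure lborel A + t * measure lborel B \<le> measure lborel C + e"
    using S T by linarith
qed

lemma nn_integral_layer_cake:
  fixes f :: "'a \<Rightarrow> real"
  assumes "sigma_finite_measure M" and [measurable]: "f \<in> borel_measurable M"
    and nn: "\<And>x. x \<in> space M \<Longrightarrow> 0 \<le> f x"
  shows "(\<integral>\<^sup>+x. ennreal (f x) \<partial>M)
       = (\<integral>\<^sup>+s. indicator {0..} s * emeasure M {x \<in> space M. s < f x} \<partial>lborel)"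
proof -
  interpret sigma_finite_measure M by fact
  interpret pair_sigma_finite M lborel ..
  have "(\<integral>\<^sup>+x. ennreal (f x) \<partial>M) = (\<integral>\<^sup>+x. \<integral>\<^sup>+s. indicator {s. 0 \<le> s \<and> s < f x} s \<partial>lborel \<partial>M)"
  proof (intro nn_integral_cong)
    fix x assume x: "x \<in> space M"
    have "{s. 0 \<le> s \<and> s < f x} = {0..<f x}" by auto
    then show "ennreal (f x) = (\<integral>\<^sup>+s. indicator {s. 0 \<le> s \<and> s < f x} s \<partial>lborel)"
      using nn[OF x] by simp
  qed
  also have "\<dots> = (\<integral>\<^sup>+s. \<integral>\<^sup>+x. indicator {s. 0 \<le> s \<and> s < f x} s \<partial>M \<partial>lborel)"
    by (rule Fubini'[symmetric]) measurable
  also have "\<dots> = (\<integral>\<^sup>+s. indicator {0..} s * emeasure M {x \<in> space M. s < f x} \<partial>lborel)"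
  proof (intro nn_integral_cong)
    fix s :: real
    have "(\<integral>\<^sup>+x. indicator {s. 0 \<le> s \<and> s < f x} s \<partial>M)
        = (\<integral>\<^sup>+x. indicator {0..} s * indicator {x \<in> space M. s < f x} x \<partial>M)"
      by (intro nn_integral_cong) (auto simp: indicator_def)
    then show "(\<integral>\<^sup>+x. indicator {s. 0 \<le> s \<and> s < f x} s \<partial>M)
        = indicator {0..} s * emeasure M {x \<in> space M. s < f x}"
      by (simp add: nn_integral_cmult)
  qed
  finally show ?thesis .
qed

lemma weighted_am_gm:
  fixes a b t :: real
  assumes "0 \<le> a" "0 \<le> b" "0 < t" "t < 1"
  shows "a powr (1 - t) * b powr t \<le> (1 - t) * a + t * b"
proof (cases "a = 0 \<or> b = 0")
  case False
  then show ?thesis using Youngs_inequality_0[of "1 - t" t a b] assms by auto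
qed (use assms in auto)

lemma integrable_bounded_support_line:
  fixes f :: "real \<Rightarrow> real"
  assumes [measurable]: "f \<in> borel_measurable borel"
    and "\<And>x. 0 \<le> f x" "\<And>x. f x \<le> M" "\<And>x. f x \<noteq> 0 \<Longrightarrow> x \<in> {-R..R}"
  shows "integrable lborel f"
proof (rule Bochner_Integration.integrable_bound[where f = "\<lambda>x. indicator {-R..R} x *\<^sub>R M"])
  show "AE x in lborel. norm (f x) \<le> norm (indicator {-R..R} x *\<^sub>R M)"
  proof (intro AE_I2)
    fix x show "norm (f x) \<le> norm (indicator {-R..R} x *\<^sub>R M)"
      using assms(2)[of x] assms(3)[of x] assms(4)[of x] by (cases "f x = 0") auto
  qed
  show "integrable lborel (\<lambda>x. indicator {-R..R} x *\<^sub>R M)"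
    using borel_integrable_compact[of "{-R..R}" "\<lambda>_. M"] by simp
qed simp

text \<open>After scaling \<open>f\<close> and \<open>g\<close> to supremum 1, all superlevel sets at heights below 1 are
  nonempty, and Brunn-Minkowski applies to them level by level.  Integrating over the height gives
  an arithmetic mean of the integrals, which dominates the geometric one.\<close>

lemma prekopa_leindler_line:
  fixes f g h :: "real \<Rightarrow> real"
  assumes meas [measurable]: "f \<in> borel_measurable borel" "g \<in> borel_measurable borel" "h \<in> borel_measurable borel"
    and nn: "\<And>x. 0 \<le> f x" "\<And>x. 0 \<le> g x" "\<And>x. 0 \<le> h x"
    and bd: "\<And>x. f x \<le> M" "\<And>x. g x \<le> M" "\<And>x. h x \<le> M"
    and supp: "\<And>x. f x \<noteq> 0 \<Longrightarrow> x \<in> {-R..R}" "\<And>x. g x \<noteq> 0 \<Longrightarrow> x \<in> {-R..R}" "\<And>x. h x \<noteq> 0 \<Longrightarrow> x \<in> {-R..R}"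
    and t: "0 < t" "t < 1"
    and le: "\<And>x y. f x powr (1 - t) * g y powr t \<le> h ((1 - t) * x + t * y)"
  shows "(\<integral>x. f x \<partial>lborel) powr (1 - t) * (\<integral>x. g x \<partial>lborel) powr t \<le> (\<integral>x. h x \<partial>lborel)"
proof (cases "(\<forall>x. f x = 0) \<or> (\<forall>x. g x = 0)")
  case True
  then have "(\<integral>x. f x \<partial>lborel) = 0 \<or> (\<integral>x. g x \<partial>lborel) = 0" by auto
  moreover have "0 \<le> (\<integral>x. h x \<partial>lborel)" using nn by simp
  ultimately show ?thesis by auto
next
  case False
  define A B where "A = Sup (range f)" and "B = Sup (range g)"
  have bdd: "bdd_above (range f)" "bdd_above (range g)" using bd by (auto simp: bdd_above_def)
  have fA: "f x \<le> A" for x unfolding A_def using bdd by (auto intro: cSup_upper)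
  have gB: "g x \<le> B" for x unfolding B_def using bdd by (auto intro: cSup_upper)
  obtain x0 y0 where "f x0 \<noteq> 0" "g y0 \<noteq> 0" using False by auto
  then have A: "A > 0" and B: "B > 0" using nn(1)[of x0] nn(2)[of y0] fA[of x0] gB[of y0] by linarith+
  define c where "c = A powr (1 - t) * B powr t"
  have c: "c > 0" using A B by (simp add: c_def)
  have intf: "integrable lborel f" and intg: "integrable lborel g" and inth: "integrable lborel h"
    using nn bd supp by (auto intro!: integrable_bounded_support_line[where M = M and R = R])
  have key: "indicator {0..} s * (ennreal (1 - t) * emeasure lborel {x \<in> space lborel. s < f x / A}
                + ennreal t * emeasure lborel {x \<in> space lborel. s < g x / B})
     \<le> indicator {0..} s * emeasure lborel {x \<in> space lborel. s < h x / c}" for s :: real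
  proof (cases "0 \<le> s \<and> s < 1")
    case True
    define P where "P = {x. s < f x / A}"
    define Q where "Q = {x. s < g x / B}"
    define H where "H = {x. s < h x / c}"
    have "\<exists>x. s * A < f x"
      using less_cSupD[of "range f" "s * A"] True A by (auto simp: A_def[symmetric])
    then have P: "P \<noteq> {}" using A by (auto simp: P_def field_simps)
    have "\<exists>x. s * B < g x"
      using less_cSupD[of "range g" "s * B"] True B by (auto simp: B_def[symmetric])
    then have Q: "Q \<noteq> {}" using B by (auto simp: Q_def field_simps)
    have [measurable]: "P \<in> sets borel" "Q \<in> sets borel" "H \<in> sets borel"
      unfolding P_def Q_def H_def by measurable
    have bndd: "P \<subseteq> {-R..R}" "Q \<subseteq> {-R..R}" "H \<subseteq> {-R..R}"
    proof -
      have "f x \<noteq> 0" if "x \<in> P" for x using that True by (auto simp: P_def)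
      moreover have "g x \<noteq> 0" if "x \<in> Q" for x using that True by (auto simp: Q_def)
      moreover have "h x \<noteq> 0" if "x \<in> H" for x using that True by (auto simp: H_def)
      ultimately show "P \<subseteq> {-R..R}" "Q \<subseteq> {-R..R}" "H \<subseteq> {-R..R}" using supp by blast+
    qed
    have "(1 - t) * x + t * y \<in> H" if "x \<in> P" "y \<in> Q" for x y
    proof -
      have "s * A < f x" "s * B < g y" using that A B by (auto simp: P_def Q_def field_simps)
      moreover have "0 \<le> s * A" "0 \<le> s * B" using True A B by auto
      ultimately have "(s * A) powr (1 - t) * (s * B) powr t < f x powr (1 - t) * g y powr t"
        using t by (intro mult_strict_mono powr_less_mono2) (auto simp del: mult_nonneg_nonneg)
      also have "(s * A) powr (1 - t) * (s * B) powr t = s powr (1 - t) * s powr t * c"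
        using True A B by (simp add: powr_mult c_def)
      also have "s powr (1 - t) * s powr t = s" using True by (simp flip: powr_add)
      finally show ?thesis using le[of x y] c by (auto simp: H_def field_simps)
    qed
    then have "(1 - t) * measure lborel P + t * measure lborel Q \<le> measure lborel H"
      using P Q t bndd by (intro brunn_minkowski_line[where R = R]) auto
    then have "ennreal ((1 - t) * measure lborel P + t * measure lborel Q) \<le> ennreal (measure lborel H)"
      by (rule ennreal_leI)
    moreover have "emeasure lborel X = ennreal (measure lborel X)" if "X \<in> sets borel" "X \<subseteq> {-R..R}" for X
      using that emeasure_bounded_finite[OF bounded_subset[OF bounded_closed_interval that(2)]]
      by (simp add: emeasure_eq_ennreal_measure)
    ultimately show ?thesis using True t bndd
      by (simp add: P_def[symmetric] Q_def[symmetric] H_def[symmetric] ennreal_plus ennreal_mult)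
  next
    case False
    have "\<not> s < f x / A" if "s \<ge> 1" for x using fA[of x] A that by (auto simp: field_simps not_less)
         (metis A fA less_eq_real_def mult.commute mult_left_mono mult.right_neutral order_trans)
    moreover have "\<not> s < g x / B" if "s \<ge> 1" for x using gB[of x] B that by (auto simp: field_simps not_less)
         (metis B gB less_eq_real_def mult.commute mult_left_mono mult.right_neutral order_trans)
    ultimately show ?thesis using False by (auto simp: indicator_def not_le)
  qed
  have "ennreal (1 - t) * (\<integral>\<^sup>+x. ennreal (f x / A) \<partial>lborel) + ennreal t * (\<integral>\<^sup>+x. ennreal (g x / B) \<partial>lborel)
      = (\<integral>\<^sup>+s. indicator {0..} s * (ennreal (1 - t) * emeasure lborel {x \<in> space lborel. s < f x / A}
                + ennreal t * emeasure lborel {x \<in> space lborel. s < g x / B}) \<partial>lborel)"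
    using nn A B
    by (subst (1 2) nn_integral_layer_cake)
       (auto simp: lborel.sigma_finite_measure_axioms distrib_left mult.left_commute nn_integral_add nn_integral_cmult)
  also have "\<dots> \<le> (\<integral>\<^sup>+s. indicator {0..} s * emeasure lborel {x \<in> space lborel. s < h x / c} \<partial>lborel)"
    by (intro nn_integral_mono key)
  also have "\<dots> = (\<integral>\<^sup>+x. ennreal (h x / c) \<partial>lborel)"
    using nn c by (subst nn_integral_layer_cake) (auto simp: lborel.sigma_finite_measure_axioms)
  finally have "ennreal ((1 - t) * ((\<integral>x. f x \<partial>lborel) / A) + t * ((\<integral>x. g x \<partial>lborel) / B))
      \<le> ennreal ((\<integral>x. h x \<partial>lborel) / c)"
    using nn A B c t intf intg inth
    by (simp add: nn_integral_eq_integral ennreal_plus flip: ennreal_mult')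
  then have "(1 - t) * ((\<integral>x. f x \<partial>lborel) / A) + t * ((\<integral>x. g x \<partial>lborel) / B) \<le> (\<integral>x. h x \<partial>lborel) / c"
    using nn c by (subst (asm) ennreal_le_iff) auto
  moreover have "((\<integral>x. f x \<partial>lborel) / A) powr (1 - t) * ((\<integral>x. g x \<partial>lborel) / B) powr t
       \<le> (1 - t) * ((\<integral>x. f x \<partial>lborel) / A) + t * ((\<integral>x. g x \<partial>lborel) / B)"
    using nn A B t by (intro weighted_am_gm) auto
  ultimately have "((\<integral>x. f x \<partial>lborel) / A) powr (1 - t) * ((\<integral>x. g x \<partial>lborel) / B) powr t \<le> (\<integral>x. h x \<partial>lborel) / c"
    by linarith
  then show ?thesis using c A B nn by (simp add: powr_divide c_def field_simps)
qed

interpretation Leb: product_sigma_finite "\<lambda>_::nat. lborel :: real measure"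
  by standard

lemma sigma_finite_Leb: "sigma_finite_measure (Leb d)"
  by (rule Leb.sigma_finite) simp

lemma space_Leb: "space (Leb d) = Rn d"
  by (simp add: space_PiM)

definition seg :: "nat \<Rightarrow> real \<Rightarrow> (nat \<Rightarrow> real) \<Rightarrow> (nat \<Rightarrow> real) \<Rightarrow> nat \<Rightarrow> real" where
  "seg d t x y = (\<lambda>i\<in>{..<d}. (1 - t) * x i + t * y i)"

lemma seg_in_Rn [simp]: "seg d t x y \<in> Rn d"
  by (simp add: seg_def)

lemma seg_nth [simp]: "i < d \<Longrightarrow> seg d t x y i = (1 - t) * x i + t * y i"
  by (simp add: seg_def)

abbreviation cube :: "nat \<Rightarrow> real \<Rightarrow> (nat \<Rightarrow> real) set" where
  "cube d R \<equiv> {..<d} \<rightarrow>\<^sub>E {-R..R}"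

lemma cube_sets [measurable]: "cube d R \<in> sets (Leb d)"
  by (intro sets_PiM_I_finite) auto

lemma emeasure_cube_finite: "emeasure (Leb d) (cube d R) < \<infinity>"
  by (subst Leb.emeasure_PiM) (auto simp: power_less_top_ennreal emeasure_lborel_Icc_eq)

lemma integrable_bounded_support:
  fixes f :: "(nat \<Rightarrow> real) \<Rightarrow> real"
  assumes [measurable]: "f \<in> borel_measurable (Leb d)"
    and "\<And>x. x \<in> Rn d \<Longrightarrow> 0 \<le> f x" "\<And>x. x \<in> Rn d \<Longrightarrow> f x \<le> M"
    and "\<And>x. x \<in> Rn d \<Longrightarrow> f x \<noteq> 0 \<Longrightarrow> x \<in> cube d R"
  shows "integrable (Leb d) f"
proof (rule Bochner_Integration.integrable_bound[where f = "\<lambda>x. indicator (cube d R) x * M"])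
  show "integrable (Leb d) (\<lambda>x. indicator (cube d R) x * M)"
    using emeasure_cube_finite by (intro integrable_mult_left integrable_real_indicator) auto
  show "AE x in Leb d. norm (f x) \<le> norm (indicator (cube d R) x * M)"
  proof (intro AE_I2)
    fix x assume "x \<in> space (Leb d)"
    then show "norm (f x) \<le> norm (indicator (cube d R) x * M)"
      using assms(2)[of x] assms(3)[of x] assms(4)[of x]
      by (cases "f x = 0") (auto simp: space_Leb)
  qed
qed simp

lemma integral_Leb_Suc:
  fixes f :: "(nat \<Rightarrow> real) \<Rightarrow> real"
  assumes "integrable (Leb (Suc d)) f"
  shows "(\<integral>x. f x \<partial>Leb (Suc d)) = (\<integral>x. \<integral>a. f (x(d := a)) \<partial>lborel \<partial>Leb d)"
  using Leb.product_integral_insert[of "{..<d}" d f] assms by (simp add: lessThan_Suc)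

text \<open>The sections in the last coordinate satisfy the hypothesis in one dimension, so their
  integrals satisfy it in the remaining dimensions.  Bounds and a common support keep the integrals
  of all sections finite.\<close>

lemma prekopa_leindler_cube:
  fixes f g h :: "(nat \<Rightarrow> real) \<Rightarrow> real"
  assumes "f \<in> borel_measurable (Leb d)" "g \<in> borel_measurable (Leb d)" "h \<in> borel_measurable (Leb d)"
    and "\<And>x. x \<in> Rn d \<Longrightarrow> 0 \<le> f x" "\<And>x. x \<in> Rn d \<Longrightarrow> 0 \<le> g x" "\<And>x. x \<in> Rn d \<Longrightarrow> 0 \<le> h x"
    and "\<And>x. x \<in> Rn d \<Longrightarrow> f x \<le> M" "\<And>x. x \<in> Rn d \<Longrightarrow> g x \<le> M" "\<And>x. x \<in> Rn d \<Longrightarrow> h x \<le> M"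
    and "\<And>x. x \<in> Rn d \<Longrightarrow> f x \<noteq> 0 \<Longrightarrow> x \<in> cube d R"
    and "\<And>x. x \<in> Rn d \<Longrightarrow> g x \<noteq> 0 \<Longrightarrow> x \<in> cube d R"
    and "\<And>x. x \<in> Rn d \<Longrightarrow> h x \<noteq> 0 \<Longrightarrow> x \<in> cube d R"
    and t: "0 < t" "t < 1" and R: "0 \<le> R"
    and "\<And>x y. x \<in> Rn d \<Longrightarrow> y \<in> Rn d \<Longrightarrow> f x powr (1 - t) * g y powr t \<le> h (seg d t x y)"
  shows "(\<integral>x. f x \<partial>Leb d) powr (1 - t) * (\<integral>x. g x \<partial>Leb d) powr t \<le> (\<integral>x. h x \<partial>Leb d)"
  using assms(1-12) assms(16)
proof (induction d arbitrary: f g h M)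
  case 0
  have "seg 0 t (\<lambda>_. undefined) (\<lambda>_. undefined) = (\<lambda>_. undefined)"
    by (simp add: seg_def restrict_def)
  then show ?case
    using 0(13)[of "\<lambda>_. undefined" "\<lambda>_. undefined"]
    by (simp add: PiM_empty lebesgue_integral_count_space_finite)
next
  case (Suc d)
  define S where "S = (\<lambda>(u::(nat \<Rightarrow> real) \<Rightarrow> real) x. \<integral>a. u (x(d := a)) \<partial>lborel)"
  have upd: "x(d := a) \<in> Rn (Suc d)" if "x \<in> Rn d" for x :: "nat \<Rightarrow> real" and a
    using that by (auto simp: PiE_iff extensional_def)
  have M: "0 \<le> M"
    using Suc.prems(4,7)[OF upd[of "\<lambda>i. if i < d then 0 else undefined" 0]]
    by (force simp: PiE_iff extensional_def)
  have joint: "(\<lambda>(x, a). u (x(d := a))) \<in> borel_measurable (Leb d \<Otimes>\<^sub>M lborel)"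
    if "u \<in> borel_measurable (Leb (Suc d))" for u :: "(nat \<Rightarrow> real) \<Rightarrow> real"
    using measurable_compose[OF measurable_add_dim[of d "{..<d}" "\<lambda>_. lborel"], of u borel] that
    by (simp add: lessThan_Suc split_beta')
  define good where "good u \<longleftrightarrow> u \<in> borel_measurable (Leb (Suc d)) \<and>
    (\<forall>x\<in>Rn (Suc d). 0 \<le> u x \<and> u x \<le> M \<and> (u x \<noteq> 0 \<longrightarrow> x \<in> cube (Suc d) R))" for u
  have sect: "S u \<in> borel_measurable (Leb d)" "\<And>x. x \<in> Rn d \<Longrightarrow> 0 \<le> S u x"
      "\<And>x. x \<in> Rn d \<Longrightarrow> S u x \<le> 2 * R * M" "\<And>x. x \<in> Rn d \<Longrightarrow> S u x \<noteq> 0 \<Longrightarrow> x \<in> cube d R"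
      "\<And>x. x \<in> Rn d \<Longrightarrow> (\<lambda>a. u (x(d := a))) \<in> borel_measurable borel"
      "\<And>x a. x \<in> Rn d \<Longrightarrow> u (x(d := a)) \<noteq> 0 \<Longrightarrow> a \<in> {-R..R}"
      "(\<integral>x. u x \<partial>Leb (Suc d)) = (\<integral>x. S u x \<partial>Leb d)"
    if "good u" for u
  proof -
    have u: "u \<in> borel_measurable (Leb (Suc d))" "\<And>x. x \<in> Rn (Suc d) \<Longrightarrow> 0 \<le> u x"
      "\<And>x. x \<in> Rn (Suc d) \<Longrightarrow> u x \<le> M" "\<And>x. x \<in> Rn (Suc d) \<Longrightarrow> u x \<noteq> 0 \<Longrightarrow> x \<in> cube (Suc d) R"
      using that by (auto simp: good_def)
    show "S u \<in> borel_measurable (Leb d)"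
      unfolding S_def by (rule lborel.borel_measurable_lebesgue_integral) (rule joint[OF u(1)])
    show "0 \<le> S u x" if "x \<in> Rn d" for x
      unfolding S_def using u(2)[OF upd[OF that]] by simp
    show m: "(\<lambda>a. u (x(d := a))) \<in> borel_measurable borel" if "x \<in> Rn d" for x
      using measurable_Pair2[OF joint[OF u(1)], of x] that by (simp add: space_Leb)
    show supp: "a \<in> {-R..R}" if "x \<in> Rn d" "u (x(d := a)) \<noteq> 0" for x a
      using PiE_mem[OF u(4)[OF upd[OF that(1)] that(2)], of d] by simp
    show "S u x \<le> 2 * R * M" if x: "x \<in> Rn d" for x
    proof -
      have "S u x \<le> (\<integral>a. indicator {-R..R} a * M \<partial>lborel)"
        unfolding S_def
      proof (rule integral_mono)
        show "integrable lborel (\<lambda>a. u (x(d := a)))"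
          using m[OF x] supp[OF x] u(2,3)[OF upd[OF x]]
          by (intro integrable_bounded_support_line[where M = M and R = R]) auto
        show "integrable lborel (\<lambda>a. indicator {-R..R} a * M)"
          by (intro integrable_mult_left integrable_real_indicator) (auto simp: emeasure_lborel_Icc_eq)
        show "u (x(d := a)) \<le> indicator {-R..R} a * M" for a
          using supp[OF x, of a] u(3)[OF upd[OF x]] by (cases "u (x(d := a)) = 0") (auto simp: M)
      qed
      also have "\<dots> = 2 * R * M" using R by simp
      finally show ?thesis .
    qed
    show "x \<in> cube d R" if x: "x \<in> Rn d" "S u x \<noteq> 0" for x
    proof -
      have "\<exists>a. u (x(d := a)) \<noteq> 0"
      proof (rule ccontr)
        assume "\<not> ?thesis"
        then show False using x(2) by (simp add: S_def)
      qed
      then obtain a where "x(d := a) \<in> cube (Suc d) R" using u(4)[OF upd[OF x(1)]] by blast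
      from PiE_mem[OF this] have "x i \<in> {-R..R}" if "i < d" for i
        using that by (metis fun_upd_apply lessThan_iff less_SucI nat_neq_iff)
      then show ?thesis using x(1) by (auto simp: PiE_iff)
    qed
    show "(\<integral>x. u x \<partial>Leb (Suc d)) = (\<integral>x. S u x \<partial>Leb d)"
      unfolding S_def by (rule integral_Leb_Suc) (rule integrable_bounded_support[OF u])
  qed
  have gf: "good f" unfolding good_def by (intro conjI ballI impI) (rule Suc.prems(1,4,7,10); assumption)+
  have gg: "good g" unfolding good_def by (intro conjI ballI impI) (rule Suc.prems(2,5,8,11); assumption)+
  have gh: "good h" unfolding good_def by (intro conjI ballI impI) (rule Suc.prems(3,6,9,12); assumption)+
  note F = sect[OF gf] and G = sect[OF gg] and H = sect[OF gh]
  have sections: "S f x powr (1 - t) * S g y powr t \<le> S h (seg d t x y)" if x: "x \<in> Rn d" and y: "y \<in> Rn d" for x y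
    unfolding S_def
  proof (rule prekopa_leindler_line[where M = M and R = R and f = "\<lambda>a. f (x(d := a))"
        and g = "\<lambda>a. g (y(d := a))" and h = "\<lambda>a. h ((seg d t x y)(d := a))"])
    fix a b :: real
    have "(seg d t x y)(d := (1 - t) * a + t * b) = seg (Suc d) t (x(d := a)) (y(d := b))"
      by (auto simp: seg_def fun_eq_iff)
    then show "f (x(d := a)) powr (1 - t) * g (y(d := b)) powr t \<le> h ((seg d t x y)(d := (1 - t) * a + t * b))"
      using Suc.prems(13)[OF upd[OF x, of a] upd[OF y, of b]] by metis
  next
    fix a :: real
    show "0 \<le> f (x(d := a))" "f (x(d := a)) \<le> M" "0 \<le> g (y(d := a))" "g (y(d := a)) \<le> M"
      "0 \<le> h ((seg d t x y)(d := a))" "h ((seg d t x y)(d := a)) \<le> M"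
      by (rule Suc.prems(4-9), rule upd, rule x y seg_in_Rn)+
    show "f (x(d := a)) \<noteq> 0 \<Longrightarrow> a \<in> {-R..R}" by (rule F(6)[OF x])
    show "g (y(d := a)) \<noteq> 0 \<Longrightarrow> a \<in> {-R..R}" by (rule G(6)[OF y])
    show "h ((seg d t x y)(d := a)) \<noteq> 0 \<Longrightarrow> a \<in> {-R..R}" by (rule H(6)[OF seg_in_Rn])
  qed (rule t F(5)[OF x] G(5)[OF y] H(5)[OF seg_in_Rn])+
  have main: "(\<integral>x. S f x \<partial>Leb d) powr (1 - t) * (\<integral>x. S g x \<partial>Leb d) powr t \<le> (\<integral>x. S h x \<partial>Leb d)"
  proof (rule Suc.IH[of "S f" "S g" "S h" "2 * R * M", OF F(1) G(1) H(1)])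
    fix x assume x: "x \<in> Rn d"
    show "0 \<le> S f x" "0 \<le> S g x" "0 \<le> S h x" by (rule F(2)[OF x] G(2)[OF x] H(2)[OF x])+
    show "S f x \<le> 2 * R * M" "S g x \<le> 2 * R * M" "S h x \<le> 2 * R * M"
      by (rule F(3)[OF x] G(3)[OF x] H(3)[OF x])+
    show "S f x \<noteq> 0 \<Longrightarrow> x \<in> cube d R" by (rule F(4)[OF x])
    show "S g x \<noteq> 0 \<Longrightarrow> x \<in> cube d R" by (rule G(4)[OF x])
    show "S h x \<noteq> 0 \<Longrightarrow> x \<in> cube d R" by (rule H(4)[OF x])
    fix y assume y: "y \<in> Rn d"
    show "S f x powr (1 - t) * S g y powr t \<le> S h (seg d t x y)" by (rule sections[OF x y])
  qed
  show ?case by (subst F(7), subst G(7), subst H(7), rule main)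
qed

text \<open>Truncation preserves the hypothesis because the cube is convex.\<close>

lemma prekopa_leindler:
  fixes f g h :: "(nat \<Rightarrow> real) \<Rightarrow> real"
  assumes int: "integrable (Leb d) f" "integrable (Leb d) g" "integrable (Leb d) h"
    and nn: "\<And>x. x \<in> Rn d \<Longrightarrow> 0 \<le> f x" "\<And>x. x \<in> Rn d \<Longrightarrow> 0 \<le> g x" "\<And>x. x \<in> Rn d \<Longrightarrow> 0 \<le> h x"
    and t: "0 < t" "t < 1"
    and le: "\<And>x y. x \<in> Rn d \<Longrightarrow> y \<in> Rn d \<Longrightarrow> f x powr (1 - t) * g y powr t \<le> h (seg d t x y)"
  shows "(\<integral>x. f x \<partial>Leb d) powr (1 - t) * (\<integral>x. g x \<partial>Leb d) powr t \<le> (\<integral>x. h x \<partial>Leb d)"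
proof -
  define T where "T = (\<lambda>(u::(nat \<Rightarrow> real) \<Rightarrow> real) (n::nat) x. indicator (cube d n) x * min (u x) n)"
  have [measurable]: "f \<in> borel_measurable (Leb d)" "g \<in> borel_measurable (Leb d)" "h \<in> borel_measurable (Leb d)"
    using int by auto
  have lim: "(\<lambda>n. \<integral>x. T u n x \<partial>Leb d) \<longlonglongrightarrow> (\<integral>x. u x \<partial>Leb d)"
    if u: "integrable (Leb d) u" "\<And>x. x \<in> Rn d \<Longrightarrow> 0 \<le> u x" for u
  proof (rule integral_dominated_convergence[where w = u])
    have [measurable]: "u \<in> borel_measurable (Leb d)" using u by auto
    show "T u n \<in> borel_measurable (Leb d)" for n unfolding T_def by measurable
    show "AE x in Leb d. (\<lambda>n. T u n x) \<longlonglongrightarrow> u x"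
    proof (intro AE_I2 tendsto_eventually)
      fix x assume "x \<in> space (Leb d)"
      then have x: "x \<in> Rn d" by (simp add: space_Leb)
      obtain n0 :: nat where n0: "(\<Sum>i<d. \<bar>x i\<bar>) + \<bar>u x\<bar> \<le> real n0" using real_arch_simple by blast
      have "T u n x = u x" if "n \<ge> n0" for n
      proof -
        have *: "\<bar>x i\<bar> \<le> real n" if "i < d" for i
        proof -
          have "\<bar>x i\<bar> \<le> (\<Sum>i<d. \<bar>x i\<bar>)" using that by (intro member_le_sum) auto
          then show ?thesis using n0 \<open>n \<ge> n0\<close> by linarith
        qed
        have "x i \<in> {-real n..real n}" if "i < d" for i using *[OF that] by auto
        then have "x \<in> cube d n" using x by (auto simp: PiE_iff)
        moreover have "u x \<le> n"
        proof -
          have "0 \<le> (\<Sum>i<d. \<bar>x i\<bar>)" by (simp add: sum_nonneg)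
          then show ?thesis using n0 \<open>n \<ge> n0\<close> by linarith
        qed
        ultimately show ?thesis unfolding T_def by (simp del: PiE_iff)
      qed
      then show "\<forall>\<^sub>F n in sequentially. T u n x = u x" by (rule eventually_sequentiallyI)
    qed
    show "AE x in Leb d. norm (T u n x) \<le> u x" for n
    proof (intro AE_I2)
      fix x assume "x \<in> space (Leb d)"
      then have "0 \<le> u x" using u(2) by (simp add: space_Leb)
      then show "norm (T u n x) \<le> u x" by (simp add: T_def indicator_def)
    qed
  qed (use u in auto)
  have Tm: "T u n \<in> borel_measurable (Leb d)" if "u \<in> borel_measurable (Leb d)" for u n
    unfolding T_def using that by measurable
  have T0: "0 \<le> T u n x" if "0 \<le> u x" for u n x using that by (simp add: T_def)
  have TM: "T u n x \<le> real n" for u n x by (simp add: T_def indicator_def)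
  have TR: "x \<in> cube d (real n)" if "T u n x \<noteq> 0" for u n x
    using that by (simp add: T_def indicator_def split: if_splits)
  have Tu: "T u n x \<le> u x" if "0 \<le> u x" for u n x using that by (simp add: T_def indicator_def)
  have step: "(\<integral>x. T f n x \<partial>Leb d) powr (1 - t) * (\<integral>x. T g n x \<partial>Leb d) powr t \<le> (\<integral>x. h x \<partial>Leb d)" for n
  proof -
    have "(\<integral>x. T f n x \<partial>Leb d) powr (1 - t) * (\<integral>x. T g n x \<partial>Leb d) powr t \<le> (\<integral>x. T h n x \<partial>Leb d)"
    proof (rule prekopa_leindler_cube[where M = "real n" and R = "real n"])
      fix x y :: "nat \<Rightarrow> real" assume x: "x \<in> Rn d" and y: "y \<in> Rn d"
      show "T f n x powr (1 - t) * T g n y powr t \<le> T h n (seg d t x y)"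
      proof (cases "x \<in> cube d n \<and> y \<in> cube d n")
        case True
        have "seg d t x y \<in> cube d n"
        proof (rule PiE_I)
          fix i assume "i \<in> {..<d}"
          with True have "x i \<in> {-real n..real n}" "y i \<in> {-real n..real n}" by (auto simp: PiE_iff)
          then have "(1 - t) *\<^sub>R x i + t *\<^sub>R y i \<in> {-real n..real n}"
            using convex_real_interval(5) t unfolding convex_alt by (metis less_imp_le)
          then show "seg d t x y i \<in> {-real n..real n}" using \<open>i \<in> {..<d}\<close> by simp
        qed (simp add: seg_def)
        moreover have "min (f x) n powr (1 - t) * min (g y) n powr t \<le> f x powr (1 - t) * g y powr t"
          using nn x y t by (intro mult_mono powr_mono2) auto
        moreover have "min (f x) n powr (1 - t) * min (g y) n powr t \<le> real n powr (1 - t) * real n powr t"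
          using nn x y t by (intro mult_mono powr_mono2) auto
        moreover have "real n powr (1 - t) * real n powr t = n" by (simp flip: powr_add)
        ultimately show ?thesis using True le[OF x y] by (simp add: T_def)
      next
        case False
        then have "T f n x = 0 \<or> T g n y = 0" using TR by blast
        then show ?thesis using T0[of h, OF nn(3)[OF seg_in_Rn[of d t x y]]] t by auto
      qed
    qed (rule Tm T0 TM TR t nn of_nat_0_le_iff; (measurable | assumption))+
    also have "\<dots> \<le> (\<integral>x. h x \<partial>Leb d)"
    proof (rule integral_mono)
      show "integrable (Leb d) (T h n)"
      proof (rule Bochner_Integration.integrable_bound[OF int(3) Tm], measurable, intro AE_I2)
        fix x assume "x \<in> space (Leb d)"
        then have "0 \<le> h x" using nn(3) by (simp add: space_Leb)
        from T0[of h, OF this] Tu[of h, OF this] show "norm (T h n x) \<le> norm (h x)"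
          using \<open>0 \<le> h x\<close> by simp
      qed
      show "T h n x \<le> h x" if "x \<in> space (Leb d)" for x
        using Tu nn(3) that by (simp add: space_Leb)
    qed (rule int)
    finally show ?thesis .
  qed
  have "0 \<le> (\<integral>x. T u n x \<partial>Leb d)" if "\<And>x. x \<in> Rn d \<Longrightarrow> 0 \<le> u x" for u n
    using T0 that by (intro integral_nonneg_AE AE_I2) (auto simp: space_Leb)
  then have "(\<lambda>n. (\<integral>x. T f n x \<partial>Leb d) powr (1 - t)) \<longlonglongrightarrow> (\<integral>x. f x \<partial>Leb d) powr (1 - t)"
      "(\<lambda>n. (\<integral>x. T g n x \<partial>Leb d) powr t) \<longlonglongrightarrow> (\<integral>x. g x \<partial>Leb d) powr t"
    using t nn by (auto intro!: tendsto_powr2 lim int always_eventually)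
  from LIMSEQ_le_const2[OF tendsto_mult[OF this]] step show ?thesis by blast
qed

section \<open>Distances, measurability and gradients\<close>

lemma edist_sq: "(edist d x y)\<^sup>2 = (\<Sum>i<d. (x i - y i)\<^sup>2)"
  by (simp add: edist_def L2_set_def sum_nonneg)

lemma edist_nonneg [simp]: "0 \<le> edist d x y"
  by (simp add: edist_def)

lemma edist_commute: "edist d x y = edist d y x"
  by (simp add: edist_def L2_set_def power2_commute)

lemma edist_le_sum: "edist d x y \<le> (\<Sum>i<d. \<bar>x i - y i\<bar>)"
  unfolding edist_def by (rule L2_set_le_sum_abs)

lemma coord_le_edist: "i < d \<Longrightarrow> \<bar>x i - y i\<bar> \<le> edist d x y"
  using member_le_L2_set[of "{..<d}" i "\<lambda>i. \<bar>x i - y i\<bar>"]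
  by (simp add: edist_def L2_set_def)

lemma edist_eq_cong: "(\<And>i. i < d \<Longrightarrow> x i - y i = x' i - y' i) \<Longrightarrow> edist d x y = edist d x' y'"
  unfolding edist_def by (intro L2_set_cong) auto

lemma sq_edist_seg:
  "(edist d (seg d t x z) y)\<^sup>2
     = (1 - t) * (edist d x y)\<^sup>2 + t * (edist d z y)\<^sup>2 - t * (1 - t) * (edist d x z)\<^sup>2"
proof -
  have "(\<Sum>i<d. ((1 - t) * x i + t * z i - y i)\<^sup>2)
      = (\<Sum>i<d. (1 - t) * (x i - y i)\<^sup>2 + t * (z i - y i)\<^sup>2 - t * (1 - t) * (x i - z i)\<^sup>2)"
    by (intro sum.cong refl) (simp add: power2_eq_square algebra_simps)
  then show ?thesis
    by (simp add: edist_sq sum.distrib sum_subtractf sum_distrib_left)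
qed

text \<open>An open set is the union of the cubes with rational center and radius that it contains.\<close>

lemma open_in_sets_Leb:
  assumes S: "S \<subseteq> Rn d"
    and op: "\<And>x. x \<in> S \<Longrightarrow> \<exists>\<delta>>0. \<forall>z\<in>Rn d. edist d z x < \<delta> \<longrightarrow> z \<in> S"
  shows "S \<in> sets (Leb d)"
proof -
  define C where "C = (\<lambda>(q::nat \<Rightarrow> real, r::real). \<Pi>\<^sub>E i\<in>{..<d}. {q i - r<..<q i + r})"
  define I where "I = {p \<in> ({..<d} \<rightarrow>\<^sub>E \<rat>) \<times> \<rat>. C p \<subseteq> S}"
  have "countable ((({..<d} \<rightarrow>\<^sub>E \<rat>) :: (nat \<Rightarrow> real) set) \<times> (\<rat> :: real set))"
    by (intro countable_SIGMA countable_PiE countable_rat) auto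
  moreover have "I \<subseteq> ({..<d} \<rightarrow>\<^sub>E \<rat>) \<times> \<rat>" unfolding I_def by (rule Collect_restrict)
  ultimately have cI: "countable I" by (rule countable_subset[rotated])
  have Cs: "C p \<in> sets (Leb d)" for p
    unfolding C_def split_beta by (intro sets_PiM_I_finite) auto
  have "S = (\<Union>p\<in>I. C p)"
  proof (intro equalityI subsetI)
    fix x assume x: "x \<in> S"
    from op[OF x] obtain \<delta> where \<delta>: "\<delta> > 0" "\<And>z. z \<in> Rn d \<Longrightarrow> edist d z x < \<delta> \<Longrightarrow> z \<in> S" by blast
    have "0 < \<delta> / (2 * (real d + 1))" using \<delta> by simp
    from Rats_dense_in_real[OF this] obtain r where r: "r \<in> \<rat>" "0 < r" "r < \<delta> / (2 * (real d + 1))" by blast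
    have "\<exists>q. q \<in> \<rat> \<and> x i - r < q \<and> q < x i + r" for i
      using Rats_dense_in_real[of "x i - r" "x i + r"] r by auto
    then obtain q0 where q0: "\<And>i. q0 i \<in> \<rat>" "\<And>i. x i - r < q0 i" "\<And>i. q0 i < x i + r" by metis
    define q where "q = restrict q0 {..<d}"
    have "x i \<in> {q i - r<..<q i + r}" if "i < d" for i
      using q0(2,3)[of i] that by (simp add: q_def)
    then have xC: "x \<in> C (q, r)"
      using subsetD[OF S x] unfolding C_def prod.case PiE_iff by blast
    have "C (q, r) \<subseteq> S"
    proof
      fix z assume z: "z \<in> C (q, r)"
      have "edist d z x \<le> (\<Sum>i<d. \<bar>z i - x i\<bar>)" by (rule edist_le_sum)
      also have "\<dots> \<le> (\<Sum>i<d. 2 * r)"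
      proof (intro sum_mono)
        fix i assume "i \<in> {..<d}"
        then have "z i \<in> {q i - r<..<q i + r}" "x i \<in> {q i - r<..<q i + r}" using z xC unfolding C_def prod.case PiE_iff by blast+
        then show "\<bar>z i - x i\<bar> \<le> 2 * r" by auto
      qed
      also have "\<dots> = real d * (2 * r)" by simp
      also have "\<dots> \<le> (real d + 1) * (2 * r)" using r by (intro mult_right_mono) auto
      also have "\<dots> < \<delta>" using r by (simp add: field_simps)
      finally have "edist d z x < \<delta>" .
      moreover have "z \<in> Rn d" using z unfolding C_def prod.case PiE_iff by blast
      ultimately show "z \<in> S" using \<delta>(2) by blast
    qed
    moreover have "q \<in> {..<d} \<rightarrow>\<^sub>E \<rat>" using q0 unfolding q_def by simp
    ultimately have "(q, r) \<in> I" using r unfolding I_def by blast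
    then show "x \<in> (\<Union>p\<in>I. C p)" using xC by blast
  next
    fix x assume "x \<in> (\<Union>p\<in>I. C p)"
    then show "x \<in> S" unfolding I_def by blast
  qed
  also have "\<dots> \<in> sets (Leb d)" using cI Cs by (intro sets.countable_UN'') auto
  finally show ?thesis .
qed

lemma usc_measurable_Leb:
  fixes g :: "(nat \<Rightarrow> real) \<Rightarrow> real"
  assumes "\<And>x e. x \<in> Rn d \<Longrightarrow> e > 0 \<Longrightarrow> \<exists>\<delta>>0. \<forall>z\<in>Rn d. edist d z x < \<delta> \<longrightarrow> g z < g x + e"
  shows "g \<in> borel_measurable (Leb d)"
  unfolding borel_measurable_iff_less
proof
  fix a
  show "{w \<in> space (Leb d). g w < a} \<in> sets (Leb d)"
  proof (rule open_in_sets_Leb)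
    fix x assume "x \<in> {w \<in> space (Leb d). g w < a}"
    then have "x \<in> Rn d" "a - g x > 0" by (simp_all add: space_Leb)
    from assms[OF this] obtain \<delta> where \<delta>: "\<delta> > 0" "\<forall>z\<in>Rn d. edist d z x < \<delta> \<longrightarrow> g z < g x + (a - g x)"
      by blast
    then show "\<exists>\<delta>>0. \<forall>z\<in>Rn d. edist d z x < \<delta> \<longrightarrow> z \<in> {w \<in> space (Leb d). g w < a}"
      unfolding space_Leb by (intro exI[of _ \<delta>]) simp
  qed (simp add: space_Leb)
qed

lemma measurable_edist [measurable]:
  assumes [measurable]: "f \<in> M \<rightarrow>\<^sub>M Leb d" "g \<in> M \<rightarrow>\<^sub>M Leb d"
  shows "(\<lambda>x. edist d (f x) (g x)) \<in> borel_measurable M"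
proof -
  have "(\<lambda>x. f x i) \<in> borel_measurable M" "(\<lambda>x. g x i) \<in> borel_measurable M" if "i \<in> {..<d}" for i
    using measurable_compose[OF assms(1) measurable_component_singleton[OF that]]
      measurable_compose[OF assms(2) measurable_component_singleton[OF that]] by auto
  then show ?thesis unfolding edist_def L2_set_def by measurable
qed

lemma inner_le_edist:
  "\<bar>\<Sum>i<d. g i * (z i - x i)\<bar> \<le> L2_set g {..<d} * edist d z x"
proof -
  have "\<bar>\<Sum>i<d. g i * (z i - x i)\<bar> \<le> (\<Sum>i<d. \<bar>g i\<bar> * \<bar>z i - x i\<bar>)"
    by (rule order_trans[OF sum_abs]) (simp add: abs_mult)
  also have "\<dots> \<le> L2_set g {..<d} * L2_set (\<lambda>i. z i - x i) {..<d}" by (rule L2_set_mult_ineq)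
  finally show ?thesis by (simp add: edist_def)
qed

lemma has_gradient_bound:
  assumes "has_gradient d f g x"
  shows "\<exists>\<delta>>0. \<exists>L\<ge>0. \<forall>z\<in>Rn d. edist d z x < \<delta> \<longrightarrow> \<bar>f z - f x\<bar> \<le> L * edist d z x"
proof -
  from assms[unfolded has_gradient_def, rule_format, OF zero_less_one] obtain \<delta> where \<delta>: "\<delta> > 0"
    "\<And>z. z \<in> Rn d \<Longrightarrow> edist d z x < \<delta> \<Longrightarrow> \<bar>f z - f x - (\<Sum>i<d. g i * (z i - x i))\<bar> \<le> 1 * edist d z x"
    by auto
  have "\<bar>f z - f x\<bar> \<le> (1 + L2_set g {..<d}) * edist d z x" if "z \<in> Rn d" "edist d z x < \<delta>" for z
    using \<delta>(2)[OF that] inner_le_edist[of g z x d] unfolding distrib_right by linarith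
  moreover have "0 \<le> 1 + L2_set g {..<d}" by simp
  ultimately show ?thesis using \<delta>(1) by blast
qed

lemma has_gradient_continuous:
  assumes "has_gradient d f g x" "e > 0"
  shows "\<exists>\<delta>>0. \<forall>z\<in>Rn d. edist d z x < \<delta> \<longrightarrow> \<bar>f z - f x\<bar> < e"
proof -
  from has_gradient_bound[OF assms(1)] obtain \<delta> L where *: "\<delta> > 0" "L \<ge> 0"
    "\<And>z. z \<in> Rn d \<Longrightarrow> edist d z x < \<delta> \<Longrightarrow> \<bar>f z - f x\<bar> \<le> L * edist d z x" by blast
  have "\<bar>f z - f x\<bar> < e" if "z \<in> Rn d" "edist d z x < min \<delta> (e / (L + 1))" for z
  proof -
    have "\<bar>f z - f x\<bar> \<le> L * edist d z x" using * that by auto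
    also have "\<dots> \<le> (L + 1) * edist d z x" by (intro mult_right_mono) auto
    also have "\<dots> < e" using that *(2) by (simp add: field_simps)
    finally show ?thesis .
  qed
  then show ?thesis using *(1,2) \<open>e > 0\<close> by (intro exI[of _ "min \<delta> (e / (L + 1))"]) auto
qed

definition ray :: "nat \<Rightarrow> (nat \<Rightarrow> real) \<Rightarrow> (nat \<Rightarrow> real) \<Rightarrow> real \<Rightarrow> nat \<Rightarrow> real" where
  "ray d x w s = (\<lambda>i\<in>{..<d}. x i + s * w i)"

lemma ray_in_Rn [simp]: "ray d x w s \<in> Rn d"
  by (simp add: ray_def)

lemma ray_nth [simp]: "i < d \<Longrightarrow> ray d x w s i = x i + s * w i"
  by (simp add: ray_def)

lemma edist_ray: "edist d (ray d x w s) (ray d x w r) = \<bar>s - r\<bar> * L2_set w {..<d}"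
proof -
  have "edist d (ray d x w s) (ray d x w r) = L2_set (\<lambda>i. (s - r) * w i) {..<d}"
    unfolding edist_def by (intro L2_set_cong) (auto simp: algebra_simps)
  also have "\<dots> = \<bar>s - r\<bar> * L2_set w {..<d}"
    by (simp add: L2_set_def power_mult_distrib real_sqrt_mult flip: sum_distrib_left)
  finally show ?thesis .
qed

lemma has_gradient_ray:
  assumes "has_gradient d f g (ray d x w s)"
  shows "((\<lambda>s. f (ray d x w s)) has_real_derivative (\<Sum>i<d. g i * w i)) (at s)"
  unfolding has_field_derivative_def has_derivative_at_alt
proof (intro conjI allI impI)
  show "bounded_linear ((*) (\<Sum>i<d. g i * w i))" by (rule bounded_linear_mult_right)
  fix e :: real assume e: "e > 0"
  define N where "N = L2_set w {..<d}"
  have N: "N \<ge> 0" by (simp add: N_def)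
  then have "e / (N + 1) > 0" using e by simp
  from assms[unfolded has_gradient_def, rule_format, OF this] obtain \<delta> where \<delta>: "\<delta> > 0"
    "\<And>z. z \<in> Rn d \<Longrightarrow> edist d z (ray d x w s) < \<delta> \<Longrightarrow>
      \<bar>f z - f (ray d x w s) - (\<Sum>i<d. g i * (z i - ray d x w s i))\<bar> \<le> e / (N + 1) * edist d z (ray d x w s)"
    by auto
  have "norm (f (ray d x w r) - f (ray d x w s) - (\<Sum>i<d. g i * w i) * (r - s)) \<le> e * norm (r - s)"
    if "norm (r - s) < \<delta> / (N + 1)" for r
  proof -
    have "\<bar>r - s\<bar> * N \<le> \<bar>r - s\<bar> * (N + 1)" by (intro mult_left_mono) auto
    also have "\<dots> < \<delta>" using that N by (simp add: field_simps)
    finally have "edist d (ray d x w r) (ray d x w s) < \<delta>" by (simp add: edist_ray N_def)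
    from \<delta>(2)[OF _ this]
    have "\<bar>f (ray d x w r) - f (ray d x w s) - (\<Sum>i<d. g i * (ray d x w r i - ray d x w s i))\<bar>
       \<le> e / (N + 1) * (\<bar>r - s\<bar> * N)" by (simp add: edist_ray N_def)
    also have "(\<Sum>i<d. g i * (ray d x w r i - ray d x w s i)) = (\<Sum>i<d. g i * w i) * (r - s)"
      unfolding sum_distrib_right by (intro sum.cong) (auto simp: algebra_simps)
    also have "e / (N + 1) * (\<bar>r - s\<bar> * N) = (N / (N + 1)) * (e * \<bar>r - s\<bar>)" by (simp add: field_simps)
    also have "\<dots> \<le> 1 * (e * \<bar>r - s\<bar>)" using N e by (intro mult_right_mono) auto
    finally show ?thesis by simp
  qed
  then show "\<exists>\<delta>>0. \<forall>r. norm (r - s) < \<delta> \<longrightarrow>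
      norm (f (ray d x w r) - f (ray d x w s) - (\<Sum>i<d. g i * w i) * (r - s)) \<le> e * norm (r - s)"
    using \<delta>(1) N by (intro exI[of _ "\<delta> / (N + 1)"]) auto
qed

lemma convex_above_tangent:
  assumes cv: "convex_fun d f" and g: "has_gradient d f g x" and x: "x \<in> Rn d" and z: "z \<in> Rn d"
  shows "f x + (\<Sum>i<d. g i * (z i - x i)) \<le> f z"
proof (rule field_le_epsilon)
  fix e :: real assume e: "e > 0"
  define N where "N = edist d z x"
  have N: "N \<ge> 0" by (simp add: N_def)
  then have "e / (N + 1) > 0" using e by simp
  from g[unfolded has_gradient_def, rule_format, OF this] obtain \<delta> where \<delta>: "\<delta> > 0"
    "\<And>z. z \<in> Rn d \<Longrightarrow> edist d z x < \<delta> \<Longrightarrow>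
      \<bar>f z - f x - (\<Sum>i<d. g i * (z i - x i))\<bar> \<le> e / (N + 1) * edist d z x"
    by auto
  define t where "t = min 1 (\<delta> / (2 * (N + 1)))"
  have t: "0 < t" "t \<le> 1" using \<delta> N by (auto simp: t_def)
  have dist: "edist d (seg d t x z) x = t * N"
  proof -
    have "edist d (seg d t x z) x = edist d (ray d x (\<lambda>i. z i - x i) t) (ray d x (\<lambda>i. z i - x i) 0)"
      by (rule edist_eq_cong) (simp add: algebra_simps)
    then show ?thesis using t unfolding edist_ray by (simp add: N_def edist_def)
  qed
  have "t * N \<le> \<delta> / (2 * (N + 1)) * (N + 1)" using N \<delta> by (intro mult_mono) (auto simp: t_def)
  also have "\<dots> = \<delta> / 2"
  proof -
    have "\<delta> / (2 * M) * M = \<delta> / 2" if "M \<noteq> 0" for M using that by simp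
    moreover have "N + 1 \<noteq> 0" using N by linarith
    ultimately show ?thesis by blast
  qed
  also have "\<dots> < \<delta>" using \<delta> by simp
  finally have "\<bar>f (seg d t x z) - f x - (\<Sum>i<d. g i * (seg d t x z i - x i))\<bar> \<le> e / (N + 1) * (t * N)"
    using \<delta>(2)[of "seg d t x z"] dist by simp
  moreover have "(\<Sum>i<d. g i * (seg d t x z i - x i)) = t * (\<Sum>i<d. g i * (z i - x i))"
    unfolding sum_distrib_left by (intro sum.cong) (auto simp: algebra_simps)
  moreover have "f (seg d t x z) \<le> (1 - t) * f x + t * f z"
    using cv x z t unfolding convex_fun_def seg_def by auto
  moreover have "e / (N + 1) * (t * N) \<le> t * e"
    using N e t by (simp add: field_simps)
  ultimately have "t * (f x + (\<Sum>i<d. g i * (z i - x i))) \<le> t * (f z + e)"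
    by (simp add: algebra_simps)
  then show "f x + (\<Sum>i<d. g i * (z i - x i)) \<le> f z + e" using t by simp
qed

lemma smooth_has_gradient:
  assumes "smooth_fun d \<beta> f" "x \<in> Rn d"
  shows "\<exists>g. has_gradient d f g x"
proof -
  from assms(1) obtain g where "(\<forall>x\<in>Rn d. has_gradient d f (g x) x) \<and>
      (\<forall>x\<in>Rn d. \<forall>y\<in>Rn d. edist d (g x) (g y) \<le> \<beta> * edist d x y)"
    unfolding smooth_fun_def ..
  then have "has_gradient d f (g x) x" using assms(2) by simp
  then show ?thesis by (rule exI[of _ "g x"])
qed

text \<open>The mean value theorem is applied to the even part of \<open>f\<close> along the line.  The result
  is twice the optimal constant, which is absorbed by the absolute constant in the final bound.\<close>

lemma smooth_semiconcave:
  assumes sm: "smooth_fun d \<beta> f" and x: "x \<in> Rn d"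
  shows "f (ray d x w 1) + f (ray d x w (-1)) - 2 * f x \<le> 2 * \<beta> * (L2_set w {..<d})\<^sup>2"
proof -
  from sm obtain g where "(\<forall>x\<in>Rn d. has_gradient d f (g x) x) \<and>
      (\<forall>x\<in>Rn d. \<forall>y\<in>Rn d. edist d (g x) (g y) \<le> \<beta> * edist d x y)"
    unfolding smooth_fun_def ..
  then have g: "\<And>x. x \<in> Rn d \<Longrightarrow> has_gradient d f (g x) x"
    "\<And>x y. x \<in> Rn d \<Longrightarrow> y \<in> Rn d \<Longrightarrow> edist d (g x) (g y) \<le> \<beta> * edist d x y" by simp_all
  define D where "D s = (\<Sum>i<d. g (ray d x w s) i * w i)" for s
  have d1: "((\<lambda>s. f (ray d x w s)) has_real_derivative D s) (at s)" for s
    unfolding D_def by (intro has_gradient_ray g) simp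
  have d2: "((\<lambda>s. f (ray d x w s) + f (ray d x w (- s))) has_real_derivative (D s - D (- s))) (at s)" for s
  proof -
    have "(uminus has_real_derivative -1) (at s)" by (auto intro!: derivative_eq_intros)
    from DERIV_chain2[where g = uminus and x = s, OF d1 this]
    have "((\<lambda>s. f (ray d x w (- s))) has_real_derivative (D (- s) * -1)) (at s)" .
    from DERIV_add[OF d1[of s] this] show ?thesis by simp
  qed
  define \<psi> where "\<psi> s = f (ray d x w s) + f (ray d x w (- s))" for s
  have d3: "(\<psi> has_real_derivative (D s - D (- s))) (at s)" for s
    unfolding \<psi>_def by (rule d2)
  have "\<exists>z>0. z < 1 \<and> \<psi> 1 - \<psi> 0 = (1 - 0) * (D z - D (- z))"
    by (rule MVT2[OF zero_less_one d3])
  then obtain s :: real where s: "0 < s" "s < 1" and eq: "\<psi> 1 - \<psi> 0 = (1 - 0) * (D s - D (- s))"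
    by (elim exE conjE)
  have ray0: "ray d x w 0 = x"
  proof (rule ext)
    fix i show "ray d x w 0 i = x i"
      using PiE_arb[OF x, of i] by (cases "i < d") (simp_all add: ray_def)
  qed
  have "D s - D (- s) = (\<Sum>i<d. w i * (g (ray d x w s) i - g (ray d x w (- s)) i))"
    by (simp add: D_def algebra_simps flip: sum_subtractf)
  also have "\<dots> \<le> L2_set w {..<d} * edist d (g (ray d x w s)) (g (ray d x w (- s)))"
    using inner_le_edist[of w "g (ray d x w s)" "g (ray d x w (- s))" d] by linarith
  also have "\<dots> \<le> L2_set w {..<d} * (\<beta> * edist d (ray d x w s) (ray d x w (- s)))"
    by (intro mult_left_mono g) auto
  also have "\<dots> = s * (2 * \<beta> * (L2_set w {..<d})\<^sup>2)"
    using s by (simp add: edist_ray power2_eq_square)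
  finally have le: "D s - D (- s) \<le> s * (2 * \<beta> * (L2_set w {..<d})\<^sup>2)" .
  have "0 \<le> \<beta> * (L2_set w {..<d})\<^sup>2"
  proof (cases "L2_set w {..<d} = 0")
    case False
    then have p: "0 < L2_set w {..<d}" using L2_set_nonneg[of w "{..<d}"] by linarith
    have "0 \<le> \<beta> * edist d (ray d x w 1) (ray d x w 0)"
      by (rule order_trans[OF edist_nonneg g(2)[OF ray_in_Rn ray_in_Rn]])
    then have "0 \<le> \<beta> * L2_set w {..<d}" by (simp add: edist_ray)
    then have "0 \<le> \<beta>" using p by (metis mult_less_0_iff not_le)
    then show ?thesis by simp
  qed simp
  then have "s * (2 * \<beta> * (L2_set w {..<d})\<^sup>2) \<le> 1 * (2 * \<beta> * (L2_set w {..<d})\<^sup>2)"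
    using s by (intro mult_right_mono) auto
  with le have "D s - D (- s) \<le> 2 * \<beta> * (L2_set w {..<d})\<^sup>2" by (simp only: mult_1)
  then have "\<psi> 1 - \<psi> 0 \<le> 2 * \<beta> * (L2_set w {..<d})\<^sup>2" using eq by (simp only: diff_zero mult_1)
  then show ?thesis by (simp add: \<psi>_def ray0)
qed

section \<open>The regularized potential and its minimizer\<close>

lemma edist_triangle: "edist d x z \<le> edist d x y + edist d y z"
  unfolding edist_def using L2_set_triangle_ineq[of "\<lambda>i. x i - y i" "\<lambda>i. y i - z i" "{..<d}"] by simp

lemma integral_Leb_pos:
  fixes g :: "(nat \<Rightarrow> real) \<Rightarrow> real"
  assumes int: "integrable (Leb d) g" and pos: "\<And>x. x \<in> Rn d \<Longrightarrow> 0 < g x"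
  shows "0 < (\<integral>x. g x \<partial>Leb d)"
proof -
  have AE: "AE x in Leb d. 0 \<le> g x" using pos by (intro AE_I2) (simp add: space_Leb less_imp_le)
  have "(\<integral>x. g x \<partial>Leb d) \<noteq> 0"
  proof
    assume "(\<integral>x. g x \<partial>Leb d) = 0"
    then have "AE x in Leb d. g x = 0" using integral_nonneg_eq_0_iff_AE[OF int AE] by simp
    then have "AE x in Leb d. x \<notin> cube d 1"
    proof (rule AE_mp, intro AE_I2 impI)
      fix x assume "x \<in> space (Leb d)" "g x = 0"
      then show "x \<notin> cube d 1" using pos[of x] by (simp add: space_Leb)
    qed
    then have "cube d 1 \<in> null_sets (Leb d)" using AE_iff_null_sets[OF cube_sets] by blast
    then have "emeasure (Leb d) (cube d 1) = 0" by (rule null_setsD1)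
    moreover have "emeasure (Leb d) (cube d 1) = (\<Prod>i<d. emeasure lborel {-1..1::real})"
      by (rule Leb.emeasure_PiM) auto
    ultimately show False by simp
  qed
  moreover have "0 \<le> (\<integral>x. g x \<partial>Leb d)" using AE by (rule integral_nonneg_AE)
  ultimately show ?thesis by simp
qed

locale smooth_convex =
  fixes d :: nat and f :: "(nat \<Rightarrow> real) \<Rightarrow> real" and \<beta> \<eta> :: real
  assumes convex: "convex_fun d f" and smooth: "smooth_fun d \<beta> f"
    and exp_int: "integrable (Leb d) (\<lambda>x. exp (- f x))"
    and eta: "\<eta> > 0" and beta: "\<beta> > 0"
begin

abbreviation V :: "(nat \<Rightarrow> real) \<Rightarrow> (nat \<Rightarrow> real) \<Rightarrow> real" where
  "V \<equiv> prox_potential f d \<eta>"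

lemma V_eq: "V y x = f x + (edist d x y)\<^sup>2 / (2 * \<eta>)"
  by (simp add: prox_potential_def)

lemma f_continuous:
  assumes "x \<in> Rn d" "e > 0"
  shows "\<exists>\<delta>>0. \<forall>z\<in>Rn d. edist d z x < \<delta> \<longrightarrow> \<bar>f z - f x\<bar> < e"
proof -
  from smooth_has_gradient[OF smooth assms(1)] obtain g where "has_gradient d f g x" ..
  from has_gradient_continuous[OF this assms(2)] show ?thesis .
qed

lemma f_measurable [measurable]: "f \<in> borel_measurable (Leb d)"
proof (rule usc_measurable_Leb)
  fix x and e :: real assume "x \<in> Rn d" "e > 0"
  from f_continuous[OF this] obtain \<delta> where \<delta>: "\<delta> > 0" "\<forall>z\<in>Rn d. edist d z x < \<delta> \<longrightarrow> \<bar>f z - f x\<bar> < e" by auto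
  have "f z < f x + e" if "z \<in> Rn d" "edist d z x < \<delta>" for z
    using bspec[OF \<delta>(2) that(1)] that(2) by linarith
  with \<delta>(1) show "\<exists>\<delta>>0. \<forall>z\<in>Rn d. edist d z x < \<delta> \<longrightarrow> f z < f x + e" by auto
qed

lemma V_measurable [measurable]:
  assumes [measurable]: "g \<in> M \<rightarrow>\<^sub>M Leb d" "h \<in> M \<rightarrow>\<^sub>M Leb d"
  shows "(\<lambda>x. V (g x) (h x)) \<in> borel_measurable M"
  unfolding prox_potential_def by measurable

lemma V_measurable_const [measurable]: "V y \<in> borel_measurable (Leb d)"
proof -
  have "(\<lambda>x. edist d x y) \<in> borel_measurable (Leb d)"
    unfolding edist_def L2_set_def by measurable
  then have "(\<lambda>x. V y x) \<in> borel_measurable (Leb d)"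
    unfolding prox_potential_def by measurable
  then show ?thesis by simp
qed

lemma f_convex:
  assumes "x \<in> Rn d" "z \<in> Rn d" "0 \<le> t" "t \<le> 1"
  shows "f (seg d t x z) \<le> (1 - t) * f x + t * f z"
  using convex assms unfolding convex_fun_def seg_def by auto

lemma V_strongly_convex:
  assumes "x \<in> Rn d" "z \<in> Rn d" "0 \<le> t" "t \<le> 1"
  shows "V y (seg d t x z) \<le> (1 - t) * V y x + t * V y z - t * (1 - t) * (edist d x z)\<^sup>2 / (2 * \<eta>)"
  using f_convex[OF assms] eta unfolding V_eq sq_edist_seg
  by (simp add: add_divide_distrib diff_divide_distrib distrib_left)

text \<open>A tangent of the convex function \<open>f\<close> loses at most linearly in the distance, which the
  quadratic term makes up for.\<close>

lemma V_bounded_below: "\<exists>m. \<forall>z\<in>Rn d. m \<le> V y z"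
proof -
  define o' where "o' = (\<lambda>i\<in>{..<d}. 0::real)"
  have o': "o' \<in> Rn d" by (simp add: o'_def)
  from smooth_has_gradient[OF smooth this] obtain g where g: "has_gradient d f g o'" ..
  have "f o' - L2_set g {..<d} * edist d y o' - \<eta> * (L2_set g {..<d})\<^sup>2 / 2 \<le> V y z" if z: "z \<in> Rn d" for z
  proof -
    define G r where "G = L2_set g {..<d}" and "r = edist d z y"
    have "f o' + (\<Sum>i<d. g i * (z i - o' i)) \<le> f z" by (rule convex_above_tangent[OF convex g o' z])
    moreover have "\<bar>\<Sum>i<d. g i * (z i - o' i)\<bar> \<le> G * edist d z o'" unfolding G_def by (rule inner_le_edist)
    moreover have "G * edist d z o' \<le> G * (r + edist d y o')"
      unfolding G_def r_def by (intro mult_left_mono edist_triangle) simp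
    moreover have "0 \<le> (r - \<eta> * G)\<^sup>2 / (2 * \<eta>)" using eta by simp
    moreover have "(r - \<eta> * G)\<^sup>2 / (2 * \<eta>) = r\<^sup>2 / (2 * \<eta>) - G * r + \<eta> * G\<^sup>2 / 2"
      using eta by (simp add: power2_eq_square field_simps)
    ultimately show ?thesis
      unfolding V_eq G_def[symmetric] r_def[symmetric] distrib_left by linarith
  qed
  then show ?thesis by blast
qed

text \<open>Strong convexity makes every minimizing sequence Cauchy.\<close>

lemma V_minimizer_exists: "\<exists>xs\<in>Rn d. \<forall>z\<in>Rn d. V y xs \<le> V y z"
proof -
  define m where "m = Inf (V y ` Rn d)"
  have bdd: "bdd_below (V y ` Rn d)" using V_bounded_below[of y] by (auto simp: bdd_below_def)
  have ne: "V y ` Rn d \<noteq> {}" using seg_in_Rn by blast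
  have m_le: "m \<le> V y z" if "z \<in> Rn d" for z unfolding m_def using bdd that by (intro cInf_lower) auto
  have "\<exists>z\<in>Rn d. V y z < m + 1 / real (Suc n)" for n
    using cInf_lessD[OF ne, of "m + 1 / real (Suc n)"] by (auto simp: m_def)
  then obtain z where z: "\<And>n. z n \<in> Rn d" "\<And>n. V y (z n) < m + 1 / real (Suc n)" by metis
  have close: "(edist d (z k) (z n))\<^sup>2 \<le> 8 * \<eta> * (1 / real (Suc N))" if "N \<le> k" "N \<le> n" for k n N
  proof -
    have "1 / real (Suc k) \<le> 1 / real (Suc N)" "1 / real (Suc n) \<le> 1 / real (Suc N)"
      using that by (intro divide_left_mono; simp)+
    then have "V y (z k) < m + 1 / real (Suc N)" "V y (z n) < m + 1 / real (Suc N)"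
      using z(2)[of k] z(2)[of n] by linarith+
    moreover have "m \<le> V y (seg d (1/2) (z k) (z n))" by (rule m_le) simp
    moreover have "V y (seg d (1/2) (z k) (z n))
        \<le> (1 - 1/2) * V y (z k) + 1/2 * V y (z n) - 1/2 * (1 - 1/2) * (edist d (z k) (z n))\<^sup>2 / (2 * \<eta>)"
      by (rule V_strongly_convex) (use z in auto)
    ultimately have "(edist d (z k) (z n))\<^sup>2 / (8 * \<eta>) \<le> 1 / real (Suc N)" by simp
    then show ?thesis using eta by (simp add: field_simps)
  qed
  have "Cauchy (\<lambda>n. z n i)" if i: "i < d" for i
  proof (rule metric_CauchyI)
    fix e :: real assume e: "e > 0"
    obtain N where "8 * \<eta> / e\<^sup>2 < real N" using reals_Archimedean2 by blast
    then have N: "8 * \<eta> / e\<^sup>2 < real (Suc N)" by simp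
    have "dist (z k i) (z n i) < e" if "k \<ge> N" "n \<ge> N" for k n
    proof -
      have "(edist d (z k) (z n))\<^sup>2 \<le> 8 * \<eta> * (1 / real (Suc N))" by (rule close) (use that in auto)
      also have "\<dots> < e\<^sup>2" using N e by (simp add: field_simps)
      finally have "edist d (z k) (z n) < e" using e by (simp add: power2_less_imp_less)
      then show ?thesis using coord_le_edist[OF i, of "z k" "z n"] by (simp add: dist_real_def)
    qed
    then show "\<exists>N. \<forall>k\<ge>N. \<forall>n\<ge>N. dist (z k i) (z n i) < e" by blast
  qed
  then have "\<exists>l. (\<lambda>n. z n i) \<longlonglongrightarrow> l" if "i < d" for i
    using that by (simp add: real_Cauchy_convergent convergent_def[symmetric])
  then obtain l where l: "\<And>i. i < d \<Longrightarrow> (\<lambda>n. z n i) \<longlonglongrightarrow> l i" by metis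
  define xs where "xs = restrict l {..<d}"
  have xs: "xs \<in> Rn d" by (simp add: xs_def)
  have lim: "(\<lambda>n. edist d (z n) xs) \<longlonglongrightarrow> 0"
  proof (rule tendsto_sandwich[OF _ _ tendsto_const])
    have "(\<lambda>n. \<Sum>i<d. \<bar>z n i - xs i\<bar>) \<longlonglongrightarrow> (\<Sum>i<d. \<bar>l i - xs i\<bar>)"
      by (intro tendsto_intros l) auto
    then show "(\<lambda>n. \<Sum>i<d. \<bar>z n i - xs i\<bar>) \<longlonglongrightarrow> 0" by (simp add: xs_def)
  qed (auto simp: edist_le_sum)
  have "V y xs \<le> m"
  proof (rule field_le_epsilon)
    fix e :: real assume e: "e > 0"
    from f_continuous[OF xs, of "e / 3"] e obtain \<delta> where \<delta>: "\<delta> > 0"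
      "\<And>z. z \<in> Rn d \<Longrightarrow> edist d z xs < \<delta> \<Longrightarrow> \<bar>f z - f xs\<bar> < e / 3" by auto
    have near: "\<bar>edist d (z n) y - edist d xs y\<bar> \<le> edist d (z n) xs" for n
      using edist_triangle[of d "z n" y xs] edist_triangle[of d xs y "z n"] edist_commute[of d "z n" xs] by linarith
    have "(\<lambda>n. edist d (z n) y - edist d xs y) \<longlonglongrightarrow> 0"
      by (rule Lim_null_comparison[OF _ lim]) (simp add: near)
    then have "(\<lambda>n. edist d (z n) y) \<longlonglongrightarrow> edist d xs y" by (rule LIM_zero_cancel)
    then have "(\<lambda>n. (edist d (z n) y)\<^sup>2 / (2 * \<eta>)) \<longlonglongrightarrow> (edist d xs y)\<^sup>2 / (2 * \<eta>)"
      using eta by (intro tendsto_intros) auto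
    then have "\<forall>\<^sub>F n in sequentially. dist ((edist d (z n) y)\<^sup>2 / (2 * \<eta>)) ((edist d xs y)\<^sup>2 / (2 * \<eta>)) < e / 3"
      by (rule tendstoD) (use e in simp)
    moreover have "\<forall>\<^sub>F n in sequentially. edist d (z n) xs < \<delta>"
      using order_tendstoD(2)[OF lim \<delta>(1)] .
    moreover have "(\<lambda>n. 1 / real (Suc n)) \<longlonglongrightarrow> 0" using LIMSEQ_inverse_real_of_nat by (simp add: inverse_eq_divide)
    then have "\<forall>\<^sub>F n in sequentially. 1 / real (Suc n) < e / 3" by (rule order_tendstoD) (use e in simp)
    ultimately have "\<forall>\<^sub>F n in sequentially. V y xs \<le> m + e"
    proof eventually_elim
      case (elim n)
      have "\<bar>(edist d (z n) y)\<^sup>2 / (2 * \<eta>) - (edist d xs y)\<^sup>2 / (2 * \<eta>)\<bar> < e / 3" using elim(1) by (simp add: dist_real_def)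
      moreover have "\<bar>f (z n) - f xs\<bar> < e / 3" using \<delta>(2)[OF z(1) elim(2)] .
      ultimately show ?case using z(2)[of n] elim(3) unfolding V_eq by linarith
    qed
    then show "V y xs \<le> m + e" by simp
  qed
  from order_trans[OF this m_le] show ?thesis by (intro bexI[OF _ xs] ballI)
qed

abbreviation xs :: "(nat \<Rightarrow> real) \<Rightarrow> nat \<Rightarrow> real" where
  "xs y \<equiv> arg_min_on (V y) (Rn d)"

lemma xs: "xs y \<in> Rn d" "z \<in> Rn d \<Longrightarrow> V y (xs y) \<le> V y z"
proof -
  from V_minimizer_exists[of y] have "\<exists>x. is_arg_min (V y) (\<lambda>x. x \<in> Rn d) x"
    unfolding is_arg_min_def not_less by (meson linorder_not_le)
  from someI_ex[OF this] have *: "is_arg_min (V y) (\<lambda>x. x \<in> Rn d) (xs y)"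
    unfolding arg_min_on_def arg_min_def .
  show "xs y \<in> Rn d" using * by (simp only: is_arg_min_def)
  show "z \<in> Rn d \<Longrightarrow> V y (xs y) \<le> V y z" using * unfolding is_arg_min_def by (meson linorder_not_le)
qed

text \<open>Compare with the value at \<open>seg d s (xs y) z\<close> and let \<open>s\<close> tend to 0.\<close>

lemma V_lower:
  assumes z: "z \<in> Rn d"
  shows "V y (xs y) + (edist d z (xs y))\<^sup>2 / (2 * \<eta>) \<le> V y z"
proof -
  define Q where "Q = (edist d z (xs y))\<^sup>2 / (2 * \<eta>)"
  have "(1 - s) * Q \<le> V y z - V y (xs y)" if s: "0 < s" "s < 1" for s
  proof -
    have "V y (xs y) \<le> V y (seg d s (xs y) z)" by (rule xs) simp
    also have "\<dots> \<le> (1 - s) * V y (xs y) + s * V y z - s * (1 - s) * (edist d (xs y) z)\<^sup>2 / (2 * \<eta>)"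
      by (rule V_strongly_convex) (use s xs z in auto)
    finally have "s * ((1 - s) * Q) \<le> s * (V y z - V y (xs y))"
      by (simp add: Q_def edist_commute algebra_simps)
    then show ?thesis using s by simp
  qed
  then have "\<forall>\<^sub>F s in at_right 0. (1 - s) * Q \<le> V y z - V y (xs y)"
    using eventually_at_right_real[of 0 1] by (auto elim!: eventually_mono)
  moreover have "((\<lambda>s. (1 - s) * Q) \<longlongrightarrow> (1 - 0) * Q) (at_right 0)" by (intro tendsto_intros)
  ultimately have "(1 - 0) * Q \<le> V y z - V y (xs y)"
    by (intro tendsto_upperbound[of "\<lambda>s. (1 - s) * Q" "(1 - 0) * Q" "at_right 0"]) auto
  then show ?thesis by (simp add: Q_def)
qed

text \<open>The sum of \<open>V y\<close> over \<open>z\<close> and its reflection in the minimizer is bounded by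
  semiconcavity, and the reflected point alone already exceeds the minimum by the strong convexity
  term.  The coefficient \<open>1 / (2 \<eta>)\<close> has to match the one in \<open>V_lower\<close>: any additional
  factor would cost a factor exponential in \<open>d\<close> in the acceptance probability.\<close>

lemma V_upper:
  assumes z: "z \<in> Rn d"
  shows "V y z \<le> V y (xs y) + (1 / (2 * \<eta>) + 2 * \<beta>) * (edist d z (xs y))\<^sup>2"
proof -
  define x w where "x = xs y" and "w = (\<lambda>i. z i - x i)"
  have x: "x \<in> Rn d" by (simp only: x_def xs)
  define z' where "z' = ray d x w (-1)"
  have zr: "ray d x w 1 = z" using z by (auto simp: ray_def w_def fun_eq_iff PiE_iff extensional_def)
  have nw: "(L2_set w {..<d})\<^sup>2 = (edist d z x)\<^sup>2" by (simp add: edist_def w_def)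
  have "f z + f z' - 2 * f x \<le> 2 * \<beta> * (edist d z x)\<^sup>2"
    using smooth_semiconcave[OF smooth x, of w] unfolding zr z'_def nw .
  moreover have "(edist d z y)\<^sup>2 + (edist d z' y)\<^sup>2 - 2 * (edist d x y)\<^sup>2 = 2 * (edist d z x)\<^sup>2"
  proof -
    have "(\<Sum>i<d. (z i - y i)\<^sup>2 + (z' i - y i)\<^sup>2 - 2 * (x i - y i)\<^sup>2) = (\<Sum>i<d. 2 * (z i - x i)\<^sup>2)"
      by (intro sum.cong refl) (simp add: z'_def w_def power2_eq_square algebra_simps)
    then show ?thesis by (simp add: edist_sq sum.distrib sum_subtractf flip: sum_distrib_left)
  qed
  moreover have "V y x + (edist d z' x)\<^sup>2 / (2 * \<eta>) \<le> V y z'"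
    unfolding x_def by (rule V_lower) (simp add: z'_def)
  moreover have "(edist d z' x)\<^sup>2 = (edist d z x)\<^sup>2"
  proof -
    have "(\<Sum>i<d. (z' i - x i)\<^sup>2) = (\<Sum>i<d. (z i - x i)\<^sup>2)"
      by (intro sum.cong refl) (simp add: z'_def w_def power2_eq_square algebra_simps)
    then show ?thesis by (simp add: edist_sq)
  qed
  moreover have "fz + a / (2 * \<eta>) \<le> fx + c / (2 * \<eta>) + (1 / (2 * \<eta>) + 2 * \<beta>) * r"
    if "fz + fz' - 2 * fx \<le> 2 * \<beta> * r" "a + b - 2 * c = 2 * r" "fx + c / (2 * \<eta>) + r / (2 * \<eta>) \<le> fz' + b / (2 * \<eta>)"
    for fz fz' fx a b c r :: real
  proof -
    have "a = 2 * r + 2 * c - b" using that(2) by simp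
    then have "a / (2 * \<eta>) = 2 * (r / (2 * \<eta>)) + 2 * (c / (2 * \<eta>)) - b / (2 * \<eta>)"
      by (simp only: add_divide_distrib diff_divide_distrib times_divide_eq_right)
    then show ?thesis using that(1,3) unfolding distrib_right by simp
  qed
  ultimately show ?thesis unfolding V_eq x_def[symmetric] by metis
qed

text \<open>The minimum of \<open>V y\<close> is upper semicontinuous in \<open>y\<close>, as an infimum of continuous
  functions.  The law of the rejection sampler depends on \<open>y\<close> through this value and the
  normalising constant, so this makes it measurable in \<open>y\<close>.\<close>

lemma envelope_measurable: "(\<lambda>y. V y (xs y)) \<in> borel_measurable (Leb d)"
proof (rule usc_measurable_Leb)
  fix y and e :: real assume y: "y \<in> Rn d" and e: "e > 0"
  define A where "A = edist d (xs y) y"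
  have A: "A \<ge> 0" by (simp add: A_def)
  \<comment> \<open>For \<open>h \<le> 1\<close> the square of \<open>A + h\<close> exceeds that of \<open>A\<close> by at most \<open>h (2 A + 1)\<close>.\<close>
  define \<delta> where "\<delta> = min 1 (2 * \<eta> * e / (2 * A + 1))"
  have \<delta>: "\<delta> > 0" using A e eta by (simp add: \<delta>_def)
  have "V y' (xs y') < V y (xs y) + e" if y': "y' \<in> Rn d" "edist d y' y < \<delta>" for y'
  proof -
    define h where "h = edist d y' y"
    have h: "0 \<le> h" "h < 1" "h < 2 * \<eta> * e / (2 * A + 1)" using y' by (auto simp: h_def \<delta>_def)
    have "edist d (xs y) y' \<le> A + h"
      using edist_triangle[of d "xs y" y' y] by (simp add: A_def h_def edist_commute)
    then have "(edist d (xs y) y')\<^sup>2 \<le> (A + h)\<^sup>2" by (intro power_mono) auto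
    also have "\<dots> \<le> A\<^sup>2 + h * (2 * A + 1)"
      using mult_right_mono[of h 1 h] h by (simp add: power2_eq_square algebra_simps)
    also have "\<dots> < A\<^sup>2 + 2 * \<eta> * e" using h(3) A by (simp add: pos_less_divide_eq)
    finally have "(edist d (xs y) y')\<^sup>2 / (2 * \<eta>) < (A\<^sup>2 + 2 * \<eta> * e) / (2 * \<eta>)"
      using eta by (intro divide_strict_right_mono) auto
    also have "\<dots> = A\<^sup>2 / (2 * \<eta>) + e" using eta by (simp add: add_divide_distrib)
    finally have "V y' (xs y) < V y (xs y) + e" by (simp add: V_eq A_def)
    moreover have "V y' (xs y') \<le> V y' (xs y)" by (rule xs(2)[OF xs(1)])
    ultimately show ?thesis by linarith
  qed
  then show "\<exists>\<delta>>0. \<forall>z\<in>Rn d. edist d z y < \<delta> \<longrightarrow> V z (xs z) < V y (xs y) + e" using \<delta> by blast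
qed

end

section \<open>Transport inequality and nonexpansiveness of the backward channel\<close>

text \<open>Integrate the tangent of \<open>exp\<close> at the mean of \<open>X\<close>.\<close>

lemma (in prob_space) jensen_exp:
  fixes X :: "'a \<Rightarrow> real"
  assumes "integrable M X" "integrable M (\<lambda>x. exp (X x))"
  shows "expectation X \<le> ln (expectation (\<lambda>x. exp (X x)))"
proof -
  define m where "m = expectation X"
  have "exp m * (1 + expectation X - m) = expectation (\<lambda>x. exp m * (1 + X x - m))"
    using assms by (simp add: prob_space)
  also have "\<dots> \<le> expectation (\<lambda>x. exp (X x))"
  proof (rule Bochner_Integration.integral_mono)
    show "exp m * (1 + X x - m) \<le> exp (X x)" for x
    proof -
      have "exp m * (1 + (X x - m)) \<le> exp m * exp (X x - m)"
        by (intro mult_left_mono exp_ge_add_one_self) auto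
      then show ?thesis by (simp flip: exp_add add: add_diff_eq)
    qed
  qed (use assms in auto)
  finally have "exp m \<le> expectation (\<lambda>x. exp (X x))" by (simp add: m_def)
  then have "ln (exp m) \<le> ln (expectation (\<lambda>x. exp (X x)))"
    using less_le_trans[OF exp_gt_zero] by (intro ln_mono) auto
  then show ?thesis by (simp add: m_def)
qed

lemma sets_gibbs [simp, measurable_cong]: "sets (gibbs d W) = sets (Leb d)"
  by (simp add: gibbs_def)

lemma space_gibbs [simp]: "space (gibbs d W) = Rn d"
  using sets_eq_imp_space_eq[OF sets_gibbs] by (simp add: space_Leb)

lemma prob_space_gibbs:
  assumes int: "integrable (Leb d) (\<lambda>x. exp (- W x))"
  shows "0 < (\<integral>x. exp (- W x) \<partial>Leb d)" "prob_space (gibbs d W)"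
proof -
  define c where "c = (\<integral>x. exp (- W x) \<partial>Leb d)"
  have c: "0 < c" unfolding c_def by (intro integral_Leb_pos int) simp
  then show "0 < (\<integral>x. exp (- W x) \<partial>Leb d)" by (simp add: c_def)
  have m: "(\<lambda>x. exp (- W x)) \<in> borel_measurable (Leb d)" using int by auto
  show "prob_space (gibbs d W)"
  proof
    have "emeasure (gibbs d W) (space (gibbs d W)) = (\<integral>\<^sup>+x. ennreal (exp (- W x) / c) \<partial>Leb d)"
      unfolding gibbs_def c_def[symmetric] using m
      by (subst emeasure_density) (auto intro!: nn_integral_cong)
    also have "\<dots> = ennreal (\<integral>x. exp (- W x) / c \<partial>Leb d)"
      using int c by (intro nn_integral_eq_integral) auto
    also have "(\<integral>x. exp (- W x) / c \<partial>Leb d) = 1" using c by (simp add: c_def)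
    finally show "emeasure (gibbs d W) (space (gibbs d W)) = 1" by simp
  qed
qed

context smooth_convex
begin

lemma integrable_tilt:
  assumes [measurable]: "h \<in> borel_measurable (Leb d)"
    and bd: "\<And>x. x \<in> Rn d \<Longrightarrow> \<bar>h x\<bar> * exp (- (edist d x y)\<^sup>2 / (2 * \<eta>)) \<le> C"
  shows "integrable (Leb d) (\<lambda>x. h x * exp (- V y x))"
proof (rule Bochner_Integration.integrable_bound[where f = "\<lambda>x. C * exp (- f x)"])
  show "integrable (Leb d) (\<lambda>x. C * exp (- f x))" using exp_int by simp
  show "AE x in Leb d. norm (h x * exp (- V y x)) \<le> norm (C * exp (- f x))"
  proof (intro AE_I2)
    fix x assume "x \<in> space (Leb d)"
    then have "\<bar>h x\<bar> * exp (- (edist d x y)\<^sup>2 / (2 * \<eta>)) * exp (- f x) \<le> C * exp (- f x)"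
      using bd[of x] by (intro mult_right_mono) (auto simp: space_Leb)
    also have "\<bar>h x\<bar> * exp (- (edist d x y)\<^sup>2 / (2 * \<eta>)) * exp (- f x) = norm (h x * exp (- V y x))"
      by (simp add: abs_mult V_eq mult.assoc flip: exp_add)
    also have "C * exp (- f x) \<le> norm (C * exp (- f x))" by simp
    finally show "norm (h x * exp (- V y x)) \<le> norm (C * exp (- f x))" .
  qed
qed measurable

lemma integrable_exp_V: "integrable (Leb d) (\<lambda>x. exp (- V y x))"
  using integrable_tilt[of "\<lambda>_. 1" y 1] eta by simp

definition Z :: "(nat \<Rightarrow> real) \<Rightarrow> real" where
  "Z y = (\<integral>x. exp (- V y x) \<partial>Leb d)"

abbreviation bwd :: "(nat \<Rightarrow> real) \<Rightarrow> (nat \<Rightarrow> real) measure" where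
  "bwd y \<equiv> gibbs d (V y)"

lemma Z_pos: "0 < Z y"
  unfolding Z_def by (rule prob_space_gibbs(1)[OF integrable_exp_V])

lemma bwd_eq: "bwd y = density (Leb d) (\<lambda>x. ennreal (exp (- V y x) / Z y))"
  by (simp add: gibbs_def Z_def)

lemmas sets_bwd = sets_gibbs[of d "V y" for y]

lemma prob_space_bwd: "prob_space (bwd y)"
  by (rule prob_space_gibbs(2)[OF integrable_exp_V])

lemma integral_bwd:
  fixes u :: "(nat \<Rightarrow> real) \<Rightarrow> real"
  assumes [measurable]: "u \<in> borel_measurable (Leb d)"
  shows "(\<integral>x. u x \<partial>bwd y) = (\<integral>x. u x * exp (- V y x) \<partial>Leb d) / Z y"
  unfolding bwd_eq using Z_pos[of y]
  by (subst integral_density) (auto simp: mult.commute)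

lemma integrable_bwd:
  fixes u :: "(nat \<Rightarrow> real) \<Rightarrow> real"
  assumes [measurable]: "u \<in> borel_measurable (Leb d)" and "integrable (Leb d) (\<lambda>x. u x * exp (- V y x))"
  shows "integrable (bwd y) u"
  unfolding bwd_eq using Z_pos[of y] assms(2)
  by (subst integrable_density) (auto simp: mult.commute)

lemma integrable_bwd_bounded:
  fixes u :: "(nat \<Rightarrow> real) \<Rightarrow> real"
  assumes [measurable]: "u \<in> borel_measurable (Leb d)" and "\<And>x. x \<in> Rn d \<Longrightarrow> \<bar>u x\<bar> \<le> K"
  shows "integrable (bwd y) u"
proof -
  interpret prob_space "bwd y" by (rule prob_space_bwd)
  show ?thesis using assms(2) by (intro integrable_const_bound[where B = K] AE_I2) auto
qed

text \<open>Prekopa-Leindler for the densities tilted by \<open>t u\<close> and \<open>- (1 - t) v\<close>: the strong convexity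
  of \<open>V y\<close> absorbs the transport cost.  As \<open>t\<close> tends to 1 this is the dual form of Talagrand's
  inequality with the sharp constant; for \<open>t = 1 / 2\<close> a factor 2 would be lost.  The limit is
  postponed to a point where it is elementary.\<close>

lemma transport_entropy_dual:
  assumes [measurable]: "u \<in> borel_measurable (Leb d)" "v \<in> borel_measurable (Leb d)"
    and bd: "\<And>x. x \<in> Rn d \<Longrightarrow> \<bar>u x\<bar> \<le> K" "\<And>x. x \<in> Rn d \<Longrightarrow> \<bar>v x\<bar> \<le> K"
    and le: "\<And>x x'. x \<in> Rn d \<Longrightarrow> x' \<in> Rn d \<Longrightarrow> u x - v x' \<le> (edist d x x')\<^sup>2 / (2 * \<eta>)"
    and t: "0 < t" "t < 1"
  shows "ln (\<integral>x. exp (t * u x) \<partial>bwd y) \<le> t * (\<integral>x. v x \<partial>bwd y)"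
proof -
  interpret prob_space "bwd y" by (rule prob_space_bwd)
  define A B where "A = (\<integral>x. exp (t * u x) \<partial>bwd y)" and "B = (\<integral>x. exp (- (1 - t) * v x) \<partial>bwd y)"
  have K: "0 \<le> K" using bd(1)[of "restrict undefined {..<d}"] by (smt (verit) restrict_PiE_iff UNIV_I)
  have b: "exp (s * w x) \<le> exp (\<bar>s\<bar> * K)" if "\<bar>w x\<bar> \<le> K" for w :: "(nat \<Rightarrow> real) \<Rightarrow> real" and x s
  proof -
    have "s * w x \<le> \<bar>s\<bar> * \<bar>w x\<bar>" by (metis abs_ge_self abs_mult)
    also have "\<dots> \<le> \<bar>s\<bar> * K" using that by (intro mult_left_mono) auto
    finally show ?thesis by simp
  qed
  have int: "integrable (Leb d) (\<lambda>x. exp (s * w x) * exp (- V y x))" "integrable (bwd y) (\<lambda>x. exp (s * w x))"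
    "0 < (\<integral>x. exp (s * w x) \<partial>bwd y)"
    if w: "w \<in> borel_measurable (Leb d)" "\<And>x. x \<in> Rn d \<Longrightarrow> \<bar>w x\<bar> \<le> K" for s w
  proof -
    note [measurable] = w(1)
    show i1: "integrable (Leb d) (\<lambda>x. exp (s * w x) * exp (- V y x))"
    proof (rule integrable_tilt[where C = "exp (\<bar>s\<bar> * K) * 1"])
      fix x assume "x \<in> Rn d"
      then show "\<bar>exp (s * w x)\<bar> * exp (- (edist d x y)\<^sup>2 / (2 * \<eta>)) \<le> exp (\<bar>s\<bar> * K) * 1"
        using b[of w x s, OF w(2)] eta by (intro mult_mono) auto
    qed measurable
    then show "integrable (bwd y) (\<lambda>x. exp (s * w x))" by (intro integrable_bwd) measurable
    show "0 < (\<integral>x. exp (s * w x) \<partial>bwd y)"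
      using integral_Leb_pos[OF i1] Z_pos[of y] by (subst integral_bwd) auto
  qed
  have pos: "A > 0" "B > 0" unfolding A_def B_def using int(3) bd assms(1,2) by blast+
  have "(\<integral>x. exp (t * u x) * exp (- V y x) \<partial>Leb d) powr (1 - t)
      * (\<integral>x. exp (- (1 - t) * v x) * exp (- V y x) \<partial>Leb d) powr t \<le> (\<integral>x. exp (- V y x) \<partial>Leb d)"
  proof (rule prekopa_leindler[OF int(1) int(1) integrable_exp_V])
    fix x x' assume x: "x \<in> Rn d" and x': "x' \<in> Rn d"
    have "t * (1 - t) * (u x - v x') \<le> t * (1 - t) * ((edist d x x')\<^sup>2 / (2 * \<eta>))"
      using le[OF x x'] t by (intro mult_left_mono) auto
    moreover have "V y (seg d t x x') \<le> (1 - t) * V y x + t * V y x' - t * (1 - t) * (edist d x x')\<^sup>2 / (2 * \<eta>)"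
      by (rule V_strongly_convex) (use x x' t in auto)
    ultimately have "(1 - t) * (t * u x - V y x) + t * (- (1 - t) * v x' - V y x') \<le> - V y (seg d t x x')"
      by (simp add: algebra_simps)
    moreover have "(exp (t * u x) * exp (- V y x)) powr (1 - t) * (exp (- (1 - t) * v x') * exp (- V y x')) powr t
       = exp ((1 - t) * (t * u x - V y x) + t * (- (1 - t) * v x' - V y x'))"
      by (simp add: powr_def flip: exp_add)
    ultimately show "(exp (t * u x) * exp (- V y x)) powr (1 - t) * (exp (- (1 - t) * v x') * exp (- V y x')) powr t
       \<le> exp (- V y (seg d t x x'))" by simp
  qed (use t bd assms(1,2) in auto)
  moreover have "(\<integral>x. exp (t * u x) * exp (- V y x) \<partial>Leb d) = A * Z y"
    unfolding A_def using Z_pos[of y] by (subst integral_bwd) auto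
  moreover have "(\<integral>x. exp (- (1 - t) * v x) * exp (- V y x) \<partial>Leb d) = B * Z y"
    unfolding B_def using Z_pos[of y] by (subst integral_bwd) auto
  ultimately have "(A * Z y) powr (1 - t) * (B * Z y) powr t \<le> Z y" by (simp add: Z_def)
  then have "ln ((A * Z y) powr (1 - t) * (B * Z y) powr t) \<le> ln (Z y)"
    using pos Z_pos[of y] by (intro ln_mono) auto
  also have "ln ((A * Z y) powr (1 - t) * (B * Z y) powr t) = (1 - t) * ln A + t * ln B + ln (Z y)"
    using pos Z_pos[of y] by (simp add: ln_mult ln_powr algebra_simps)
  finally have 1: "(1 - t) * ln A + t * ln B \<le> 0" by simp
  have "(\<integral>x. - (1 - t) * v x \<partial>bwd y) \<le> ln B"
    unfolding B_def
    by (intro jensen_exp int(2) integrable_mult_right integrable_bwd_bounded[where K = K]) (use bd in auto)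
  then have 2: "- (1 - t) * (\<integral>x. v x \<partial>bwd y) \<le> ln B" by simp
  have "(1 - t) * ln A \<le> - (t * ln B)" using 1 by simp
  also have "\<dots> \<le> t * ((1 - t) * (\<integral>x. v x \<partial>bwd y))"
  proof -
    have "- ln B \<le> (1 - t) * (\<integral>x. v x \<partial>bwd y)" using 2 by (simp add: algebra_simps)
    from mult_left_mono[OF this, of t] t show ?thesis by simp
  qed
  finally have "(1 - t) * ln A \<le> (1 - t) * (t * (\<integral>x. v x \<partial>bwd y))" by (simp add: mult.left_commute)
  then show ?thesis using t by (simp add: A_def)
qed

text \<open>The log-density of \<open>bwd y'\<close> with respect to \<open>bwd y\<close>, up to an additive constant.  It is an
  affine function of \<open>x\<close>.\<close>

definition lin :: "(nat \<Rightarrow> real) \<Rightarrow> (nat \<Rightarrow> real) \<Rightarrow> (nat \<Rightarrow> real) \<Rightarrow> real" where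
  "lin y y' x = ((edist d x y)\<^sup>2 - (edist d x y')\<^sup>2) / (2 * \<eta>)"

lemma V_lin: "V y' x = V y x - lin y y' x"
  using eta by (simp add: V_eq lin_def field_simps)

lemma lin_swap: "lin y' y x = - lin y y' x"
  by (simp add: lin_def minus_divide_left)

lemma lin_measurable [measurable]: "lin y y' \<in> borel_measurable (Leb d)"
proof -
  have "(\<lambda>x. edist d x z) \<in> borel_measurable (Leb d)" for z
    unfolding edist_def L2_set_def by measurable
  then show ?thesis unfolding lin_def by measurable
qed

lemma lin_affine_bound: "\<bar>lin y y' x\<bar> \<le> (2 * edist d x y * edist d y y' + (edist d y y')\<^sup>2) / (2 * \<eta>)"
proof -
  define a b h where "a = edist d x y" and "b = edist d x y'" and "h = edist d y y'"
  have "b \<le> a + h" "a \<le> b + h" using edist_triangle[of d x y' y] edist_triangle[of d x y y']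
    by (auto simp: a_def b_def h_def edist_commute)
  moreover have nn: "0 \<le> a" "0 \<le> b" "0 \<le> h" by (auto simp: a_def b_def h_def)
  ultimately have "b\<^sup>2 \<le> (a + h)\<^sup>2" "a\<^sup>2 \<le> (b + h)\<^sup>2" by (auto intro: power_mono)
  moreover have "b\<^sup>2 - a\<^sup>2 \<le> 2 * a * h + h\<^sup>2" using \<open>b\<^sup>2 \<le> (a + h)\<^sup>2\<close> by (simp add: power2_sum)
  moreover have "a\<^sup>2 - b\<^sup>2 \<le> 2 * a * h + h\<^sup>2"
  proof (cases "a \<le> b")
    case True
    then have "a\<^sup>2 \<le> b\<^sup>2" using nn by (intro power_mono) auto
    moreover have "0 \<le> 2 * a * h + h\<^sup>2" using nn by simp
    ultimately show ?thesis by linarith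
  next
    case False
    then have "(a - b) * (a + b) \<le> h * (2 * a)" using nn \<open>a \<le> b + h\<close> by (intro mult_mono) auto
    then have "a\<^sup>2 - b\<^sup>2 \<le> 2 * a * h" by (simp add: power2_eq_square algebra_simps)
    moreover have "0 \<le> h\<^sup>2" by simp
    ultimately show ?thesis by linarith
  qed
  ultimately have "\<bar>a\<^sup>2 - b\<^sup>2\<bar> \<le> 2 * a * h + h\<^sup>2" by linarith
  then show ?thesis using eta by (simp add: lin_def a_def b_def h_def divide_right_mono)
qed

lemma gaussian_beats_linear: "0 \<le> r \<Longrightarrow> r * exp (- r\<^sup>2 / (2 * \<eta>)) \<le> 1 + 2 * \<eta>"
proof -
  assume r: "0 \<le> r"
  have "r\<^sup>2 / (2 * \<eta>) \<le> exp (r\<^sup>2 / (2 * \<eta>))" using exp_ge_add_one_self[of "r\<^sup>2 / (2 * \<eta>)"] by linarith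
  then have "r\<^sup>2 \<le> 2 * \<eta> * exp (r\<^sup>2 / (2 * \<eta>))" using eta by (simp add: field_simps)
  moreover have "r \<le> 1 + r\<^sup>2" using r by (smt (verit) mult_left_le power2_eq_square one_le_power self_le_power zero_le_power2 less_numeral_extra(1) pos2)
  moreover have "1 \<le> exp (r\<^sup>2 / (2 * \<eta>))" using eta by simp
  ultimately have "r \<le> (1 + 2 * \<eta>) * exp (r\<^sup>2 / (2 * \<eta>))" unfolding distrib_right by linarith
  then show ?thesis by (simp add: exp_minus field_simps)
qed

lemma integrable_bwd_lin: "integrable (bwd z) (lin y y')"
proof (rule integrable_bwd)
  define h g where "h = edist d y y'" and "g = edist d z y"
  have nn: "0 \<le> h" "0 \<le> g" by (auto simp: h_def g_def)
  show "integrable (Leb d) (\<lambda>x. lin y y' x * exp (- V z x))"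
  proof (rule integrable_tilt)
    fix x assume "x \<in> Rn d"
    define r where "r = edist d x z"
    have r: "0 \<le> r" by (simp add: r_def)
    have "edist d x y \<le> r + g" using edist_triangle[of d x y z] by (simp add: r_def g_def)
    then have "2 * edist d x y * h + h\<^sup>2 \<le> 2 * (r + g) * h + h\<^sup>2" using nn by (intro add_right_mono mult_right_mono) auto
    then have "\<bar>lin y y' x\<bar> \<le> (2 * (r + g) * h + h\<^sup>2) / (2 * \<eta>)"
      using lin_affine_bound[of y y' x] eta
      by (intro order_trans[OF lin_affine_bound] divide_right_mono) (auto simp: h_def)
    then have "\<bar>lin y y' x\<bar> * exp (- r\<^sup>2 / (2 * \<eta>)) \<le> (2 * (r + g) * h + h\<^sup>2) / (2 * \<eta>) * exp (- r\<^sup>2 / (2 * \<eta>))"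
      by (intro mult_right_mono) auto
    also have "\<dots> = h / \<eta> * (r * exp (- r\<^sup>2 / (2 * \<eta>))) + (2 * g * h + h\<^sup>2) / (2 * \<eta>) * exp (- r\<^sup>2 / (2 * \<eta>))"
      using eta by (simp add: field_simps)
    also have "\<dots> \<le> h / \<eta> * (1 + 2 * \<eta>) + (2 * g * h + h\<^sup>2) / (2 * \<eta>) * 1"
      using gaussian_beats_linear[OF r] nn eta by (intro add_mono mult_left_mono) auto
    finally show "\<bar>lin y y' x\<bar> * exp (- (edist d x z)\<^sup>2 / (2 * \<eta>)) \<le> h / \<eta> * (1 + 2 * \<eta>) + (2 * g * h + h\<^sup>2) / (2 * \<eta>) * 1"
      by (simp add: r_def)
  qed measurable
qed measurable

text \<open>The Donsker-Varadhan inequality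
  \<open>\<integral> w d\<mu>' - H\<^sub>\<mu>(\<mu>') \<le> ln (\<integral> exp w d\<mu>)\<close> for \<open>\<mu> = bwd y\<close> and \<open>\<mu>' = bwd y'\<close>.\<close>

lemma change_of_measure:
  assumes [measurable]: "w \<in> borel_measurable (Leb d)"
    and bd: "\<And>x. x \<in> Rn d \<Longrightarrow> \<bar>w x\<bar> \<le> K"
  shows "(\<integral>x. w x \<partial>bwd y') - (\<integral>x. lin y y' x \<partial>bwd y') + ln (Z y') - ln (Z y) \<le> ln (\<integral>x. exp (w x) \<partial>bwd y)"
proof -
  interpret prob_space "bwd y'" by (rule prob_space_bwd)
  have i: "integrable (Leb d) (\<lambda>x. exp (w x) * exp (- V y x))"
  proof (rule integrable_tilt[where C = "exp K * 1"])
    fix x assume "x \<in> Rn d"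
    then show "\<bar>exp (w x)\<bar> * exp (- (edist d x y)\<^sup>2 / (2 * \<eta>)) \<le> exp K * 1"
      using bd[of x] eta by (intro mult_mono) auto
  qed measurable
  have eq: "exp (w x - lin y y' x) * exp (- V y' x) = exp (w x) * exp (- V y x)" for x
    by (simp add: V_lin[of y' x y] flip: exp_add)
  have i2: "integrable (bwd y') (\<lambda>x. exp (w x - lin y y' x))"
    by (rule integrable_bwd) (simp_all add: eq i)
  have iw: "integrable (bwd y') w" by (rule integrable_bwd_bounded[OF _ bd]) auto
  have "(\<integral>x. w x - lin y y' x \<partial>bwd y') \<le> ln (\<integral>x. exp (w x - lin y y' x) \<partial>bwd y')"
    by (intro jensen_exp i2 Bochner_Integration.integrable_diff iw integrable_bwd_lin)
  also have "(\<integral>x. exp (w x - lin y y' x) \<partial>bwd y') = (\<integral>x. exp (w x) * exp (- V y x) \<partial>Leb d) / Z y'"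
    by (subst integral_bwd) (simp_all add: eq)
  also have "\<dots> = (\<integral>x. exp (w x) \<partial>bwd y) * Z y / Z y'"
    using Z_pos[of y] by (subst integral_bwd) auto
  also have "ln \<dots> = ln (\<integral>x. exp (w x) \<partial>bwd y) + ln (Z y) - ln (Z y')"
  proof -
    have "0 < (\<integral>x. exp (w x) \<partial>bwd y)"
      using integral_Leb_pos[OF i] Z_pos[of y] by (subst integral_bwd) auto
    then show ?thesis using Z_pos[of y] Z_pos[of y'] by (simp add: ln_div ln_mult)
  qed
  finally show ?thesis using iw integrable_bwd_lin by (simp add: Bochner_Integration.integral_diff)
qed

lemma ln_Z_concave:
  assumes t: "0 < t" "t < 1"
  shows "(1 - t) * ln (Z y) + t * ln (Z y') \<le> ln (Z (seg d t y y'))"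
proof -
  have "Z y powr (1 - t) * Z y' powr t \<le> Z (seg d t y y')"
    unfolding Z_def
  proof (rule prekopa_leindler[OF integrable_exp_V integrable_exp_V integrable_exp_V])
    fix x x' assume x: "x \<in> Rn d" and x': "x' \<in> Rn d"
    have "(edist d (seg d t x x') (seg d t y y'))\<^sup>2 \<le> (\<Sum>i<d. (1 - t) * (x i - y i)\<^sup>2 + t * (x' i - y' i)\<^sup>2)"
      unfolding edist_sq
    proof (rule sum_mono)
      fix i assume "i \<in> {..<d}"
      have "0 \<le> t * (1 - t) * ((x i - y i) - (x' i - y' i))\<^sup>2" using t by simp
      then show "(seg d t x x' i - seg d t y y' i)\<^sup>2 \<le> (1 - t) * (x i - y i)\<^sup>2 + t * (x' i - y' i)\<^sup>2"
        using \<open>i \<in> {..<d}\<close> by (simp add: power2_eq_square algebra_simps)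
    qed
    also have "\<dots> = (1 - t) * (edist d x y)\<^sup>2 + t * (edist d x' y')\<^sup>2"
      by (simp add: edist_sq sum.distrib sum_distrib_left)
    finally have "(edist d (seg d t x x') (seg d t y y'))\<^sup>2 / (2 * \<eta>)
        \<le> ((1 - t) * (edist d x y)\<^sup>2 + t * (edist d x' y')\<^sup>2) / (2 * \<eta>)"
      using eta by (intro divide_right_mono) auto
    moreover have "f (seg d t x x') \<le> (1 - t) * f x + t * f x'" by (rule f_convex) (use x x' t in auto)
    ultimately have "V (seg d t y y') (seg d t x x') \<le> (1 - t) * V y x + t * V y' x'"
      unfolding V_eq by (simp add: distrib_left add_divide_distrib)
    then show "exp (- V y x) powr (1 - t) * exp (- V y' x') powr t \<le> exp (- V (seg d t y y') (seg d t x x'))"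
      by (simp add: powr_def flip: exp_add)
  qed (use t in auto)
  then have "ln (Z y powr (1 - t) * Z y' powr t) \<le> ln (Z (seg d t y y'))"
    using Z_pos[of y] Z_pos[of y'] by (intro ln_mono) auto
  then show ?thesis using Z_pos[of y] Z_pos[of y'] by (simp add: ln_mult ln_powr)
qed

text \<open>The left-hand side is the symmetrised relative entropy of \<open>bwd y\<close> and \<open>bwd y'\<close>.  Prolong
  the segment from \<open>y\<close> to \<open>y'\<close> by the fraction \<open>s\<close> at both ends.  Concavity of \<open>ln Z\<close> bounds the
  sum over the outer points by the sum over the inner ones, while Jensen bounds the increments of
  \<open>ln Z\<close> at the two ends below by the means in question.  Divide by \<open>s\<close> and let \<open>s\<close> tend to 0.\<close>

lemma lin_mean_gap:
  assumes y: "y \<in> Rn d" and y': "y' \<in> Rn d"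
  shows "(\<integral>x. lin y y' x \<partial>bwd y') - (\<integral>x. lin y y' x \<partial>bwd y) \<le> (edist d y y')\<^sup>2 / \<eta>"
proof (rule field_le_epsilon)
  define q m0 m1 where "q = (edist d y y')\<^sup>2 / (2 * \<eta>)"
    and "m0 = (\<integral>x. lin y y' x \<partial>bwd y)" and "m1 = (\<integral>x. lin y y' x \<partial>bwd y')"
  have q: "0 \<le> q" using eta by (simp add: q_def)
  have bound: "m1 - m0 \<le> 2 * q + 2 * s * q" if s: "s > 0" for s
  proof -
    \<comment> \<open>The prolonged segment runs from \<open>p\<close> to \<open>p'\<close>, and \<open>y\<close>, \<open>y'\<close> lie at the fractions \<open>t\<close>, \<open>1 - t\<close> of it.\<close>
    define D p p' where "D = (\<lambda>i. y' i - y i)" and "p = ray d y D (- s)" and "p' = ray d y D (1 + s)"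
    define t where "t = s / (1 + 2 * s)"
    have t: "0 < t" "t < 1" "t * (1 + 2 * s) = s" using s by (auto simp: t_def field_simps)
    have low: "ln (Z z) + (\<integral>x. lin z z' x \<partial>bwd z) \<le> ln (Z z')" for z z'
    proof -
      interpret prob_space "bwd z" by (rule prob_space_bwd)
      interpret b': prob_space "bwd z'" by (rule prob_space_bwd)
      have "b'.prob (Rn d) = 1" using b'.prob_space by simp
      then show ?thesis
        using change_of_measure[of "\<lambda>_. 0" 0 z z'] by (simp add: lin_swap[of z z'])
    qed
    have sq: "(\<Sum>i<d. (x i - y i)\<^sup>2) - (\<Sum>i<d. (x i - (y i + r * D i))\<^sup>2)
        = r * ((\<Sum>i<d. (x i - y i)\<^sup>2) - (\<Sum>i<d. (x i - y' i)\<^sup>2)) + (r - r\<^sup>2) * (\<Sum>i<d. (y i - y' i)\<^sup>2)" for r x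
      unfolding sum_subtractf[symmetric] sum_distrib_left sum.distrib[symmetric]
      by (intro sum.cong refl) (simp add: D_def power2_eq_square algebra_simps)
    have lr: "lin y (ray d y D r) x = r * lin y y' x + (r - r\<^sup>2) * q" for r x
    proof -
      have "(edist d x y)\<^sup>2 - (edist d x (ray d y D r))\<^sup>2
          = r * ((edist d x y)\<^sup>2 - (edist d x y')\<^sup>2) + (r - r\<^sup>2) * (edist d y y')\<^sup>2"
        using sq[of x r] by (simp add: edist_sq)
      then show ?thesis unfolding lin_def q_def by (simp add: add_divide_distrib)
    qed
    have "lin y p x = - s * lin y y' x + (- s - s\<^sup>2) * q" for x
      using lr[of "- s" x] by (simp add: p_def)
    moreover have "lin y' p' x = s * lin y y' x + (- s - s\<^sup>2) * q" for x
    proof -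
      have "lin y' p' x = lin y p' x - lin y y' x"
        by (simp add: lin_def diff_divide_distrib)
      then show ?thesis using lr[of "1 + s" x] by (simp add: p'_def power2_eq_square algebra_simps)
    qed
    moreover have sp: "Sigma_Algebra.measure (bwd z) (Rn d) = 1" for z
      using prob_space.prob_space[OF prob_space_bwd, of z] by simp
    ultimately have "(\<integral>x. lin y p x \<partial>bwd y) = - s * m0 + (- s - s\<^sup>2) * q"
      "(\<integral>x. lin y' p' x \<partial>bwd y') = s * m1 + (- s - s\<^sup>2) * q"
      using integrable_bwd_lin prob_space.finite_measure[OF prob_space_bwd]
      by (simp_all add: m0_def m1_def finite_measure.integrable_const sp)
    with low[of y p] low[of y' p']
    have "ln (Z y) - s * m0 + (- s - s\<^sup>2) * q \<le> ln (Z p)" "ln (Z y') + s * m1 + (- s - s\<^sup>2) * q \<le> ln (Z p')"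
      by simp_all
    moreover have "seg d t p p' = y"
    proof (rule ext)
      fix i show "seg d t p p' i = y i"
      proof (cases "i < d")
        case True
        have "seg d t p p' i = y i + (t * (1 + 2 * s) - s) * D i"
          using True by (simp add: p_def p'_def algebra_simps)
        then show ?thesis using t by simp
      qed (use PiE_arb[OF y, of i] in \<open>simp add: seg_def\<close>)
    qed
    moreover have "seg d (1 - t) p p' = y'"
    proof (rule ext)
      fix i show "seg d (1 - t) p p' i = y' i"
      proof (cases "i < d")
        case True
        have "seg d (1 - t) p p' i = y i + (1 + s - t * (1 + 2 * s)) * D i"
          using True by (simp add: p_def p'_def algebra_simps)
        then show ?thesis using t by (simp add: D_def)
      qed (use PiE_arb[OF y', of i] in \<open>simp add: seg_def\<close>)
    qed
    ultimately have "s * m1 - s * m0 + 2 * ((- s - s\<^sup>2) * q) \<le> 0"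
      using ln_Z_concave[of t p p'] ln_Z_concave[of "1 - t" p p'] t by (simp add: algebra_simps)
    then have "s * (m1 - m0) \<le> s * (2 * q + 2 * s * q)" by (simp add: power2_eq_square algebra_simps)
    then show ?thesis using s by simp
  qed
  fix e :: real assume e: "e > 0"
  have "m1 - m0 \<le> 2 * q + 2 * (e / (2 * q + 1)) * q" by (rule bound) (use e q in auto)
  also have "2 * (e / (2 * q + 1)) * q = e * (2 * q / (2 * q + 1))" by simp
  also have "\<dots> \<le> e * 1" using e q by (intro mult_left_mono) auto
  finally show "(\<integral>x. lin y y' x \<partial>bwd y') - (\<integral>x. lin y y' x \<partial>bwd y) \<le> (edist d y y')\<^sup>2 / \<eta> + e"
    by (simp add: q_def m0_def m1_def)
qed

text \<open>Talagrand's inequality and the change of measure, used once from \<open>y\<close> to \<open>y'\<close> and once in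
  the opposite direction, bound twice the left-hand side by the symmetrised relative entropy.\<close>

lemma bwd_contraction_unit:
  assumes [measurable]: "u \<in> borel_measurable (Leb d)" "v \<in> borel_measurable (Leb d)"
    and bd: "\<And>x. x \<in> Rn d \<Longrightarrow> \<bar>u x\<bar> \<le> K" "\<And>x. x \<in> Rn d \<Longrightarrow> \<bar>v x\<bar> \<le> K"
    and le: "\<And>x x'. x \<in> Rn d \<Longrightarrow> x' \<in> Rn d \<Longrightarrow> u x - v x' \<le> (edist d x x')\<^sup>2 / (2 * \<eta>)"
    and y: "y \<in> Rn d" and y': "y' \<in> Rn d"
  shows "(\<integral>x. u x \<partial>bwd y') - (\<integral>x. v x \<partial>bwd y) \<le> (edist d y y')\<^sup>2 / (2 * \<eta>)"
proof (rule ccontr)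
  define q X where "q = (edist d y y')\<^sup>2 / (2 * \<eta>)" and "X = (\<integral>x. u x \<partial>bwd y') - (\<integral>x. v x \<partial>bwd y)"
  have q: "0 \<le> q" using eta by (simp add: q_def)
  have tX: "t * X \<le> q" if t: "0 < t" "t < 1" for t
  proof -
    have b: "\<bar>t * w x\<bar> \<le> K" if "\<bar>w x\<bar> \<le> K" for w x
    proof -
      have "\<bar>t * w x\<bar> \<le> 1 * \<bar>w x\<bar>" using t by (simp add: abs_mult mult_left_le_one_le)
      then show ?thesis using that by simp
    qed
    have "t * (\<integral>x. u x \<partial>bwd y') - (\<integral>x. lin y y' x \<partial>bwd y') + ln (Z y') - ln (Z y) \<le> ln (\<integral>x. exp (t * u x) \<partial>bwd y)"
      using change_of_measure[of "\<lambda>x. t * u x" K y' y] b[of u] bd by simp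
    moreover have "ln (\<integral>x. exp (t * u x) \<partial>bwd y) \<le> t * (\<integral>x. v x \<partial>bwd y)"
      by (rule transport_entropy_dual[where K = K]) (use bd le t in auto)
    moreover have "- t * (\<integral>x. v x \<partial>bwd y) + (\<integral>x. lin y y' x \<partial>bwd y) + ln (Z y) - ln (Z y') \<le> ln (\<integral>x. exp (t * - v x) \<partial>bwd y')"
      using change_of_measure[of "\<lambda>x. t * - v x" K y y'] b[of "\<lambda>x. - v x"] bd by (simp add: lin_swap[of y' y])
    moreover have "ln (\<integral>x. exp (t * - v x) \<partial>bwd y') \<le> t * (\<integral>x. - u x \<partial>bwd y')"
    proof (rule transport_entropy_dual[where K = K])
      fix x x' assume "x \<in> Rn d" "x' \<in> Rn d"
      from le[OF this(2,1)] show "- v x - - u x' \<le> (edist d x x')\<^sup>2 / (2 * \<eta>)" by (simp add: edist_commute)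
    qed (use bd t in auto)
    moreover have "(\<integral>x. lin y y' x \<partial>bwd y') - (\<integral>x. lin y y' x \<partial>bwd y) \<le> 2 * q"
      using lin_mean_gap[OF y y'] by (simp add: q_def)
    ultimately show ?thesis by (simp add: X_def algebra_simps)
  qed
  assume "\<not> ?thesis"
  then have "q < X" by (simp add: q_def X_def)
  \<comment> \<open>The weight \<open>t = (X + q) / (2 X)\<close> makes \<open>t X\<close> the midpoint of \<open>q\<close> and \<open>X\<close>.\<close>
  then have "(X + q) / (2 * X) * X \<le> q" using q by (intro tX) (auto simp: field_simps)
  then show False using \<open>q < X\<close> q by simp
qed

text \<open>In dual form: the backward channel does not expand the Wasserstein distance of order 2.
  Both sides are homogeneous in \<open>u\<close>, \<open>v\<close> and \<open>a\<close>, so the constant \<open>a = 1 / (2 \<eta>)\<close> suffices.\<close>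

lemma bwd_contraction:
  assumes [measurable]: "u \<in> borel_measurable (Leb d)" "v \<in> borel_measurable (Leb d)"
    and bd: "\<And>x. x \<in> Rn d \<Longrightarrow> \<bar>u x\<bar> \<le> K" "\<And>x. x \<in> Rn d \<Longrightarrow> \<bar>v x\<bar> \<le> K"
    and a: "a > 0"
    and le: "\<And>x x'. x \<in> Rn d \<Longrightarrow> x' \<in> Rn d \<Longrightarrow> u x \<le> v x' + a * (edist d x x')\<^sup>2"
    and y: "y \<in> Rn d" and y': "y' \<in> Rn d"
  shows "(\<integral>x. u x \<partial>bwd y) \<le> (\<integral>x. v x \<partial>bwd y') + a * (edist d y y')\<^sup>2"
proof -
  define \<kappa> where "\<kappa> = 2 * \<eta> * a"
  have \<kappa>: "\<kappa> > 0" using a eta by (simp add: \<kappa>_def)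
  have "(\<integral>x. u x / \<kappa> \<partial>bwd y) - (\<integral>x. v x / \<kappa> \<partial>bwd y') \<le> (edist d y' y)\<^sup>2 / (2 * \<eta>)"
  proof (rule bwd_contraction_unit[where K = "K / \<kappa>"])
    fix x x' assume x: "x \<in> Rn d" "x' \<in> Rn d"
    have "(u x - v x') / \<kappa> \<le> a * (edist d x x')\<^sup>2 / \<kappa>"
      using le[OF x] \<kappa> by (intro divide_right_mono) auto
    also have "\<dots> = (edist d x x')\<^sup>2 / (2 * \<eta>)" using a by (simp add: \<kappa>_def)
    finally show "u x / \<kappa> - v x' / \<kappa> \<le> (edist d x x')\<^sup>2 / (2 * \<eta>)" by (simp add: diff_divide_distrib)
  qed (use bd \<kappa> y y' in \<open>auto simp: divide_right_mono abs_divide\<close>)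
  then have "((\<integral>x. u x \<partial>bwd y) - (\<integral>x. v x \<partial>bwd y')) / \<kappa> \<le> a * (edist d y y')\<^sup>2 / \<kappa>"
    using a by (simp add: \<kappa>_def edist_commute diff_divide_distrib)
  then show ?thesis using \<kappa> by (simp add: divide_le_cancel)
qed

end

section \<open>Gaussian measures\<close>

lemma gaussian_density_eq:
  assumes "\<sigma> > 0"
  shows "(\<Prod>i<d. normal_density (m i) \<sigma> (x i))
     = (1 / sqrt (2 * pi * \<sigma>\<^sup>2)) ^ d * exp (- (edist d x m)\<^sup>2 / (2 * \<sigma>\<^sup>2))"
proof -
  have "(\<Prod>i<d. normal_density (m i) \<sigma> (x i))
      = (\<Prod>i<d. 1 / sqrt (2 * pi * \<sigma>\<^sup>2)) * (\<Prod>i<d. exp (- (x i - m i)\<^sup>2 / (2 * \<sigma>\<^sup>2)))"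
    unfolding normal_density_def by (rule prod.distrib)
  also have "(\<Prod>i<d. exp (- (x i - m i)\<^sup>2 / (2 * \<sigma>\<^sup>2))) = exp (- (edist d x m)\<^sup>2 / (2 * \<sigma>\<^sup>2))"
    by (simp add: edist_sq exp_sum[symmetric] sum_divide_distrib sum_negf)
  finally show ?thesis by simp
qed

lemma gaussian_density_measurable [measurable]:
  "(\<lambda>x. \<Prod>i<d. normal_density (m i) \<sigma> (x i)) \<in> borel_measurable (Leb d)"
  by measurable

lemma sets_gaussian [simp, measurable_cong]: "sets (gaussian d m \<sigma>) = sets (Leb d)"
  by (simp add: gaussian_def)

lemma space_gaussian [simp]: "space (gaussian d m \<sigma>) = Rn d"
  using sets_eq_imp_space_eq[OF sets_gaussian] by (simp add: space_Leb)

lemma nn_integral_gaussian_density: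
  assumes "\<sigma> > 0"
  shows "(\<integral>\<^sup>+x. ennreal (\<Prod>i<d. normal_density (m i) \<sigma> (x i)) \<partial>Leb d) = 1"
proof -
  have "(\<integral>\<^sup>+x. ennreal (\<Prod>i<d. normal_density (m i) \<sigma> (x i)) \<partial>Leb d)
      = (\<integral>\<^sup>+x. (\<Prod>i<d. ennreal (normal_density (m i) \<sigma> (x i))) \<partial>Leb d)"
    by (intro nn_integral_cong) (simp add: prod_ennreal)
  also have "\<dots> = (\<Prod>i<d. \<integral>\<^sup>+a. ennreal (normal_density (m i) \<sigma> a) \<partial>lborel)"
    by (rule Leb.product_nn_integral_prod) auto
  also have "\<dots> = (\<Prod>i<d. 1)"
  proof (intro prod.cong refl)
    fix i
    interpret prob_space "density lborel (\<lambda>a. ennreal (normal_density (m i) \<sigma> a))"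
      by (rule prob_space_normal_density[OF assms])
    show "(\<integral>\<^sup>+a. ennreal (normal_density (m i) \<sigma> a) \<partial>lborel) = 1"
      using emeasure_space_1 by (simp add: emeasure_density)
  qed
  finally show ?thesis by simp
qed

lemma prob_space_gaussian:
  assumes "\<sigma> > 0"
  shows "prob_space (gaussian d m \<sigma>)"
proof
  have "emeasure (gaussian d m \<sigma>) (space (gaussian d m \<sigma>))
      = (\<integral>\<^sup>+x. ennreal (\<Prod>i<d. normal_density (m i) \<sigma> (x i)) \<partial>Leb d)"
    unfolding gaussian_def by (subst emeasure_density) (auto intro!: nn_integral_cong simp: space_Leb)
  then show "emeasure (gaussian d m \<sigma>) (space (gaussian d m \<sigma>)) = 1"
    using nn_integral_gaussian_density[OF assms] by simp
qed

lemma integral_gaussian: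
  fixes u :: "(nat \<Rightarrow> real) \<Rightarrow> real"
  assumes [measurable]: "u \<in> borel_measurable (Leb d)"
  shows "(\<integral>x. u x \<partial>gaussian d m \<sigma>) = (\<integral>x. u x * (\<Prod>i<d. normal_density (m i) \<sigma> (x i)) \<partial>Leb d)"
    "integrable (gaussian d m \<sigma>) u \<longleftrightarrow> integrable (Leb d) (\<lambda>x. u x * (\<Prod>i<d. normal_density (m i) \<sigma> (x i)))"
  unfolding gaussian_def
  by (subst integral_density integrable_density; auto simp: mult.commute prod_nonneg)+

lemma gaussian_coordinate_mean:
  assumes s: "\<sigma> > 0" and i: "i < d"
  shows "integrable (gaussian d m \<sigma>) (\<lambda>x. x i - m i)" "(\<integral>x. x i - m i \<partial>gaussian d m \<sigma>) = 0"
proof -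
  define g where "g j a = normal_density (m j) \<sigma> a * (if j = i then a - m i else 1)" for j a
  have "integrable lborel (\<lambda>a. normal_density (m i) \<sigma> a * a)" "(\<integral>a. normal_density (m i) \<sigma> a * a \<partial>lborel) = m i"
    using normal_moment_nz_1[of \<sigma> "m i"] s by (auto simp: has_bochner_integral_iff)
  then have 1: "integrable lborel (\<lambda>a. normal_density (m i) \<sigma> a * (a - m i))"
    "(\<integral>a. normal_density (m i) \<sigma> a * (a - m i) \<partial>lborel) = 0"
    using integrable_normal_density[OF s, of "m i"] integral_normal_density[OF s, of "m i"]
    by (auto simp: right_diff_distrib)
  have g: "integrable lborel (g j)" for j
  proof -
    have "g j = (\<lambda>a. normal_density (m j) \<sigma> a * (if j = i then a - m i else 1))"
      by (rule ext) (simp add: g_def)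
    then show ?thesis using 1(1) integrable_normal_density[OF s, of "m j"] by (cases "j = i") simp_all
  qed
  have eq: "(x i - m i) * (\<Prod>j<d. normal_density (m j) \<sigma> (x j)) = (\<Prod>j<d. g j (x j))" for x
    using i by (simp add: g_def prod.distrib prod.delta mult.commute)
  have "(\<lambda>x. x i) \<in> borel_measurable (Leb d)"
    using measurable_component_singleton[of i "{..<d}" "\<lambda>_. lborel"] i by simp
  then have meas: "(\<lambda>x. x i - m i) \<in> borel_measurable (Leb d)"
    by (rule borel_measurable_diff) simp
  show "integrable (gaussian d m \<sigma>) (\<lambda>x. x i - m i)"
    unfolding integral_gaussian(2)[OF meas] eq by (rule Leb.product_integrable_prod) (auto intro: g)
  have "(\<integral>x. x i - m i \<partial>gaussian d m \<sigma>) = (\<Prod>j<d. \<integral>a. g j a \<partial>lborel)"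
    unfolding integral_gaussian(1)[OF meas] eq by (rule Leb.product_integral_prod) (auto intro: g)
  also have "\<dots> = 0"
    using i 1(2) by (intro prod_zero) (auto intro!: bexI[of _ i] simp: g_def)
  finally show "(\<integral>x. x i - m i \<partial>gaussian d m \<sigma>) = 0" .
qed

definition shift :: "nat \<Rightarrow> (nat \<Rightarrow> real) \<Rightarrow> (nat \<Rightarrow> real) \<Rightarrow> nat \<Rightarrow> real" where
  "shift d h x = (\<lambda>i\<in>{..<d}. x i + h i)"

lemma shift_measurable [measurable]: "shift d h \<in> Leb d \<rightarrow>\<^sub>M Leb d"
  unfolding shift_def by (rule measurable_restrict) measurable

lemma Leb_shift: "distr (Leb d) (Leb d) (shift d h) = Leb d"
proof (rule Leb.PiM_eqI)
  fix A :: "nat \<Rightarrow> real set" assume A: "\<And>i. i \<in> {..<d} \<Longrightarrow> A i \<in> sets lborel"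
  have sA: "(\<lambda>a. a + h i) -` A i \<in> sets lborel" if "i \<in> {..<d}" for i
    using measurable_sets[of "\<lambda>a. a + h i" lborel lborel "A i"] A[OF that] by simp
  have pre: "shift d h -` (Pi\<^sub>E {..<d} A) \<inter> space (Leb d) = (\<Pi>\<^sub>E i\<in>{..<d}. (\<lambda>a. a + h i) -` A i)"
    by (auto simp: shift_def PiE_iff space_Leb)
  have "emeasure (distr (Leb d) (Leb d) (shift d h)) (Pi\<^sub>E {..<d} A) = emeasure (Leb d) (\<Pi>\<^sub>E i\<in>{..<d}. (\<lambda>a. a + h i) -` A i)"
    using A by (subst emeasure_distr) (simp_all add: pre sets_PiM_I_finite)
  also have "\<dots> = (\<Prod>i<d. emeasure lborel ((\<lambda>a. a + h i) -` A i))"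
    by (rule Leb.emeasure_PiM) (simp_all only: finite_lessThan sA)
  also have "\<dots> = (\<Prod>i<d. emeasure lborel (A i))"
  proof (intro prod.cong refl)
    fix i assume i: "i \<in> {..<d}"
    have "emeasure lborel (A i) = emeasure (distr lborel borel ((+) (h i))) (A i)"
      by (simp add: lborel_distr_plus)
    also have "\<dots> = emeasure lborel ((+) (h i) -` A i)"
      using A[OF i] by (subst emeasure_distr) auto
    also have "(+) (h i) -` A i = (\<lambda>a. a + h i) -` A i" by (auto simp: add.commute)
    finally show "emeasure lborel ((\<lambda>a. a + h i) -` A i) = emeasure lborel (A i)" by simp
  qed
  finally show "emeasure (distr (Leb d) (Leb d) (shift d h)) (Pi\<^sub>E {..<d} A) = (\<Prod>i<d. emeasure lborel (A i))" .
qed auto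

lemma gaussian_shift:
  "gaussian d m \<sigma> = distr (gaussian d z \<sigma>) (Leb d) (shift d (\<lambda>i. m i - z i))"
proof -
  let ?h = "\<lambda>i. m i - z i"
  have "gaussian d m \<sigma> = density (distr (Leb d) (Leb d) (shift d ?h)) (\<lambda>x. ennreal (\<Prod>i<d. normal_density (m i) \<sigma> (x i)))"
    unfolding Leb_shift gaussian_def ..
  also have "\<dots> = distr (density (Leb d) (\<lambda>x. ennreal (\<Prod>i<d. normal_density (m i) \<sigma> (shift d ?h x i)))) (Leb d) (shift d ?h)"
    by (rule density_distr) measurable
  also have "(\<lambda>x. ennreal (\<Prod>i<d. normal_density (m i) \<sigma> (shift d ?h x i))) = (\<lambda>x. ennreal (\<Prod>i<d. normal_density (z i) \<sigma> (x i)))"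
    by (intro ext arg_cong[where f = ennreal] prod.cong refl) (simp add: shift_def normal_density_def algebra_simps)
  finally show ?thesis by (simp add: gaussian_def)
qed

lemma integral_gaussian_shift:
  fixes u :: "(nat \<Rightarrow> real) \<Rightarrow> real"
  assumes "u \<in> borel_measurable (Leb d)"
  shows "(\<integral>x. u x \<partial>gaussian d m \<sigma>) = (\<integral>x. u (shift d (\<lambda>i. m i - z i) x) \<partial>gaussian d z \<sigma>)"
  by (subst gaussian_shift[of d m \<sigma> z], rule integral_distr) (use assms in measurable)

text \<open>Jensen after a change of measure.  The log-density ratio \<open>l\<close> of the two Gaussians is
  affine, and its mean is their relative entropy.\<close>

lemma gaussian_log_harnack:
  assumes s: "\<sigma> > 0" and [measurable]: "g \<in> borel_measurable (Leb d)"
    and bd: "\<And>x. x \<in> Rn d \<Longrightarrow> \<bar>g x\<bar> \<le> K"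
  shows "(\<integral>a. g a \<partial>gaussian d x \<sigma>)
    \<le> ln (\<integral>a. exp (g a) \<partial>gaussian d y \<sigma>) + (edist d x y)\<^sup>2 / (2 * \<sigma>\<^sup>2)"
proof -
  interpret X: prob_space "gaussian d x \<sigma>" by (rule prob_space_gaussian[OF s])
  interpret Y: prob_space "gaussian d y \<sigma>" by (rule prob_space_gaussian[OF s])
  define l where "l a = ((edist d a y)\<^sup>2 - (edist d a x)\<^sup>2) / (2 * \<sigma>\<^sup>2)" for a
  have l_eq: "l a = (\<Sum>i<d. (x i - y i) * (a i - x i)) / \<sigma>\<^sup>2 + (edist d x y)\<^sup>2 / (2 * \<sigma>\<^sup>2)" for a
  proof -
    have "(edist d a y)\<^sup>2 - (edist d a x)\<^sup>2 = (\<Sum>i<d. 2 * ((x i - y i) * (a i - x i)) + (x i - y i)\<^sup>2)"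
      unfolding edist_sq sum_subtractf[symmetric] by (intro sum.cong refl) (simp add: power2_eq_square algebra_simps)
    also have "\<dots> = 2 * (\<Sum>i<d. (x i - y i) * (a i - x i)) + (edist d x y)\<^sup>2"
      by (simp add: edist_sq sum.distrib sum_distrib_left)
    finally show ?thesis by (simp add: l_def add_divide_distrib)
  qed
  have l_int: "integrable (gaussian d x \<sigma>) l" "(\<integral>a. l a \<partial>gaussian d x \<sigma>) = (edist d x y)\<^sup>2 / (2 * \<sigma>\<^sup>2)"
  proof -
    have i: "integrable (gaussian d x \<sigma>) (\<lambda>a. \<Sum>i<d. (x i - y i) * (a i - x i))"
      by (intro Bochner_Integration.integrable_sum integrable_mult_right gaussian_coordinate_mean s) simp
    then show "integrable (gaussian d x \<sigma>) l"
      unfolding l_eq by (intro Bochner_Integration.integrable_add integrable_divide) auto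
    have "(\<integral>a. (\<Sum>i<d. (x i - y i) * (a i - x i)) \<partial>gaussian d x \<sigma>) = (\<Sum>i<d. (x i - y i) * (\<integral>a. a i - x i \<partial>gaussian d x \<sigma>))"
      by (subst Bochner_Integration.integral_sum)
         (auto intro!: integrable_mult_right gaussian_coordinate_mean s simp del: Bochner_Integration.integral_diff)
    also have "\<dots> = 0"
      by (intro sum.neutral ballI) (simp add: gaussian_coordinate_mean(2)[OF s] del: Bochner_Integration.integral_diff)
    finally show "(\<integral>a. l a \<partial>gaussian d x \<sigma>) = (edist d x y)\<^sup>2 / (2 * \<sigma>\<^sup>2)"
      unfolding l_eq using i by (subst Bochner_Integration.integral_add) (use X.prob_space in auto)
  qed
  have [measurable]: "l \<in> borel_measurable (Leb d)" using l_int(1) by (auto dest: borel_measurable_integrable)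
  have g_int: "integrable (gaussian d x \<sigma>) g" "integrable (gaussian d y \<sigma>) (\<lambda>a. exp (g a))"
    using bd by (auto intro!: X.integrable_const_bound[where B = K] Y.integrable_const_bound[where B = "exp K"] simp: abs_le_iff)
  have eq: "exp (g a - l a) * (\<Prod>i<d. normal_density (x i) \<sigma> (a i)) = exp (g a) * (\<Prod>i<d. normal_density (y i) \<sigma> (a i))" for a
  proof -
    have "g a - l a + - (edist d a x)\<^sup>2 / (2 * \<sigma>\<^sup>2) = g a + - (edist d a y)\<^sup>2 / (2 * \<sigma>\<^sup>2)"
      by (simp add: l_def diff_divide_distrib)
    then have "exp (g a - l a) * exp (- (edist d a x)\<^sup>2 / (2 * \<sigma>\<^sup>2)) = exp (g a) * exp (- (edist d a y)\<^sup>2 / (2 * \<sigma>\<^sup>2))"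
      by (simp only: exp_add[symmetric])
    moreover have "e1 * (k * f1) = e2 * (k * f2)" if "e1 * f1 = e2 * f2" for e1 f1 e2 f2 k :: real
      using that by (metis mult.left_commute)
    ultimately show ?thesis unfolding gaussian_density_eq[OF s] by blast
  qed
  have i2: "integrable (gaussian d x \<sigma>) (\<lambda>a. exp (g a - l a))"
    using g_int(2) by (subst integral_gaussian(2), simp, subst (asm) integral_gaussian(2), simp) (simp only: eq)
  have "(\<integral>a. g a - l a \<partial>gaussian d x \<sigma>) \<le> ln (\<integral>a. exp (g a - l a) \<partial>gaussian d x \<sigma>)"
    by (intro X.jensen_exp i2 Bochner_Integration.integrable_diff g_int l_int)
  also have "(\<integral>a. exp (g a - l a) \<partial>gaussian d x \<sigma>) = (\<integral>a. exp (g a) \<partial>gaussian d y \<sigma>)"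
    by (subst (1 2) integral_gaussian(1)) (simp_all only: eq, measurable)
  finally show ?thesis using g_int l_int by simp
qed

section \<open>The log-Harnack inequality\<close>

context smooth_convex
begin

abbreviation fwd :: "(nat \<Rightarrow> real) \<Rightarrow> (nat \<Rightarrow> real) measure" where
  "fwd x \<equiv> gaussian d x (sqrt \<eta>)"

lemma prob_space_fwd: "prob_space (fwd x)"
  using eta by (intro prob_space_gaussian) simp

definition bounded_obs :: "real \<Rightarrow> real \<Rightarrow> ((nat \<Rightarrow> real) \<Rightarrow> real) \<Rightarrow> bool" where
  "bounded_obs a b F \<longleftrightarrow> F \<in> borel_measurable (Leb d) \<and> (\<forall>x\<in>Rn d. a \<le> F x \<and> F x \<le> b)"

lemma bounded_obsI:
  "F \<in> borel_measurable (Leb d) \<Longrightarrow> (\<And>x. x \<in> Rn d \<Longrightarrow> a \<le> F x) \<Longrightarrow> (\<And>x. x \<in> Rn d \<Longrightarrow> F x \<le> b) \<Longrightarrow> bounded_obs a b F"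
  by (simp add: bounded_obs_def)

lemma bounded_obsD:
  assumes "bounded_obs a b F"
  shows "F \<in> borel_measurable (Leb d)" "x \<in> Rn d \<Longrightarrow> a \<le> F x" "x \<in> Rn d \<Longrightarrow> F x \<le> b"
    "x \<in> Rn d \<Longrightarrow> \<bar>F x\<bar> \<le> max \<bar>a\<bar> \<bar>b\<bar>"
  using assms by (auto simp: bounded_obs_def)

lemma bounded_obs_integrable:
  assumes F: "bounded_obs a b F" and M: "prob_space M" "sets M = sets (Leb d)"
  shows "integrable M F" "a \<le> (\<integral>x. F x \<partial>M)" "(\<integral>x. F x \<partial>M) \<le> b"
proof -
  interpret prob_space M by fact
  have sp: "space M = Rn d" using sets_eq_imp_space_eq[OF M(2)] by (simp add: space_Leb)
  have m: "F \<in> borel_measurable M" using bounded_obsD(1)[OF F] measurable_cong_sets[OF M(2) refl] by blast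
  show i: "integrable M F"
    by (intro integrable_const_bound[where B = "max \<bar>a\<bar> \<bar>b\<bar>"] AE_I2 m) (use bounded_obsD(4)[OF F] sp in simp)
  show "a \<le> (\<integral>x. F x \<partial>M)" by (intro integral_ge_const i AE_I2) (use bounded_obsD(2)[OF F] sp in simp)
  show "(\<integral>x. F x \<partial>M) \<le> b" by (intro integral_le_const i AE_I2) (use bounded_obsD(3)[OF F] sp in simp)
qed

lemma Z_measurable [measurable]: "Z \<in> borel_measurable (Leb d)"
proof -
  interpret sigma_finite_measure "Leb d" by (rule sigma_finite_Leb)
  show ?thesis unfolding Z_def by measurable
qed

definition bwd_op :: "((nat \<Rightarrow> real) \<Rightarrow> real) \<Rightarrow> (nat \<Rightarrow> real) \<Rightarrow> real" where
  "bwd_op F y = (\<integral>x. F x \<partial>bwd y)"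

definition fwd_op :: "((nat \<Rightarrow> real) \<Rightarrow> real) \<Rightarrow> (nat \<Rightarrow> real) \<Rightarrow> real" where
  "fwd_op F x = (\<integral>y. F y \<partial>fwd x)"

lemma bwd_op_obs:
  assumes F: "bounded_obs a b F"
  shows "bounded_obs a b (bwd_op F)"
proof (rule bounded_obsI)
  interpret sigma_finite_measure "Leb d" by (rule sigma_finite_Leb)
  note [measurable] = bounded_obsD(1)[OF F]
  have "bwd_op F = (\<lambda>y. (\<integral>x. F x * exp (- V y x) \<partial>Leb d) / Z y)"
    unfolding bwd_op_def by (intro ext integral_bwd) measurable
  also have "\<dots> \<in> borel_measurable (Leb d)" by measurable
  finally show "bwd_op F \<in> borel_measurable (Leb d)" .
qed (use bounded_obs_integrable[OF F prob_space_bwd sets_bwd] in \<open>simp_all add: bwd_op_def\<close>)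

lemma fwd_op_obs:
  assumes F: "bounded_obs a b F"
  shows "bounded_obs a b (fwd_op F)"
proof (rule bounded_obsI)
  interpret sigma_finite_measure "Leb d" by (rule sigma_finite_Leb)
  note [measurable] = bounded_obsD(1)[OF F]
  have "fwd_op F = (\<lambda>x. \<integral>y. F y * ((1 / sqrt (2 * pi * (sqrt \<eta>)\<^sup>2)) ^ d * exp (- (edist d y x)\<^sup>2 / (2 * (sqrt \<eta>)\<^sup>2))) \<partial>Leb d)"
    unfolding fwd_op_def
    by (rule ext, subst integral_gaussian(1)) (use eta in \<open>simp_all add: gaussian_density_eq\<close>)
  also have "\<dots> \<in> borel_measurable (Leb d)" by measurable
  finally show "fwd_op F \<in> borel_measurable (Leb d)" .
qed (use bounded_obs_integrable[OF F prob_space_fwd sets_gaussian] in \<open>simp_all add: fwd_op_def\<close>)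

definition round_op :: "((nat \<Rightarrow> real) \<Rightarrow> real) \<Rightarrow> (nat \<Rightarrow> real) \<Rightarrow> real" where
  "round_op F = fwd_op (bwd_op F)"

lemma round_op_obs: "bounded_obs a b F \<Longrightarrow> bounded_obs a b (round_op F)"
  unfolding round_op_def by (intro fwd_op_obs bwd_op_obs)

lemma round_op_iter_obs: "bounded_obs a b F \<Longrightarrow> bounded_obs a b ((round_op ^^ n) F)"
  by (induction n) (simp_all add: round_op_obs)

lemma ln_obs: "0 < a \<Longrightarrow> bounded_obs a b F \<Longrightarrow> bounded_obs (ln a) (ln b) (\<lambda>x. ln (F x))"
proof (rule bounded_obsI)
  assume a: "0 < a" and F: "bounded_obs a b F"
  show "(\<lambda>x. ln (F x)) \<in> borel_measurable (Leb d)" using bounded_obsD(1)[OF F] by measurable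
  fix x assume x: "x \<in> Rn d"
  have "0 < F x" using a bounded_obsD(2)[OF F x] by linarith
  then show "ln a \<le> ln (F x)" "ln (F x) \<le> ln b"
    using bounded_obsD(2,3)[OF F x] a by (auto intro!: ln_mono)
qed

lemma bwd_op_ln_le:
  assumes a: "0 < a" and F: "bounded_obs a b F"
  shows "bwd_op (\<lambda>x. ln (F x)) y \<le> ln (bwd_op F y)"
proof -
  interpret prob_space "bwd y" by (rule prob_space_bwd)
  have e: "exp (ln (F x)) = F x" if "x \<in> space (bwd y)" for x
    using bounded_obsD(2)[OF F, of x] a that by simp
  have "integrable (bwd y) (\<lambda>x. exp (ln (F x))) \<longleftrightarrow> integrable (bwd y) F"
    by (intro Bochner_Integration.integrable_cong refl e)
  then have i: "integrable (bwd y) (\<lambda>x. exp (ln (F x)))"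
    using bounded_obs_integrable(1)[OF F prob_space_bwd sets_bwd] by simp
  have "(\<integral>x. ln (F x) \<partial>bwd y) \<le> ln (\<integral>x. exp (ln (F x)) \<partial>bwd y)"
    by (intro jensen_exp i bounded_obs_integrable(1)[OF ln_obs[OF a F] prob_space_bwd sets_bwd])
  also have "(\<integral>x. exp (ln (F x)) \<partial>bwd y) = (\<integral>x. F x \<partial>bwd y)"
    by (intro Bochner_Integration.integral_cong refl e)
  finally show ?thesis by (simp add: bwd_op_def)
qed

lemma fwd_op_harnack:
  assumes a: "0 < a" and F: "bounded_obs a b F"
  shows "fwd_op (\<lambda>x. ln (F x)) x \<le> ln (fwd_op F y) + (edist d x y)\<^sup>2 / (2 * \<eta>)"
proof -
  have "(\<integral>z. ln (F z) \<partial>fwd x) \<le> ln (\<integral>z. exp (ln (F z)) \<partial>fwd y) + (edist d x y)\<^sup>2 / (2 * (sqrt \<eta>)\<^sup>2)"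
    by (rule gaussian_log_harnack[OF _ _ bounded_obsD(4)[OF ln_obs[OF a F]]])
       (use eta bounded_obsD(1)[OF ln_obs[OF a F]] in auto)
  also have "(\<integral>z. exp (ln (F z)) \<partial>fwd y) = (\<integral>z. F z \<partial>fwd y)"
  proof (intro Bochner_Integration.integral_cong refl)
    fix z assume "z \<in> space (fwd y)"
    then have "0 < F z" using bounded_obsD(2)[OF F, of z] a by simp
    then show "exp (ln (F z)) = F z" by simp
  qed
  finally show ?thesis using eta by (simp add: fwd_op_def)
qed

text \<open>In the inductive round_op, \<open>z\<close> divides the segment from \<open>x\<close> to \<open>y\<close>.  Translating the
  Gaussian at \<open>z\<close> to \<open>x\<close> and applying the induction hypothesis through the backward channel
  costs \<open>\<bar>x - z\<bar>\<^sup>2 / (2 n \<eta>)\<close>, and the Harnack inequality of the Gaussian from \<open>z\<close> to \<open>y\<close>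
  costs \<open>\<bar>z - y\<bar>\<^sup>2 / (2 \<eta>)\<close>.\<close>

lemma log_harnack:
  assumes a: "0 < a" and F: "bounded_obs a b F" and x: "x \<in> Rn d" and y: "y \<in> Rn d"
  shows "(round_op ^^ Suc n) (\<lambda>x. ln (F x)) x \<le> ln ((round_op ^^ Suc n) F y) + (edist d x y)\<^sup>2 / (2 * real (Suc n) * \<eta>)"
  using x y
proof (induction n arbitrary: x y)
  case 0
  have m: "fwd_op G x \<le> fwd_op H x" if "bounded_obs a' b' G" "bounded_obs a'' b'' H" "\<And>z. G z \<le> H z" for G H a' b' a'' b''
    unfolding fwd_op_def
    by (intro Bochner_Integration.integral_mono bounded_obs_integrable(1)[OF that(1) prob_space_fwd sets_gaussian]
        bounded_obs_integrable(1)[OF that(2) prob_space_fwd sets_gaussian] that(3))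
  have "round_op (\<lambda>x. ln (F x)) x \<le> fwd_op (\<lambda>y. ln (bwd_op F y)) x"
    unfolding round_op_def
    by (rule m[OF bwd_op_obs[OF ln_obs[OF a F]] ln_obs[OF a bwd_op_obs[OF F]] bwd_op_ln_le[OF a F]])
  also have "\<dots> \<le> ln (fwd_op (bwd_op F) y) + (edist d x y)\<^sup>2 / (2 * \<eta>)"
    by (rule fwd_op_harnack[OF a bwd_op_obs[OF F]])
  finally show ?case by (simp add: round_op_def)
next
  case (Suc n)
  define c where "c = 1 / (2 * real (Suc n) * \<eta>)"
  have c: "c > 0" using eta by (simp add: c_def)
  define u w where "u = (round_op ^^ Suc n) (\<lambda>x. ln (F x))" and "w = (round_op ^^ Suc n) F"
  have u: "bounded_obs (ln a) (ln b) u" and w: "bounded_obs a b w"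
    unfolding u_def w_def by (intro round_op_iter_obs ln_obs a F)+
  define K where "K = max \<bar>ln a\<bar> \<bar>ln b\<bar>"
  have contr: "bwd_op u y1 \<le> ln (bwd_op w y2) + c * (edist d y1 y2)\<^sup>2" if "y1 \<in> Rn d" "y2 \<in> Rn d" for y1 y2
  proof -
    have "bwd_op u y1 \<le> bwd_op (\<lambda>x. ln (w x)) y2 + c * (edist d y1 y2)\<^sup>2"
      unfolding bwd_op_def
    proof (rule bwd_contraction[where K = K])
      fix x x' assume "x \<in> Rn d" "x' \<in> Rn d"
      from Suc.IH[OF this] show "u x \<le> ln (w x') + c * (edist d x x')\<^sup>2"
        by (simp add: u_def w_def c_def)
    next
      fix x assume "x \<in> Rn d"
      then show "\<bar>u x\<bar> \<le> K" "\<bar>ln (w x)\<bar> \<le> K"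
        unfolding K_def using bounded_obsD(4)[OF u] bounded_obsD(4)[OF ln_obs[OF a w]] by auto
    qed (use c that bounded_obsD(1)[OF u] bounded_obsD(1)[OF ln_obs[OF a w]] in auto)
    also have "bwd_op (\<lambda>x. ln (w x)) y2 \<le> ln (bwd_op w y2)" by (rule bwd_op_ln_le[OF a w])
    finally show ?thesis by simp
  qed
  define s where "s = real (Suc n) / real (Suc (Suc n))"
  define z where "z = seg d s x y"
  have z: "z \<in> Rn d" by (simp add: z_def)
  have dx: "(edist d x z)\<^sup>2 = s\<^sup>2 * (edist d x y)\<^sup>2" and dy: "(edist d z y)\<^sup>2 = (1 - s)\<^sup>2 * (edist d x y)\<^sup>2"
    unfolding edist_sq sum_distrib_left z_def
    by (intro sum.cong refl; simp add: power2_eq_square algebra_simps)+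
  have int_u: "integrable (fwd z) (\<lambda>a. bwd_op u (shift d (\<lambda>i. x i - z i) a))"
  proof -
    have "bounded_obs (ln a) (ln b) (\<lambda>a. bwd_op u (shift d (\<lambda>i. x i - z i) a))"
    proof (rule bounded_obsI)
      show "(\<lambda>a. bwd_op u (shift d (\<lambda>i. x i - z i) a)) \<in> borel_measurable (Leb d)"
        using bounded_obsD(1)[OF bwd_op_obs[OF u]] by measurable
    qed (use bounded_obsD(2,3)[OF bwd_op_obs[OF u]] in \<open>simp_all add: shift_def\<close>)
    then show ?thesis by (rule bounded_obs_integrable(1)[OF _ prob_space_fwd sets_gaussian])
  qed
  have int_w: "integrable (fwd z) (\<lambda>a. ln (bwd_op w a))"
    by (rule bounded_obs_integrable(1)[OF ln_obs[OF a bwd_op_obs[OF w]] prob_space_fwd sets_gaussian])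
  interpret G: prob_space "fwd z" by (rule prob_space_fwd)
  have "round_op u x = (\<integral>a. bwd_op u (shift d (\<lambda>i. x i - z i) a) \<partial>fwd z)"
    unfolding round_op_def fwd_op_def by (rule integral_gaussian_shift) (rule bounded_obsD(1)[OF bwd_op_obs[OF u]])
  also have "\<dots> \<le> (\<integral>a. ln (bwd_op w a) + c * (edist d x z)\<^sup>2 \<partial>fwd z)"
  proof (rule Bochner_Integration.integral_mono[OF int_u])
    fix a assume "a \<in> space (fwd z)"
    then have a: "a \<in> Rn d" by simp
    have "shift d (\<lambda>i. x i - z i) a \<in> Rn d" by (simp add: shift_def)
    moreover have "edist d (shift d (\<lambda>i. x i - z i) a) a = edist d x z"
      by (rule edist_eq_cong) (simp add: shift_def)
    ultimately show "bwd_op u (shift d (\<lambda>i. x i - z i) a) \<le> ln (bwd_op w a) + c * (edist d x z)\<^sup>2"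
      using contr[OF _ a] by metis
  qed (use int_w in simp)
  also have "\<dots> = fwd_op (\<lambda>a. ln (bwd_op w a)) z + c * (edist d x z)\<^sup>2"
    using int_w G.prob_space by (simp add: fwd_op_def)
  also have "\<dots> \<le> ln (fwd_op (bwd_op w) y) + ((edist d z y)\<^sup>2 / (2 * \<eta>) + c * (edist d x z)\<^sup>2)"
    using fwd_op_harnack[OF a bwd_op_obs[OF w], of z y] by simp
  also have "(edist d z y)\<^sup>2 / (2 * \<eta>) + c * (edist d x z)\<^sup>2 = (edist d x y)\<^sup>2 / (2 * real (Suc (Suc n)) * \<eta>)"
  proof -
    define N where "N = real (Suc n)"
    have N: "N > 0" "real (Suc (Suc n)) = N + 1" by (simp_all add: N_def)
    have "(1 - N / (N + 1))\<^sup>2 / (2 * \<eta>) + 1 / (2 * N * \<eta>) * (N / (N + 1))\<^sup>2 = 1 / (2 * (N + 1) * \<eta>)"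
      using N(1) eta by (simp add: power2_eq_square divide_simps) (simp add: algebra_simps)
    then have "((1 - s)\<^sup>2 / (2 * \<eta>) + c * s\<^sup>2) * (edist d x y)\<^sup>2 = 1 / (2 * (N + 1) * \<eta>) * (edist d x y)\<^sup>2"
      by (simp only: s_def c_def N_def[symmetric] N(2))
    then show ?thesis unfolding dx dy N(2) by (simp add: distrib_right)
  qed
  finally have "round_op u x \<le> ln (round_op w y) + (edist d x y)\<^sup>2 / (2 * real (Suc (Suc n)) * \<eta>)"
    by (simp only: round_op_def)
  then show ?case by (simp only: u_def w_def funpow.simps comp_apply)
qed

end

section \<open>Rejection sampling\<close>

context prob_space
begin

lemma iid_first_success:
  fixes n :: nat
  assumes A: "A \<in> events" and B: "B \<in> events"
  defines "P \<equiv> PiM (UNIV :: nat set) (\<lambda>_. M)"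
  shows "emeasure P {\<omega> \<in> space P. (\<forall>i<n. \<omega> i \<notin> A) \<and> \<omega> n \<in> B} = ennreal ((1 - prob A) ^ n * prob B)"
    and "emeasure P {\<omega> \<in> space P. \<forall>i<n. \<omega> i \<notin> A} = ennreal ((1 - prob A) ^ n)"
proof -
  interpret PP: product_prob_space "\<lambda>_. M" "UNIV :: nat set" by standard
  have sp: "\<omega> i \<in> space M" if "\<omega> \<in> space P" for \<omega> and i :: nat
    using that by (auto simp: P_def space_PiM)
  have fail: "emeasure M (space M - A) = ennreal (1 - prob A)"
    using A by (simp add: emeasure_eq_measure prob_compl)
  define X where "X i = (if i < n then space M - A else B)" for i
  have "{\<omega> \<in> space P. (\<forall>i<n. \<omega> i \<notin> A) \<and> \<omega> n \<in> B} = {\<omega> \<in> space P. \<forall>i\<in>{..n}. \<omega> i \<in> X i}"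
    using sp by (force simp: X_def le_less)
  then have "emeasure P {\<omega> \<in> space P. (\<forall>i<n. \<omega> i \<notin> A) \<and> \<omega> n \<in> B} = (\<Prod>i\<in>{..n}. emeasure M (X i))"
    unfolding P_def using PP.emeasure_PiM_Collect[of "{..n}" X] A B by (simp add: X_def)
  also have "\<dots> = (\<Prod>i<n. emeasure M (X i)) * emeasure M (X n)"
    by (simp add: lessThan_Suc_atMost[symmetric])
  also have "(\<Prod>i<n. emeasure M (X i)) = (\<Prod>i<n. ennreal (1 - prob A))"
    by (intro prod.cong refl) (simp add: X_def fail)
  finally show "emeasure P {\<omega> \<in> space P. (\<forall>i<n. \<omega> i \<notin> A) \<and> \<omega> n \<in> B} = ennreal ((1 - prob A) ^ n * prob B)"
    by (simp add: X_def emeasure_eq_measure ennreal_mult ennreal_power)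
  have "{\<omega> \<in> space P. \<forall>i<n. \<omega> i \<notin> A} = {\<omega> \<in> space P. \<forall>i\<in>{..<n}. \<omega> i \<in> space M - A}"
    using sp by auto
  then have "emeasure P {\<omega> \<in> space P. \<forall>i<n. \<omega> i \<notin> A} = (\<Prod>i<n. emeasure M (space M - A))"
    unfolding P_def using PP.emeasure_PiM_Collect[of "{..<n}" "\<lambda>_. space M - A"] A by simp
  then show "emeasure P {\<omega> \<in> space P. \<forall>i<n. \<omega> i \<notin> A} = ennreal ((1 - prob A) ^ n)"
    by (simp add: fail ennreal_power)
qed

lemma iid_failures_sets:
  assumes A: "A \<in> events"
  shows "{\<omega> \<in> space (PiM UNIV (\<lambda>_. M)). \<forall>i::nat. Q i \<longrightarrow> \<omega> i \<notin> A} \<in> sets (PiM UNIV (\<lambda>_. M))"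
proof (rule sets.sets_Collect_countable_All)
  fix i :: nat
  have c: "(\<lambda>\<omega>. \<omega> i) \<in> PiM UNIV (\<lambda>_. M) \<rightarrow>\<^sub>M M" by (rule measurable_component_singleton) simp
  have "{\<omega> \<in> space (PiM UNIV (\<lambda>_. M)). \<omega> i \<notin> A} = (\<lambda>\<omega>. \<omega> i) -` (space M - A) \<inter> space (PiM UNIV (\<lambda>_. M))"
    using measurable_space[OF c] by blast
  also have "\<dots> \<in> sets (PiM UNIV (\<lambda>_. M))" by (rule measurable_sets[OF c]) (use A in auto)
  finally show "{\<omega> \<in> space (PiM UNIV (\<lambda>_. M)). Q i \<longrightarrow> \<omega> i \<notin> A} \<in> sets (PiM UNIV (\<lambda>_. M))"
    by (cases "Q i") simp_all
qed

lemma iid_success_AE: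
  assumes A: "A \<in> events" and p: "0 < prob A"
  shows "AE \<omega> in PiM (UNIV :: nat set) (\<lambda>_. M). \<exists>n. \<omega> n \<in> A"
proof -
  define P where "P = PiM (UNIV :: nat set) (\<lambda>_. M)"
  have N: "{\<omega> \<in> space P. \<forall>i. \<omega> i \<notin> A} \<in> sets P"
    unfolding P_def using iid_failures_sets[OF A, of "\<lambda>_. True"] by simp
  have le: "emeasure P {\<omega> \<in> space P. \<forall>i. \<omega> i \<notin> A} \<le> ennreal ((1 - prob A) ^ n)" for n
  proof -
    have "{\<omega> \<in> space P. \<forall>i. \<omega> i \<notin> A} \<subseteq> {\<omega> \<in> space P. \<forall>i<n. \<omega> i \<notin> A}" by blast
    then have "emeasure P {\<omega> \<in> space P. \<forall>i. \<omega> i \<notin> A} \<le> emeasure P {\<omega> \<in> space P. \<forall>i<n. \<omega> i \<notin> A}"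
      by (rule emeasure_mono) (unfold P_def, rule iid_failures_sets[OF A])
    then show ?thesis using iid_first_success(2)[OF A A, of n] by (simp add: P_def)
  qed
  have "(\<lambda>n. (1 - prob A) ^ n) \<longlonglongrightarrow> 0"
    using p prob_le_1[of A] by (intro LIMSEQ_power_zero) auto
  then have "(\<lambda>n. ennreal ((1 - prob A) ^ n)) \<longlonglongrightarrow> ennreal 0" by (rule tendsto_ennrealI)
  then have "emeasure P {\<omega> \<in> space P. \<forall>i. \<omega> i \<notin> A} \<le> ennreal 0"
    by (rule LIMSEQ_le_const) (use le in auto)
  then have "{\<omega> \<in> space P. \<forall>i. \<omega> i \<notin> A} \<in> null_sets P" using N by (simp add: null_sets_def)
  then have "AE \<omega> in P. \<exists>n. \<omega> n \<in> A"
    by (rule AE_I') auto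
  then show ?thesis unfolding P_def .
qed

end

locale rejection =
  fixes d :: nat and W :: "(nat \<Rightarrow> real) \<Rightarrow> real" and \<alpha> :: real
  assumes alpha: "\<alpha> > 0"
    and W_measurable [measurable]: "W \<in> borel_measurable (Leb d)"
    and W_int: "integrable (Leb d) (\<lambda>x. exp (- W x))"
    and min_in: "arg_min_on W (Rn d) \<in> Rn d"
    and W_lower: "\<And>z. z \<in> Rn d \<Longrightarrow>
      W (arg_min_on W (Rn d)) + \<alpha> / 2 * (edist d z (arg_min_on W (Rn d)))\<^sup>2 \<le> W z"
begin

definition x0 :: "nat \<Rightarrow> real" where "x0 = arg_min_on W (Rn d)"

definition ratio :: "(nat \<Rightarrow> real) \<Rightarrow> real" where
  "ratio z = exp (- W z + W x0 + \<alpha> / 2 * (edist d z x0)\<^sup>2)"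

definition U :: "((nat \<Rightarrow> real) \<times> real) measure" where
  "U = gaussian d x0 (1 / sqrt \<alpha>) \<Otimes>\<^sub>M uniform_measure lborel {0..1::real}"

definition accepted :: "((nat \<Rightarrow> real) \<times> real) set" where
  "accepted = {w \<in> space U. snd w \<le> ratio (fst w)}"

text \<open>The acceptance probability (\<open>prob_accepted\<close>), in closed form so that its dependence on \<open>W\<close> can
  be read off.\<close>

definition p :: real where
  "p = (1 / sqrt (2 * pi / \<alpha>)) ^ d * exp (W x0) * (\<integral>x. exp (- W x) \<partial>Leb d)"

lemma x0_in: "x0 \<in> Rn d"
  unfolding x0_def by (rule min_in)

lemma edist_x0_measurable [measurable]: "(\<lambda>x. edist d x x0) \<in> borel_measurable (Leb d)"
  unfolding edist_def L2_set_def by measurable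

lemma ratio_measurable [measurable]: "ratio \<in> borel_measurable (Leb d)"
  unfolding ratio_def by measurable

lemma ratio_le_1: "z \<in> Rn d \<Longrightarrow> ratio z \<le> 1"
  using W_lower[of z] by (simp add: ratio_def x0_def)

sublocale G: prob_space "gaussian d x0 (1 / sqrt \<alpha>)"
  using alpha by (intro prob_space_gaussian) simp

sublocale I: prob_space "uniform_measure lborel {0..1::real}"
  by (rule prob_space_uniform_measure) simp_all

sublocale GI: pair_prob_space "gaussian d x0 (1 / sqrt \<alpha>)" "uniform_measure lborel {0..1::real}" ..

sublocale U: prob_space U
  unfolding U_def by (rule GI.prob_space_axioms)

lemma sets_U: "sets U = sets (Leb d \<Otimes>\<^sub>M borel)"
  unfolding U_def by (intro sets_pair_measure_cong) simp_all

lemma space_U: "space U = Rn d \<times> UNIV"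
  using sets_eq_imp_space_eq[OF sets_U] by (simp add: space_pair_measure space_Leb)

lemma accepted_sets [measurable]: "accepted \<in> sets U"
proof -
  have "accepted = {w \<in> space (Leb d \<Otimes>\<^sub>M borel). snd w \<le> ratio (fst w)}"
    by (simp add: accepted_def space_U space_pair_measure space_Leb)
  also have "\<dots> \<in> sets (Leb d \<Otimes>\<^sub>M borel)" by measurable
  finally show ?thesis by (simp add: sets_U)
qed

lemma integral_exp_W_pos: "0 < (\<integral>x. exp (- W x) \<partial>Leb d)"
  by (rule prob_space_gibbs(1)[OF W_int])

lemma p_pos: "0 < p"
  unfolding p_def using alpha integral_exp_W_pos by simp

lemma emeasure_gibbs:
  assumes [measurable]: "A \<in> sets (Leb d)"
  shows "emeasure (gibbs d W) A = (\<integral>\<^sup>+x. ennreal (exp (- W x) / (\<integral>x. exp (- W x) \<partial>Leb d)) * indicator A x \<partial>Leb d)"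
  unfolding gibbs_def by (subst emeasure_density) auto

text \<open>The ratio is chosen such that the proposal density times the acceptance probability is
  proportional to \<open>exp (- W)\<close>.\<close>

lemma emeasure_accepted:
  assumes A [measurable]: "A \<in> sets (Leb d)"
  shows "emeasure U (accepted \<inter> (A \<times> UNIV)) = ennreal p * emeasure (gibbs d W) A"
proof -
  have AR: "A \<subseteq> Rn d" using sets.sets_into_space[OF A] by (simp add: space_Leb)
  have s: "accepted \<inter> (A \<times> UNIV) \<in> sets (gaussian d x0 (1 / sqrt \<alpha>) \<Otimes>\<^sub>M uniform_measure lborel {0..1::real})"
  proof -
    have "A \<times> UNIV \<in> sets U" unfolding sets_U by (rule pair_measureI) auto
    then show ?thesis using accepted_sets unfolding U_def by auto
  qed
  have inner: "emeasure (uniform_measure lborel {0..1::real}) (Pair z -` (accepted \<inter> (A \<times> UNIV)))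
      = ennreal (ratio z) * indicator A z" if z: "z \<in> Rn d" for z
  proof (cases "z \<in> A")
    case True
    have "Pair z -` (accepted \<inter> (A \<times> UNIV)) = {..ratio z}"
      using True z by (auto simp: accepted_def space_U)
    moreover have "{0..1} \<inter> {..ratio z} = {0..ratio z}" using ratio_le_1[OF z] by auto
    moreover have "0 \<le> ratio z" by (simp add: ratio_def)
    ultimately show ?thesis using True by (simp add: divide_ennreal_def)
  qed simp
  have dens: "ratio z * (\<Prod>i<d. normal_density (x0 i) (1 / sqrt \<alpha>) (z i))
      = p * (exp (- W z) / (\<integral>x. exp (- W x) \<partial>Leb d))" for z
  proof -
    have "exp (- W z + W x0 + \<alpha> / 2 * (edist d z x0)\<^sup>2) * exp (- (edist d z x0)\<^sup>2 / (2 * (1 / sqrt \<alpha>)\<^sup>2)) = exp (- W z) * exp (W x0)"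
      using alpha by (simp add: power_divide mult.commute flip: exp_add)
    moreover have "2 * pi * (1 / sqrt \<alpha>)\<^sup>2 = 2 * pi / \<alpha>" using alpha by (simp add: power_divide)
    ultimately have "ratio z * (\<Prod>i<d. normal_density (x0 i) (1 / sqrt \<alpha>) (z i)) = (1 / sqrt (2 * pi / \<alpha>)) ^ d * (exp (- W z) * exp (W x0))"
      using alpha by (subst gaussian_density_eq) (simp_all add: ratio_def mult.left_commute)
    then show ?thesis using integral_exp_W_pos by (simp add: p_def)
  qed
  have "emeasure U (accepted \<inter> (A \<times> UNIV)) = (\<integral>\<^sup>+z. emeasure (uniform_measure lborel {0..1::real}) (Pair z -` (accepted \<inter> (A \<times> UNIV))) \<partial>gaussian d x0 (1 / sqrt \<alpha>))"
    unfolding U_def by (rule I.emeasure_pair_measure_alt[OF s])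
  also have "\<dots> = (\<integral>\<^sup>+z. ennreal (ratio z) * indicator A z \<partial>gaussian d x0 (1 / sqrt \<alpha>))"
    by (intro nn_integral_cong inner) simp
  also have "\<dots> = (\<integral>\<^sup>+z. ennreal (\<Prod>i<d. normal_density (x0 i) (1 / sqrt \<alpha>) (z i)) * (ennreal (ratio z) * indicator A z) \<partial>Leb d)"
    unfolding gaussian_def by (subst nn_integral_density) auto
  also have "\<dots> = (\<integral>\<^sup>+z. ennreal p * (ennreal (exp (- W z) / (\<integral>x. exp (- W x) \<partial>Leb d)) * indicator A z) \<partial>Leb d)"
  proof (intro nn_integral_cong)
    fix z
    have "ennreal (\<Prod>i<d. normal_density (x0 i) (1 / sqrt \<alpha>) (z i)) * ennreal (ratio z)
        = ennreal (ratio z * (\<Prod>i<d. normal_density (x0 i) (1 / sqrt \<alpha>) (z i)))"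
      by (subst ennreal_mult[symmetric]) (auto intro!: prod_nonneg simp: ratio_def mult.commute)
    also have "\<dots> = ennreal p * ennreal (exp (- W z) / (\<integral>x. exp (- W x) \<partial>Leb d))"
      unfolding dens using p_pos integral_exp_W_pos by (intro ennreal_mult) auto
    finally show "ennreal (\<Prod>i<d. normal_density (x0 i) (1 / sqrt \<alpha>) (z i)) * (ennreal (ratio z) * indicator A z)
        = ennreal p * (ennreal (exp (- W z) / (\<integral>x. exp (- W x) \<partial>Leb d)) * indicator A z)"
      by (simp only: mult.assoc[symmetric])
  qed
  also have "\<dots> = ennreal p * emeasure (gibbs d W) A"
    unfolding emeasure_gibbs[OF A] by (rule nn_integral_cmult) measurable
  finally show ?thesis .
qed

lemma prob_accepted: "U.prob accepted = p"
proof -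
  have "accepted \<inter> (Rn d \<times> UNIV) = accepted" by (auto simp: accepted_def space_U)
  moreover have "emeasure (gibbs d W) (Rn d) = 1"
    using prob_space.emeasure_space_1[OF prob_space_gibbs(2)[OF W_int]] by simp
  moreover have "Rn d \<in> sets (Leb d)" using sets.top[of "Leb d"] by (simp add: space_Leb)
  ultimately have "emeasure U accepted = ennreal p" using emeasure_accepted[of "Rn d"] by simp
  then show ?thesis using p_pos by (simp add: U.emeasure_eq_measure)
qed

lemma p_le_1: "p \<le> 1"
  using U.prob_le_1[of accepted] by (simp add: prob_accepted)

abbreviation P :: "(nat \<Rightarrow> (nat \<Rightarrow> real) \<times> real) measure" where
  "P \<equiv> PiM UNIV (\<lambda>_. U)"

definition out :: "(nat \<Rightarrow> (nat \<Rightarrow> real) \<times> real) \<Rightarrow> (nat \<Rightarrow> real) \<times> ennreal" where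
  "out \<omega> = (if \<exists>n. \<omega> n \<in> accepted then (fst (\<omega> (LEAST n. \<omega> n \<in> accepted)), of_nat (Suc (LEAST n. \<omega> n \<in> accepted)))
     else (x0, \<infinity>))"

lemma fst_U_measurable: "(\<lambda>\<omega>. fst (\<omega> n)) \<in> P \<rightarrow>\<^sub>M Leb d"
proof -
  have "fst \<in> U \<rightarrow>\<^sub>M Leb d" using measurable_fst[of "Leb d" borel] measurable_cong_sets[OF sets_U refl] by blast
  then show ?thesis by measurable
qed

lemma out_measurable: "out \<in> P \<rightarrow>\<^sub>M Leb d \<Otimes>\<^sub>M borel"
proof -
  have L: "(\<lambda>\<omega>. LEAST n. \<omega> n \<in> accepted) \<in> P \<rightarrow>\<^sub>M count_space UNIV" by measurable
  have "(\<lambda>\<omega>. fst (\<omega> (LEAST n. \<omega> n \<in> accepted))) \<in> P \<rightarrow>\<^sub>M Leb d"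
    by (rule measurable_compose_countable[OF fst_U_measurable L])
  moreover have "(\<lambda>\<omega>. of_nat (Suc (LEAST n. \<omega> n \<in> accepted)) :: ennreal) \<in> borel_measurable P"
    by (rule measurable_compose[OF L]) simp
  moreover have "x0 \<in> space (Leb d)" using x0_in by (simp add: space_Leb)
  ultimately show ?thesis unfolding out_def by measurable
qed

lemma rejection_sampling_eq: "rejection_sampling d W \<alpha> = distr P (Leb d \<Otimes>\<^sub>M borel) out"
proof -
  have "distr P (Leb d \<Otimes>\<^sub>M borel) out = rejection_sampling d W \<alpha>"
    unfolding rejection_sampling_def Let_def x0_def[symmetric]
  proof (rule distr_cong)
    fix \<omega> assume "\<omega> \<in> space P"
    then have "\<omega> n \<in> space U" for n by (auto simp: space_PiM)
    then have "\<omega> n \<in> accepted \<longleftrightarrow> (case \<omega> n of (z, u) \<Rightarrow> u \<le> exp (- W z + W x0 + \<alpha> / 2 * (edist d z x0)\<^sup>2))" for n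
      by (simp add: accepted_def ratio_def split_beta)
    then show "out \<omega> = (if \<exists>n. case \<omega> n of (z, u) \<Rightarrow> u \<le> exp (- W z + W x0 + \<alpha> / 2 * (edist d z x0)\<^sup>2)
        then (fst (\<omega> (LEAST n. case \<omega> n of (z, u) \<Rightarrow> u \<le> exp (- W z + W x0 + \<alpha> / 2 * (edist d z x0)\<^sup>2))),
              of_nat (Suc (LEAST n. case \<omega> n of (z, u) \<Rightarrow> u \<le> exp (- W z + W x0 + \<alpha> / 2 * (edist d z x0)\<^sup>2))))
        else (x0, \<infinity>))"
      by (simp only: out_def)
  qed (simp_all add: U_def)
  then show ?thesis ..
qed

lemma prob_space_P: "prob_space P"
  by (intro prob_space_PiM U.prob_space_axioms)

lemma prob_space_rejection: "prob_space (rejection_sampling d W \<alpha>)"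
  unfolding rejection_sampling_eq by (rule prob_space.prob_space_distr[OF prob_space_P out_measurable])

lemma sets_rejection: "sets (rejection_sampling d W \<alpha>) = sets (Leb d \<Otimes>\<^sub>M borel)"
  by (simp add: rejection_sampling_def Let_def)

lemma success_AE: "AE \<omega> in P. \<exists>n. \<omega> n \<in> accepted"
  by (rule U.iid_success_AE[OF accepted_sets]) (simp add: prob_accepted p_pos)

text \<open>The output and the number of proposals are independent, with law \<open>gibbs d W\<close> and a
  geometric law.  In particular the law is a function of \<open>p\<close> and \<open>gibbs d W\<close> alone.\<close>

lemma emeasure_rejection:
  assumes A [measurable]: "A \<in> sets (Leb d)" and B [measurable]: "B \<in> sets borel"
  shows "emeasure (rejection_sampling d W \<alpha>) (A \<times> B)
     = (\<Sum>n. indicator B (of_nat (Suc n) :: ennreal) * ennreal ((1 - p) ^ n * p)) * emeasure (gibbs d W) A"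
proof -
  define C where "C = accepted \<inter> (A \<times> UNIV)"
  have C: "C \<in> sets U"
  proof -
    have "A \<times> UNIV \<in> sets U" unfolding sets_U by (rule pair_measureI) auto
    then show ?thesis using accepted_sets unfolding C_def by auto
  qed
  define E where "E n = {\<omega> \<in> space P. (\<forall>i<n. \<omega> i \<notin> accepted) \<and> \<omega> n \<in> C}" for n
  have E [measurable]: "E n \<in> sets P" for n unfolding E_def using C by measurable
  have EE: "emeasure P (E n) = ennreal ((1 - p) ^ n * p) * emeasure (gibbs d W) A" for n
  proof -
    have "emeasure P (E n) = ennreal ((1 - p) ^ n * U.prob C)"
      unfolding E_def using U.iid_first_success(1)[OF accepted_sets C, of n] by (simp add: prob_accepted)
    also have "\<dots> = ennreal ((1 - p) ^ n) * emeasure U C"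
      using p_le_1 by (simp add: ennreal_mult U.emeasure_eq_measure)
    also have "\<dots> = ennreal ((1 - p) ^ n) * (ennreal p * emeasure (gibbs d W) A)"
      unfolding C_def emeasure_accepted[OF A] ..
    finally show ?thesis using p_le_1 p_pos by (simp add: ennreal_mult mult.assoc)
  qed
  have S: "A \<times> B \<in> sets (Leb d \<Otimes>\<^sub>M borel)" by measurable
  have pre: "out -` (A \<times> B) \<inter> space P \<in> sets P" by (rule measurable_sets[OF out_measurable S])
  have "emeasure (rejection_sampling d W \<alpha>) (A \<times> B) = emeasure P (out -` (A \<times> B) \<inter> space P)"
    unfolding rejection_sampling_eq by (rule emeasure_distr[OF out_measurable S])
  also have "\<dots> = (\<integral>\<^sup>+\<omega>. indicator (out -` (A \<times> B) \<inter> space P) \<omega> \<partial>P)"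
    using pre by simp
  also have "\<dots> = (\<integral>\<^sup>+\<omega>. (\<Sum>n. indicator B (of_nat (Suc n) :: ennreal) * indicator (E n) \<omega>) \<partial>P)"
  proof (rule nn_integral_cong_AE, rule AE_mp[OF success_AE], intro AE_I2 impI)
    fix \<omega> assume \<omega>: "\<omega> \<in> space P" and ex: "\<exists>n. \<omega> n \<in> accepted"
    define k where "k = (LEAST n. \<omega> n \<in> accepted)"
    have k: "\<omega> k \<in> accepted" unfolding k_def using ex by (rule LeastI_ex)
    have less: "\<omega> i \<notin> accepted" if "i < k" for i using not_less_Least that unfolding k_def by blast
    have "\<omega> n \<notin> C \<or> \<not> (\<forall>i<n. \<omega> i \<notin> accepted)" if "n \<noteq> k" for n
      using k less[of n] that by (cases "n < k") (auto simp: C_def intro!: exI[of _ k])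
    then have "(\<Sum>n. indicator B (of_nat (Suc n) :: ennreal) * indicator (E n) \<omega>)
       = (\<Sum>n\<in>{k}. indicator B (of_nat (Suc n) :: ennreal) * indicator (E n) \<omega> :: ennreal)"
      by (intro suminf_finite) (auto simp: E_def indicator_def)
    also have "\<dots> = indicator (out -` (A \<times> B) \<inter> space P) \<omega>"
    proof -
      have "fst (\<omega> k) \<in> A \<longleftrightarrow> \<omega> \<in> E k" using k less \<omega> by (auto simp: E_def C_def mem_Times_iff)
      moreover have "out \<omega> = (fst (\<omega> k), of_nat (Suc k))" using ex by (simp only: out_def k_def if_True)
      ultimately show ?thesis using \<omega> by (auto simp: indicator_def)
    qed
    finally show "indicator (out -` (A \<times> B) \<inter> space P) \<omega>
        = (\<Sum>n. indicator B (of_nat (Suc n) :: ennreal) * indicator (E n) \<omega> :: ennreal)" by simp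
  qed
  also have "\<dots> = (\<Sum>n. \<integral>\<^sup>+\<omega>. indicator B (of_nat (Suc n) :: ennreal) * indicator (E n) \<omega> \<partial>P)"
    by (rule nn_integral_suminf) measurable
  also have "\<dots> = (\<Sum>n. (indicator B (of_nat (Suc n) :: ennreal) * ennreal ((1 - p) ^ n * p)) * emeasure (gibbs d W) A)"
    by (intro suminf_cong) (simp add: nn_integral_cmult EE mult.assoc)
  finally show ?thesis by simp
qed

lemma geometric_sum: "(\<Sum>n. ennreal ((1 - p) ^ n)) = ennreal (1 / p)"
proof -
  have "(\<lambda>n. (1 - p) ^ n) sums (1 / (1 - (1 - p)))"
    using p_pos p_le_1 by (intro geometric_sums) auto
  then show ?thesis using p_le_1 by (intro suminf_ennreal_eq) auto
qed

lemma rejection_output_law: "distr (rejection_sampling d W \<alpha>) (Leb d) fst = gibbs d W"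
proof (rule measure_eqI)
  fix A assume "A \<in> sets (distr (rejection_sampling d W \<alpha>) (Leb d) fst)"
  then have A: "A \<in> sets (Leb d)" by simp
  have m: "fst \<in> rejection_sampling d W \<alpha> \<rightarrow>\<^sub>M Leb d"
    using measurable_fst[of "Leb d" borel] measurable_cong_sets[OF sets_rejection refl] by blast
  have "fst -` A \<inter> space (rejection_sampling d W \<alpha>) = A \<times> UNIV"
    using sets.sets_into_space[OF A] sets_eq_imp_space_eq[OF sets_rejection] by (auto simp: space_pair_measure)
  then have "emeasure (distr (rejection_sampling d W \<alpha>) (Leb d) fst) A = emeasure (rejection_sampling d W \<alpha>) (A \<times> UNIV)"
    using A m by (simp add: emeasure_distr)
  also have "\<dots> = (\<Sum>n. ennreal ((1 - p) ^ n * p)) * emeasure (gibbs d W) A"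
    using emeasure_rejection[OF A, of UNIV] by simp
  also have "(\<Sum>n. ennreal ((1 - p) ^ n * p)) = (\<Sum>n. ennreal ((1 - p) ^ n)) * ennreal p"
    using p_pos p_le_1 by (simp add: ennreal_mult)
  also have "\<dots> = 1" unfolding geometric_sum using p_pos by (simp flip: ennreal_mult)
  finally show "emeasure (distr (rejection_sampling d W \<alpha>) (Leb d) fst) A = emeasure (gibbs d W) A" by simp
qed simp

text \<open>The number of proposals is the number of initial segments without a success.\<close>

lemma expected_proposals: "(\<integral>\<^sup>+w. snd w \<partial>rejection_sampling d W \<alpha>) = ennreal (1 / p)"
proof -
  define E where "E n = {\<omega> \<in> space P. \<forall>i<n. \<omega> i \<notin> accepted}" for n :: nat
  have E [measurable]: "E n \<in> sets P" for n unfolding E_def by measurable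
  have "(\<integral>\<^sup>+w. snd w \<partial>rejection_sampling d W \<alpha>) = (\<integral>\<^sup>+\<omega>. snd (out \<omega>) \<partial>P)"
    unfolding rejection_sampling_eq by (rule nn_integral_distr[OF out_measurable]) measurable
  also have "\<dots> = (\<integral>\<^sup>+\<omega>. (\<Sum>n. indicator (E n) \<omega>) \<partial>P)"
  proof (rule nn_integral_cong_AE, rule AE_mp[OF success_AE], intro AE_I2 impI)
    fix \<omega> assume \<omega>: "\<omega> \<in> space P" and ex: "\<exists>n. \<omega> n \<in> accepted"
    define k where "k = (LEAST n. \<omega> n \<in> accepted)"
    have k: "\<omega> k \<in> accepted" unfolding k_def using ex by (rule LeastI_ex)
    have less: "\<omega> i \<notin> accepted" if "i < k" for i using not_less_Least that unfolding k_def by blast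
    have ind: "indicator (E n) \<omega> = (if n \<le> k then 1 else 0 :: ennreal)" for n
      using k less \<omega> by (auto simp: E_def indicator_def not_le)
    have "(\<Sum>n. indicator (E n) \<omega>) = (\<Sum>n\<in>{..k}. 1 :: ennreal)"
      unfolding ind by (subst suminf_finite[of "{..k}"]) auto
    also have "\<dots> = snd (out \<omega>)" using ex by (simp add: out_def k_def)
    finally show "snd (out \<omega>) = (\<Sum>n. indicator (E n) \<omega>)" by simp
  qed
  also have "\<dots> = (\<Sum>n. \<integral>\<^sup>+\<omega>. indicator (E n) \<omega> \<partial>P)"
    by (rule nn_integral_suminf) measurable
  also have "\<dots> = (\<Sum>n. ennreal ((1 - p) ^ n))"
    using U.iid_first_success(2)[OF accepted_sets accepted_sets] by (simp add: E_def[symmetric] prob_accepted)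
  finally show ?thesis by (simp add: geometric_sum)
qed

end

section \<open>The implemented sampler and its cost\<close>

lemma density_kernel:
  assumes N: "sigma_finite_measure N"
    and g: "(\<lambda>(y, x). g y x) \<in> borel_measurable (M \<Otimes>\<^sub>M N)"
    and prob: "\<And>y. y \<in> space M \<Longrightarrow> prob_space (density N (g y))"
  shows "(\<lambda>y. density N (g y)) \<in> M \<rightarrow>\<^sub>M subprob_algebra N"
proof (rule measurable_subprob_algebra)
  interpret sigma_finite_measure N by fact
  fix A assume [measurable]: "A \<in> sets N"
  have "(\<lambda>y. \<integral>\<^sup>+x. g y x * indicator A x \<partial>N) \<in> borel_measurable M"
    by (rule borel_measurable_nn_integral) (use g in measurable)
  moreover have e: "emeasure (density N (g y)) A = (\<integral>\<^sup>+x. g y x * indicator A x \<partial>N)" if "y \<in> space M" for y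
    using measurable_Pair2[OF g that] by (intro emeasure_density) auto
  ultimately show "(\<lambda>y. emeasure (density N (g y)) A) \<in> borel_measurable M"
    by (simp only: measurable_cong[OF e])
qed (use prob in \<open>auto intro: prob_space_imp_subprob_space\<close>)

context smooth_convex
begin

lemma fwd_kernel: "fwd \<in> Leb d \<rightarrow>\<^sub>M subprob_algebra (Leb d)"
proof -
  have "(\<lambda>x. density (Leb d) (\<lambda>y. ennreal ((1 / sqrt (2 * pi * (sqrt \<eta>)\<^sup>2)) ^ d * exp (- (edist d y x)\<^sup>2 / (2 * (sqrt \<eta>)\<^sup>2)))))
      \<in> Leb d \<rightarrow>\<^sub>M subprob_algebra (Leb d)"
  proof (rule density_kernel[OF sigma_finite_Leb])
    show "prob_space (density (Leb d) (\<lambda>y. ennreal ((1 / sqrt (2 * pi * (sqrt \<eta>)\<^sup>2)) ^ d * exp (- (edist d y x)\<^sup>2 / (2 * (sqrt \<eta>)\<^sup>2)))))" for x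
      using prob_space_fwd[of x] eta unfolding gaussian_def by (subst (asm) gaussian_density_eq) simp_all
  qed measurable
  then show ?thesis unfolding gaussian_def using eta by (subst gaussian_density_eq) simp_all
qed

lemma bwd_kernel: "bwd \<in> Leb d \<rightarrow>\<^sub>M subprob_algebra (Leb d)"
proof -
  have "(\<lambda>y. density (Leb d) (\<lambda>x. ennreal (exp (- V y x) / Z y))) \<in> Leb d \<rightarrow>\<^sub>M subprob_algebra (Leb d)"
  proof (rule density_kernel[OF sigma_finite_Leb])
    show "prob_space (density (Leb d) (\<lambda>x. ennreal (exp (- V y x) / Z y)))" for y
      using prob_space_bwd[of y] by (simp only: bwd_eq)
  qed measurable
  then show ?thesis by (simp only: bwd_eq[abs_def])
qed

end

locale proximal = smooth_convex +
  assumes small: "\<beta> * \<eta> * real d \<le> 1 / 8" and dim: "d \<ge> 1"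
begin

definition \<alpha> :: real where "\<alpha> = 1 / \<eta> - \<beta>"

abbreviation rej :: "(nat \<Rightarrow> real) \<Rightarrow> ((nat \<Rightarrow> real) \<times> ennreal) measure" where
  "rej y \<equiv> rejection_sampling d (V y) \<alpha>"

lemma beta_eta: "\<beta> * \<eta> \<le> 1 / 8" "0 < \<beta> * \<eta>"
proof -
  show pos: "0 < \<beta> * \<eta>" using beta eta by simp
  have "\<beta> * \<eta> * 1 \<le> \<beta> * \<eta> * real d" using pos dim by (intro mult_left_mono) auto
  then show "\<beta> * \<eta> \<le> 1 / 8" using small by linarith
qed

lemma alpha_pos: "0 < \<alpha>" and alpha_le: "\<alpha> / 2 \<le> 1 / (2 * \<eta>)"
proof -
  have "\<alpha> = (1 - \<beta> * \<eta>) / \<eta>" using eta by (simp add: \<alpha>_def diff_divide_distrib)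
  then show "0 < \<alpha>" using eta beta_eta by simp
  have "\<alpha> \<le> 1 / \<eta>" using beta by (simp add: \<alpha>_def)
  then show "\<alpha> / 2 \<le> 1 / (2 * \<eta>)" by simp
qed

lemma rejection: "rejection d (V y) \<alpha>"
proof
  fix z assume z: "z \<in> Rn d"
  have "\<alpha> / 2 * (edist d z (xs y))\<^sup>2 \<le> 1 / (2 * \<eta>) * (edist d z (xs y))\<^sup>2"
    using alpha_le by (intro mult_right_mono) auto
  then show "V y (xs y) + \<alpha> / 2 * (edist d z (xs y))\<^sup>2 \<le> V y z"
    using V_lower[OF z, of y] by simp
qed (use alpha_pos integrable_exp_V xs(1) in auto)

sublocale R: rejection d "V y" \<alpha> for y
  by (rule rejection)

text \<open>The upper bound on the potential compares \<open>p\<close> with a ratio of two Gaussian normalising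
  constants, so \<open>p \<ge> (\<alpha> / A)\<^bsup>d / 2\<^esup>\<close> where \<open>A\<close> is the effective smoothness.  With
  \<open>x = \<beta> \<eta>\<close> this base is \<open>(1 - x) / (1 + 4 x) \<ge> (1 - 4 x)\<^sup>2\<close>, and Bernoulli's inequality
  concludes.\<close>

lemma acceptance_ge_half: "1 / 2 \<le> R.p y"
proof -
  define A where "A = 1 / \<eta> + 4 * \<beta>"
  have A: "A > 0" using eta beta by (simp add: A_def add_pos_pos)
  define m where "m = xs y"
  have gauss: "integrable (Leb d) (\<lambda>x. exp (- (A / 2 * (edist d x m)\<^sup>2)))"
     "(\<integral>x. exp (- (A / 2 * (edist d x m)\<^sup>2)) \<partial>Leb d) = sqrt (2 * pi / A) ^ d"
  proof -
    define K where "K = (1 / sqrt (2 * pi / A)) ^ d"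
    have K: "K > 0" using A by (simp add: K_def)
    have dens: "(\<Prod>i<d. normal_density (m i) (1 / sqrt A) (x i)) = K * exp (- (A / 2 * (edist d x m)\<^sup>2))" for x
    proof -
      have "2 * pi * (1 / sqrt A)\<^sup>2 = 2 * pi / A" "- (edist d x m)\<^sup>2 / (2 * (1 / sqrt A)\<^sup>2) = - (A / 2 * (edist d x m)\<^sup>2)"
        using A by (simp_all add: power_divide)
      then show ?thesis using A by (subst gaussian_density_eq) (simp_all add: K_def)
    qed
    have n: "(\<integral>\<^sup>+x. ennreal (K * exp (- (A / 2 * (edist d x m)\<^sup>2))) \<partial>Leb d) = 1"
      using nn_integral_gaussian_density[of "1 / sqrt A" d m] A unfolding dens by simp
    have [measurable]: "(\<lambda>x. edist d x m) \<in> borel_measurable (Leb d)"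
      unfolding edist_def L2_set_def by measurable
    have i: "integrable (Leb d) (\<lambda>x. K * exp (- (A / 2 * (edist d x m)\<^sup>2)))"
      by (rule integrableI_nonneg) (use n K in auto)
    then show g: "integrable (Leb d) (\<lambda>x. exp (- (A / 2 * (edist d x m)\<^sup>2)))" using K by simp
    have "ennreal (\<integral>x. K * exp (- (A / 2 * (edist d x m)\<^sup>2)) \<partial>Leb d) = 1"
      using n nn_integral_eq_integral[OF i] K by simp
    then have "K * (\<integral>x. exp (- (A / 2 * (edist d x m)\<^sup>2)) \<partial>Leb d) = 1" by simp
    then show "(\<integral>x. exp (- (A / 2 * (edist d x m)\<^sup>2)) \<partial>Leb d) = sqrt (2 * pi / A) ^ d"
      using A by (simp add: K_def power_divide field_simps)
  qed
  have "exp (- V y m) * sqrt (2 * pi / A) ^ d = (\<integral>x. exp (- V y m) * exp (- (A / 2 * (edist d x m)\<^sup>2)) \<partial>Leb d)"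
    using gauss by simp
  also have "\<dots> \<le> (\<integral>x. exp (- V y x) \<partial>Leb d)"
  proof (rule Bochner_Integration.integral_mono[OF integrable_mult_right[OF gauss(1)] integrable_exp_V])
    fix x assume "x \<in> space (Leb d)"
    then have "x \<in> Rn d" by (simp add: space_Leb)
    have "1 / (2 * \<eta>) + 2 * \<beta> = A / 2" by (simp add: A_def add_divide_distrib)
    with V_upper[OF \<open>x \<in> Rn d\<close>, of y] have "V y x \<le> V y m + A / 2 * (edist d x m)\<^sup>2"
      by (simp only: m_def)
    then show "exp (- V y m) * exp (- (A / 2 * (edist d x m)\<^sup>2)) \<le> exp (- V y x)"
      by (simp flip: exp_add)
  qed
  finally have low: "exp (- V y m) * sqrt (2 * pi / A) ^ d \<le> (\<integral>x. exp (- V y x) \<partial>Leb d)" .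
  define K where "K = (1 / sqrt (2 * pi / \<alpha>)) ^ d"
  have K: "K \<ge> 0" using alpha_pos by (simp add: K_def)
  have "(sqrt (\<alpha> / A)) ^ d = K * exp (V y m) * (exp (- V y m) * sqrt (2 * pi / A) ^ d)"
  proof -
    have "exp (V y m) * exp (- V y m) = 1" by (simp flip: exp_add)
    moreover have "sqrt (\<alpha> / A) = 1 / sqrt (2 * pi / \<alpha>) * sqrt (2 * pi / A)"
      using alpha_pos A by (simp add: real_sqrt_divide real_sqrt_mult)
    ultimately have "sqrt (\<alpha> / A) ^ d = (1 / sqrt (2 * pi / \<alpha>) * sqrt (2 * pi / A)) ^ d" by (simp only:)
    also have "\<dots> = K * sqrt (2 * pi / A) ^ d" unfolding K_def by (rule power_mult_distrib)
    also have "\<dots> = K * (exp (V y m) * exp (- V y m)) * sqrt (2 * pi / A) ^ d" by (simp flip: exp_add)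
    finally show ?thesis by (simp only: mult.assoc)
  qed
  also have "\<dots> \<le> K * exp (V y m) * (\<integral>x. exp (- V y x) \<partial>Leb d)"
    using low K by (intro mult_left_mono) auto
  also have "\<dots> = R.p y" unfolding R.p_def R.x0_def K_def m_def ..
  finally have p: "(sqrt (\<alpha> / A)) ^ d \<le> R.p y" .
  define x where "x = \<beta> * \<eta>"
  have x: "0 < x" "x \<le> 1 / 8" using beta_eta by (auto simp: x_def)
  have "\<alpha> / A = (1 - x) / (1 + 4 * x)"
  proof -
    have "\<alpha> = (1 - x) / \<eta>" "A = (1 + 4 * x) / \<eta>"
      using eta by (simp_all add: \<alpha>_def A_def x_def diff_divide_distrib add_divide_distrib)
    then show ?thesis using eta by simp
  qed
  moreover have "(1 - 4 * x)\<^sup>2 \<le> (1 - x) / (1 + 4 * x)"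
  proof -
    have "(1 - 4 * x)\<^sup>2 * (1 + 4 * x) = 1 - x - x * (3 + 16 * x - 64 * x * x)"
      by (simp add: power2_eq_square algebra_simps)
    moreover have "64 * x * x \<le> 8 * x" using mult_right_mono[OF x(2), of "64 * x"] x(1) by simp
    then have "0 \<le> 3 + 16 * x - 64 * x * x" using x by linarith
    with x(1) have "0 \<le> x * (3 + 16 * x - 64 * x * x)" by (intro mult_nonneg_nonneg) auto
    ultimately have "(1 - 4 * x)\<^sup>2 * (1 + 4 * x) \<le> 1 - x" by linarith
    then show ?thesis using x by (simp add: pos_le_divide_eq)
  qed
  ultimately have sq: "1 - 4 * x \<le> sqrt (\<alpha> / A)" by (intro real_le_rsqrt) simp
  have "x * real d \<le> 1 / 8" using small by (simp only: x_def)
  moreover have "real d * (- (4 * x)) = - 4 * (x * real d)" by simp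
  ultimately have "1 / 2 \<le> 1 + real d * (- (4 * x))" by linarith
  also have "\<dots> \<le> (1 + - (4 * x)) ^ d" by (rule Bernoulli_inequality) (use x in simp)
  also have "\<dots> \<le> sqrt (\<alpha> / A) ^ d" using sq x by (intro power_mono) auto
  finally show ?thesis using p by linarith
qed

lemma p_measurable: "R.p \<in> borel_measurable (Leb d)"
proof -
  note [measurable] = envelope_measurable
  have "(\<lambda>y. (1 / sqrt (2 * pi / \<alpha>)) ^ d * exp (V y (xs y)) * Z y) \<in> borel_measurable (Leb d)"
    by measurable
  also have "(\<lambda>y. (1 / sqrt (2 * pi / \<alpha>)) ^ d * exp (V y (xs y)) * Z y) = R.p"
    by (rule ext) (simp only: R.p_def R.x0_def Z_def)
  finally show ?thesis .
qed

text \<open>Measurability is needed for the monadic composition of the rounds.  On rectangles the law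
  only involves \<open>R.p y\<close> and \<open>bwd y\<close>, which are measurable in \<open>y\<close>.\<close>

lemma rej_kernel: "rej \<in> Leb d \<rightarrow>\<^sub>M subprob_algebra (Leb d \<Otimes>\<^sub>M borel)"
proof (rule measurable_subprob_algebra_generated[OF sets_pair_measure Int_stable_pair_measure_generator pair_measure_closed])
  note [measurable] = p_measurable
  have rect: "(\<lambda>y. emeasure (rej y) (A \<times> B)) \<in> borel_measurable (Leb d)"
    if A [measurable]: "A \<in> sets (Leb d)" and B [measurable]: "B \<in> sets borel" for A and B :: "ennreal set"
  proof -
    have "(\<lambda>y. emeasure (bwd y) A) \<in> borel_measurable (Leb d)"
      by (rule measurable_emeasure_kernel[OF bwd_kernel A])
    then have "(\<lambda>y. (\<Sum>n. indicator B (of_nat (Suc n) :: ennreal) * ennreal ((1 - R.p y) ^ n * R.p y)) * emeasure (bwd y) A)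
        \<in> borel_measurable (Leb d)"
      by measurable
    then show ?thesis by (simp only: R.emeasure_rejection[OF A B])
  qed
  show "subprob_space (rej y)" for y by (rule prob_space_imp_subprob_space[OF R.prob_space_rejection])
  show "sets (rej y) = sets (Leb d \<Otimes>\<^sub>M borel)" for y by (rule R.sets_rejection)
  show "(\<lambda>y. emeasure (rej y) X) \<in> borel_measurable (Leb d)"
    if "X \<in> {a \<times> b |a b. a \<in> sets (Leb d) \<and> b \<in> sets borel}" for X
    using that rect by auto
  show "(\<lambda>y. emeasure (rej y) (space (Leb d) \<times> space borel)) \<in> borel_measurable (Leb d)"
    by (rule rect) auto
qed

definition round_kernel :: "(nat \<Rightarrow> real) \<times> ennreal \<Rightarrow> ((nat \<Rightarrow> real) \<times> ennreal) measure" where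
  "round_kernel = (\<lambda>(x, calls). fwd x \<bind> (\<lambda>y. distr (rej y) (Leb d \<Otimes>\<^sub>M borel) (\<lambda>(x', n). (x', calls + 2 + n))))"

lemma count_kernel:
  "(\<lambda>w. distr (rej (snd w)) (Leb d \<Otimes>\<^sub>M borel) (\<lambda>(x', n). (x', snd (fst w) + 2 + n)))
     \<in> (Leb d \<Otimes>\<^sub>M borel) \<Otimes>\<^sub>M Leb d \<rightarrow>\<^sub>M subprob_algebra (Leb d \<Otimes>\<^sub>M borel)"
proof (rule measurable_distr2[where M = "Leb d \<Otimes>\<^sub>M borel"])
  show "(\<lambda>w. rej (snd w)) \<in> (Leb d \<Otimes>\<^sub>M borel) \<Otimes>\<^sub>M Leb d \<rightarrow>\<^sub>M subprob_algebra (Leb d \<Otimes>\<^sub>M borel)"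
    by (rule measurable_compose[OF measurable_snd rej_kernel])
qed measurable

lemma round_kernel_eq:
  "round_kernel w = fwd (fst w) \<bind> (\<lambda>y. distr (rej y) (Leb d \<Otimes>\<^sub>M borel) (\<lambda>(x', n). (x', snd w + 2 + n)))"
  by (cases w) (simp add: round_kernel_def)

lemma round_kernel_measurable: "round_kernel \<in> Leb d \<Otimes>\<^sub>M borel \<rightarrow>\<^sub>M subprob_algebra (Leb d \<Otimes>\<^sub>M borel)"
  unfolding round_kernel_eq[abs_def]
  by (rule measurable_bind[OF measurable_compose[OF measurable_fst fwd_kernel] count_kernel])

lemma nn_integral_round:
  assumes w: "w \<in> space (Leb d \<Otimes>\<^sub>M (borel :: ennreal measure))"
    and \<phi> [measurable]: "\<phi> \<in> borel_measurable (Leb d \<Otimes>\<^sub>M (borel :: ennreal measure))"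
  shows "(\<integral>\<^sup>+v. \<phi> v \<partial>round_kernel w) = (\<integral>\<^sup>+y. \<integral>\<^sup>+v. \<phi> (fst v, snd w + 2 + snd v) \<partial>rej y \<partial>fwd (fst w))"
proof -
  have k: "(\<lambda>y. distr (rej y) (Leb d \<Otimes>\<^sub>M borel) (\<lambda>(x', n). (x', snd w + 2 + n))) \<in> Leb d \<rightarrow>\<^sub>M subprob_algebra (Leb d \<Otimes>\<^sub>M borel)"
    using measurable_compose[OF measurable_Pair1' count_kernel, OF w] by simp
  have "(\<integral>\<^sup>+v. \<phi> v \<partial>round_kernel w)
      = (\<integral>\<^sup>+y. \<integral>\<^sup>+v. \<phi> v \<partial>distr (rej y) (Leb d \<Otimes>\<^sub>M borel) (\<lambda>(x', n). (x', snd w + 2 + n)) \<partial>fwd (fst w))"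
    unfolding round_kernel_eq
    by (rule nn_integral_bind[OF \<phi>]) (use k measurable_cong_sets[OF sets_gaussian refl] in blast)
  also have "\<dots> = (\<integral>\<^sup>+y. \<integral>\<^sup>+v. \<phi> (fst v, snd w + 2 + snd v) \<partial>rej y \<partial>fwd (fst w))"
  proof (intro nn_integral_cong)
    fix y
    have "(\<lambda>(x', n). (x', snd w + 2 + n)) \<in> Leb d \<Otimes>\<^sub>M borel \<rightarrow>\<^sub>M Leb d \<Otimes>\<^sub>M borel" by measurable
    then have "(\<lambda>(x', n). (x', snd w + 2 + n)) \<in> rej y \<rightarrow>\<^sub>M Leb d \<Otimes>\<^sub>M borel"
      using measurable_cong_sets[OF R.sets_rejection refl] by blast
    then show "(\<integral>\<^sup>+v. \<phi> v \<partial>distr (rej y) (Leb d \<Otimes>\<^sub>M borel) (\<lambda>(x', n). (x', snd w + 2 + n)))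
        = (\<integral>\<^sup>+v. \<phi> (fst v, snd w + 2 + snd v) \<partial>rej y)"
      by (subst nn_integral_distr) (auto simp: split_beta)
  qed
  finally show ?thesis .
qed

lemma bind_steps:
  assumes M: "sets M = sets (Leb d)" and A: "A \<in> sets (Leb d)"
  shows "emeasure ((M \<bind> fwd) \<bind> bwd) A = (\<integral>\<^sup>+x. \<integral>\<^sup>+y. emeasure (bwd y) A \<partial>fwd x \<partial>M)"
    and "sets ((M \<bind> fwd) \<bind> bwd) = sets (Leb d)"
proof -
  have ne: "space M \<noteq> {}" unfolding sets_eq_imp_space_eq[OF M] space_Leb using seg_in_Rn by blast
  have f: "fwd \<in> M \<rightarrow>\<^sub>M subprob_algebra (Leb d)" using fwd_kernel measurable_cong_sets[OF M refl] by blast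
  have s1: "sets (M \<bind> fwd) = sets (Leb d)" by (rule sets_bind[OF _ ne]) simp
  have ne1: "space (M \<bind> fwd) \<noteq> {}" unfolding sets_eq_imp_space_eq[OF s1] space_Leb using seg_in_Rn by blast
  have b: "bwd \<in> (M \<bind> fwd) \<rightarrow>\<^sub>M subprob_algebra (Leb d)" using bwd_kernel measurable_cong_sets[OF s1 refl] by blast
  have "emeasure ((M \<bind> fwd) \<bind> bwd) A = (\<integral>\<^sup>+y. emeasure (bwd y) A \<partial>(M \<bind> fwd))"
    by (rule emeasure_bind[OF ne1 b A])
  also have "\<dots> = (\<integral>\<^sup>+x. \<integral>\<^sup>+y. emeasure (bwd y) A \<partial>fwd x \<partial>M)"
    by (rule nn_integral_bind[OF measurable_emeasure_kernel[OF bwd_kernel A] f])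
  finally show "emeasure ((M \<bind> fwd) \<bind> bwd) A = (\<integral>\<^sup>+x. \<integral>\<^sup>+y. emeasure (bwd y) A \<partial>fwd x \<partial>M)" .
  show "sets ((M \<bind> fwd) \<bind> bwd) = sets (Leb d)" by (rule sets_bind[OF _ ne1]) simp
qed

lemma proximal_sampler_Suc:
  "proximal_sampler d f \<beta> \<eta> \<rho>0 (Suc k) = proximal_sampler d f \<beta> \<eta> \<rho>0 k \<bind> round_kernel"
  by (simp add: round_kernel_def \<alpha>_def)

text \<open>Forgetting the counter turns each round into a round of the ideal sampler.  A round adds the
  call to the proximity operator, the evaluation at the minimizer and \<open>1 / p \<le> 2\<close> proposals on
  average.\<close>

lemma sampler_correct:
  assumes \<rho>0: "prob_space \<rho>0" "sets \<rho>0 = sets (Leb d)"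
  shows "sets (proximal_sampler d f \<beta> \<eta> \<rho>0 k) = sets (Leb d \<Otimes>\<^sub>M borel)
     \<and> sets (proximal_law d f \<eta> \<rho>0 k) = sets (Leb d)
     \<and> prob_space (proximal_sampler d f \<beta> \<eta> \<rho>0 k)
     \<and> distr (proximal_sampler d f \<beta> \<eta> \<rho>0 k) (Leb d) fst = proximal_law d f \<eta> \<rho>0 k
     \<and> (\<integral>\<^sup>+w. snd w \<partial>proximal_sampler d f \<beta> \<eta> \<rho>0 k) \<le> ennreal (4 * real k)"
proof (induction k)
  case 0
  have m: "(\<lambda>x. (x, 0 :: ennreal)) \<in> \<rho>0 \<rightarrow>\<^sub>M Leb d \<Otimes>\<^sub>M borel"
    using \<rho>0(2) by (intro measurable_Pair measurable_ident_sets) auto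
  have "distr (distr \<rho>0 (Leb d \<Otimes>\<^sub>M borel) (\<lambda>x. (x, 0 :: ennreal))) (Leb d) fst = distr \<rho>0 (Leb d) (\<lambda>x. x)"
    using m by (subst distr_distr) (auto simp: comp_def)
  also have "\<dots> = \<rho>0" by (rule distr_id2[OF \<rho>0(2)[symmetric]])
  finally show ?case using \<rho>0 m by (simp add: nn_integral_distr prob_space.prob_space_distr)
next
  case (Suc k)
  define S where "S = proximal_sampler d f \<beta> \<eta> \<rho>0 k"
  define L where "L = proximal_law d f \<eta> \<rho>0 k"
  have S: "sets S = sets (Leb d \<Otimes>\<^sub>M borel)" and L: "sets L = sets (Leb d)" and pS: "prob_space S"
    and SL: "distr S (Leb d) fst = L" and cost: "(\<integral>\<^sup>+w. snd w \<partial>S) \<le> ennreal (4 * real k)"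
    using Suc.IH by (auto simp: S_def L_def)
  interpret prob_space S by fact
  have sS: "space S = space (Leb d \<Otimes>\<^sub>M (borel :: ennreal measure))" using sets_eq_imp_space_eq[OF S] .
  have K: "round_kernel \<in> S \<rightarrow>\<^sub>M subprob_algebra (Leb d \<Otimes>\<^sub>M borel)"
    using round_kernel_measurable measurable_cong_sets[OF S refl] by blast
  have fS: "fst \<in> S \<rightarrow>\<^sub>M Leb d" using measurable_fst[of "Leb d" borel] measurable_cong_sets[OF S refl] by blast
  have Seq: "proximal_sampler d f \<beta> \<eta> \<rho>0 (Suc k) = S \<bind> round_kernel"
    unfolding S_def by (rule proximal_sampler_Suc)
  have Leq: "proximal_law d f \<eta> \<rho>0 (Suc k) = (L \<bind> fwd) \<bind> bwd" by (simp add: L_def)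
  have s1: "sets (S \<bind> round_kernel) = sets (Leb d \<Otimes>\<^sub>M borel)"
    by (rule sets_bind[OF sets_kernel[OF K] not_empty])
  have s2: "sets ((L \<bind> fwd) \<bind> bwd) = sets (Leb d)" by (rule bind_steps(2)[OF L sets.empty_sets])
  have nn: "(\<integral>\<^sup>+v. \<phi> v \<partial>(S \<bind> round_kernel)) = (\<integral>\<^sup>+w. \<integral>\<^sup>+y. \<integral>\<^sup>+v. \<phi> (fst v, snd w + 2 + snd v) \<partial>rej y \<partial>fwd (fst w) \<partial>S)"
    if \<phi>: "\<phi> \<in> borel_measurable (Leb d \<Otimes>\<^sub>M (borel :: ennreal measure))" for \<phi>
    unfolding nn_integral_bind[OF \<phi> K]
    by (intro nn_integral_cong nn_integral_round[OF _ \<phi>]) (simp add: sS)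
  have p1: "prob_space (S \<bind> round_kernel)"
  proof
    have "emeasure (S \<bind> round_kernel) (space (S \<bind> round_kernel)) = (\<integral>\<^sup>+v. 1 \<partial>(S \<bind> round_kernel))" by simp
    also have "\<dots> = (\<integral>\<^sup>+w. \<integral>\<^sup>+y. \<integral>\<^sup>+v. 1 \<partial>rej y \<partial>fwd (fst w) \<partial>S)" by (rule nn) simp
    also have "\<dots> = 1"
      using prob_space.emeasure_space_1[OF R.prob_space_rejection] prob_space.emeasure_space_1[OF prob_space_fwd]
        emeasure_space_1 by (simp del: space_gaussian)
    finally show "emeasure (S \<bind> round_kernel) (space (S \<bind> round_kernel)) = 1" .
  qed
  have law: "distr (S \<bind> round_kernel) (Leb d) fst = (L \<bind> fwd) \<bind> bwd"
  proof (rule measure_eqI)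
    fix A assume "A \<in> sets (distr (S \<bind> round_kernel) (Leb d) fst)"
    then have A [measurable]: "A \<in> sets (Leb d)" by simp
    have m: "fst \<in> (S \<bind> round_kernel) \<rightarrow>\<^sub>M Leb d"
      using measurable_fst[of "Leb d" borel] measurable_cong_sets[OF s1 refl] by blast
    have "emeasure (distr (S \<bind> round_kernel) (Leb d) fst) A = (\<integral>\<^sup>+v. indicator A v \<partial>distr (S \<bind> round_kernel) (Leb d) fst)"
      by simp
    also have "\<dots> = (\<integral>\<^sup>+v. indicator A (fst v) \<partial>(S \<bind> round_kernel))"
      by (rule nn_integral_distr[OF m]) measurable
    also have "\<dots> = (\<integral>\<^sup>+w. \<integral>\<^sup>+y. \<integral>\<^sup>+v. indicator A (fst v) \<partial>rej y \<partial>fwd (fst w) \<partial>S)"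
      by (subst nn) simp_all
    also have "\<dots> = (\<integral>\<^sup>+w. \<integral>\<^sup>+y. emeasure (bwd y) A \<partial>fwd (fst w) \<partial>S)"
    proof (intro nn_integral_cong)
      fix y
      have mr: "fst \<in> rej y \<rightarrow>\<^sub>M Leb d"
        using measurable_fst[of "Leb d" borel] measurable_cong_sets[OF R.sets_rejection refl] by blast
      have "(\<integral>\<^sup>+v. indicator A (fst v) \<partial>rej y) = (\<integral>\<^sup>+x. indicator A x \<partial>distr (rej y) (Leb d) fst)"
        by (rule nn_integral_distr[OF mr, symmetric]) measurable
      also have "\<dots> = emeasure (bwd y) A" unfolding R.rejection_output_law by simp
      finally show "(\<integral>\<^sup>+v. indicator A (fst v) \<partial>rej y) = emeasure (bwd y) A" .
    qed
    also have "\<dots> = (\<integral>\<^sup>+x. \<integral>\<^sup>+y. emeasure (bwd y) A \<partial>fwd x \<partial>distr S (Leb d) fst)"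
    proof (rule nn_integral_distr[OF fS, symmetric])
      have "(\<lambda>(x, y). emeasure (bwd y) A) \<in> borel_measurable (Leb d \<Otimes>\<^sub>M Leb d)"
        unfolding split_beta by (rule measurable_compose[OF measurable_snd measurable_emeasure_kernel[OF bwd_kernel A]])
      from nn_integral_measurable_subprob_algebra2[OF this fwd_kernel]
      show "(\<lambda>x. \<integral>\<^sup>+y. emeasure (bwd y) A \<partial>fwd x) \<in> borel_measurable (distr S (Leb d) fst)" by simp
    qed
    also have "\<dots> = emeasure ((L \<bind> fwd) \<bind> bwd) A" unfolding SL by (rule bind_steps(1)[OF L A, symmetric])
    finally show "emeasure (distr (S \<bind> round_kernel) (Leb d) fst) A = emeasure ((L \<bind> fwd) \<bind> bwd) A" .
  qed (simp add: s2)
  have "(\<integral>\<^sup>+w. snd w \<partial>(S \<bind> round_kernel)) = (\<integral>\<^sup>+w. \<integral>\<^sup>+y. \<integral>\<^sup>+v. snd w + 2 + snd v \<partial>rej y \<partial>fwd (fst w) \<partial>S)"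
    by (subst nn) simp_all
  also have "\<dots> \<le> (\<integral>\<^sup>+w. \<integral>\<^sup>+y. snd w + 4 \<partial>fwd (fst w) \<partial>S)"
  proof (intro nn_integral_mono)
    fix w y
    interpret r: prob_space "rej y" by (rule R.prob_space_rejection)
    have "snd \<in> borel_measurable (rej y)"
      using measurable_snd[of "Leb d" "borel :: ennreal measure"] measurable_cong_sets[OF R.sets_rejection refl] by blast
    then have "(\<integral>\<^sup>+v. snd w + 2 + snd v \<partial>rej y) = snd w + 2 + ennreal (1 / R.p y)"
      using r.emeasure_space_1 by (simp add: nn_integral_add R.expected_proposals)
    also have "ennreal (1 / R.p y) \<le> ennreal 2"
      using acceptance_ge_half[of y] R.p_pos[of y] by (intro ennreal_leI) (simp add: field_simps)
    finally show "(\<integral>\<^sup>+v. snd w + 2 + snd v \<partial>rej y) \<le> snd w + 4"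
      by (simp add: add.assoc add_left_mono)
  qed
  also have "\<dots> = (\<integral>\<^sup>+w. snd w + 4 \<partial>S)"
    using prob_space.emeasure_space_1[OF prob_space_fwd] by (simp del: space_gaussian)
  also have "\<dots> = (\<integral>\<^sup>+w. snd w \<partial>S) + 4"
  proof -
    have "snd \<in> borel_measurable S"
      using measurable_snd[of "Leb d" "borel :: ennreal measure"] measurable_cong_sets[OF S refl] by blast
    then show ?thesis using emeasure_space_1 by (simp add: nn_integral_add)
  qed
  also have "\<dots> \<le> ennreal (4 * real k) + 4" using cost by (intro add_right_mono)
  also have "\<dots> = ennreal (4 * real (Suc k))"
    by (simp add: algebra_simps flip: ennreal_plus ennreal_numeral)
  finally show ?case unfolding Seq Leq using s1 s2 p1 law by simp
qed

end

section \<open>Stationarity and entropy\<close>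

context proximal
begin

abbreviation target :: "(nat \<Rightarrow> real) measure" where
  "target \<equiv> gibbs d f"

abbreviation law :: "(nat \<Rightarrow> real) measure \<Rightarrow> nat \<Rightarrow> (nat \<Rightarrow> real) measure" where
  "law \<equiv> proximal_law d f \<eta>"

definition Zf :: real where "Zf = (\<integral>x. exp (- f x) \<partial>Leb d)"

lemma Zf_pos: "0 < Zf"
  unfolding Zf_def by (rule prob_space_gibbs(1)[OF exp_int])

lemma target_eq: "target = density (Leb d) (\<lambda>x. ennreal (exp (- f x) / Zf))"
  by (simp add: gibbs_def Zf_def)

lemmas sets_target = sets_gibbs[of d f]

lemma prob_space_target: "prob_space target"
  by (rule prob_space_gibbs(2)[OF exp_int])

lemma sampler_law:
  assumes "prob_space \<rho>" "sets \<rho> = sets (Leb d)"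
  shows "prob_space (law \<rho> k)" "sets (law \<rho> k) = sets (Leb d)"
proof -
  have *: "sets (proximal_sampler d f \<beta> \<eta> \<rho> k) = sets (Leb d \<Otimes>\<^sub>M borel)" "prob_space (proximal_sampler d f \<beta> \<eta> \<rho> k)"
    "distr (proximal_sampler d f \<beta> \<eta> \<rho> k) (Leb d) fst = law \<rho> k"
    using sampler_correct[OF assms, of k] by auto
  show "sets (law \<rho> k) = sets (Leb d)" using sampler_correct[OF assms, of k] by auto
  have "fst \<in> proximal_sampler d f \<beta> \<eta> \<rho> k \<rightarrow>\<^sub>M Leb d"
    using measurable_fst[of "Leb d" borel] measurable_cong_sets[OF *(1) refl] by blast
  from prob_space.prob_space_distr[OF *(2) this] show "prob_space (law \<rho> k)" by (simp only: *(3))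
qed

text \<open>The joint law of \<open>x\<close> and \<open>y\<close> has a density proportional to \<open>exp (- V y x)\<close>, and
  \<open>bwd y\<close> is its disintegration over \<open>y\<close>.\<close>

lemma target_stationary: "(target \<bind> fwd) \<bind> bwd = target"
proof (rule measure_eqI)
  interpret sf: sigma_finite_measure "Leb d" by (rule sigma_finite_Leb)
  interpret pair_sigma_finite "Leb d" "Leb d" ..
  show "sets ((target \<bind> fwd) \<bind> bwd) = sets target"
    using bind_steps(2)[OF sets_target sets.empty_sets] by (simp add: sets_target)
  fix A assume "A \<in> sets ((target \<bind> fwd) \<bind> bwd)"
  then have A [measurable]: "A \<in> sets (Leb d)"
    using bind_steps(2)[OF sets_target sets.empty_sets] by simp
  define K where "K = (1 / sqrt (2 * pi * (sqrt \<eta>)\<^sup>2)) ^ d"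
  have K: "K \<ge> 0" using eta by (simp add: K_def)
  define \<phi> where "\<phi> x y = K * exp (- (edist d y x)\<^sup>2 / (2 * \<eta>))" for x y
  have dens: "(\<Prod>i<d. normal_density (x i) (sqrt \<eta>) (y i)) = \<phi> x y" for x y
    using eta by (subst gaussian_density_eq) (simp_all add: \<phi>_def K_def)
  have \<phi>_nonneg: "0 \<le> \<phi> x y" for x y using K by (simp add: \<phi>_def)
  have \<phi>_meas [measurable]: "(\<lambda>w. \<phi> (g w) (h w)) \<in> borel_measurable M"
    if "g \<in> M \<rightarrow>\<^sub>M Leb d" "h \<in> M \<rightarrow>\<^sub>M Leb d" for g h and M :: "'z measure"
    using that unfolding \<phi>_def by measurable
  have \<phi>_sym: "\<phi> x y = \<phi> y x" for x y by (simp add: \<phi>_def edist_commute)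
  have joint: "exp (- f x) * \<phi> x y = K * exp (- V y x)" for x y
    using eta by (simp add: \<phi>_def V_eq edist_commute flip: exp_add)
  have me [measurable]: "(\<lambda>y. emeasure (bwd y) A) \<in> borel_measurable (Leb d)"
    by (rule measurable_emeasure_kernel[OF bwd_kernel A])
  have bwd_mass: "ennreal (Z y) * emeasure (bwd y) A = (\<integral>\<^sup>+x. ennreal (exp (- V y x)) * indicator A x \<partial>Leb d)" for y
  proof -
    have "ennreal (Z y) * emeasure (bwd y) A = ennreal (Z y) * (\<integral>\<^sup>+x. ennreal (exp (- V y x) / Z y) * indicator A x \<partial>Leb d)"
      unfolding bwd_eq by (subst emeasure_density) auto
    also have "\<dots> = (\<integral>\<^sup>+x. ennreal (Z y) * (ennreal (exp (- V y x) / Z y) * indicator A x) \<partial>Leb d)"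
      by (rule nn_integral_cmult[symmetric]) measurable
    also have "\<dots> = (\<integral>\<^sup>+x. ennreal (exp (- V y x)) * indicator A x \<partial>Leb d)"
      using Z_pos[of y] by (intro nn_integral_cong) (simp add: mult.assoc[symmetric] flip: ennreal_mult)
    finally show ?thesis .
  qed
  have mass: "(\<integral>\<^sup>+x. ennreal (K * exp (- V y x) / Zf) \<partial>Leb d) = ennreal (K / Zf) * ennreal (Z y)" for y
  proof -
    have "(\<integral>\<^sup>+x. ennreal (K * exp (- V y x) / Zf) \<partial>Leb d) = ennreal (\<integral>x. K * exp (- V y x) / Zf \<partial>Leb d)"
      using integrable_exp_V K Zf_pos by (intro nn_integral_eq_integral) auto
    also have "(\<integral>x. K * exp (- V y x) / Zf \<partial>Leb d) = K / Zf * Z y" by (simp add: Z_def)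
    also have "ennreal (K / Zf * Z y) = ennreal (K / Zf) * ennreal (Z y)"
      using K Zf_pos Z_pos[of y] by (intro ennreal_mult) auto
    finally show ?thesis .
  qed
  have "emeasure ((target \<bind> fwd) \<bind> bwd) A = (\<integral>\<^sup>+x. \<integral>\<^sup>+y. emeasure (bwd y) A \<partial>fwd x \<partial>target)"
    by (rule bind_steps(1)[OF sets_target A])
  also have "\<dots> = (\<integral>\<^sup>+x. \<integral>\<^sup>+y. ennreal (\<phi> x y) * emeasure (bwd y) A \<partial>Leb d \<partial>target)"
  proof (intro nn_integral_cong)
    fix x
    have "(\<lambda>y. ennreal (\<phi> x y)) \<in> borel_measurable (Leb d)" unfolding dens[symmetric] by measurable
    then show "(\<integral>\<^sup>+y. emeasure (bwd y) A \<partial>fwd x) = (\<integral>\<^sup>+y. ennreal (\<phi> x y) * emeasure (bwd y) A \<partial>Leb d)"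
      unfolding gaussian_def dens by (rule nn_integral_density[OF _ me])
  qed
  also have "\<dots> = (\<integral>\<^sup>+x. ennreal (exp (- f x) / Zf) * (\<integral>\<^sup>+y. ennreal (\<phi> x y) * emeasure (bwd y) A \<partial>Leb d) \<partial>Leb d)"
    unfolding target_eq by (rule nn_integral_density) measurable
  also have "\<dots> = (\<integral>\<^sup>+x. \<integral>\<^sup>+y. ennreal (exp (- f x) / Zf) * (ennreal (\<phi> x y) * emeasure (bwd y) A) \<partial>Leb d \<partial>Leb d)"
    by (intro nn_integral_cong nn_integral_cmult[symmetric]) measurable
  also have "\<dots> = (\<integral>\<^sup>+x. \<integral>\<^sup>+y. ennreal (K * exp (- V y x) / Zf) * emeasure (bwd y) A \<partial>Leb d \<partial>Leb d)"
  proof (intro nn_integral_cong)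
    fix x y
    have "ennreal (exp (- f x) / Zf) * ennreal (\<phi> x y) = ennreal (exp (- f x) / Zf * \<phi> x y)"
      using Zf_pos \<phi>_nonneg by (intro ennreal_mult[symmetric]) auto
    also have "exp (- f x) / Zf * \<phi> x y = K * exp (- V y x) / Zf" using joint[of x y] by simp
    finally show "ennreal (exp (- f x) / Zf) * (ennreal (\<phi> x y) * emeasure (bwd y) A) = ennreal (K * exp (- V y x) / Zf) * emeasure (bwd y) A"
      by (simp only: mult.assoc[symmetric])
  qed
  also have "\<dots> = (\<integral>\<^sup>+y. \<integral>\<^sup>+x. ennreal (K * exp (- V y x) / Zf) * emeasure (bwd y) A \<partial>Leb d \<partial>Leb d)"
    by (rule Fubini') measurable
  also have "\<dots> = (\<integral>\<^sup>+y. ennreal (K / Zf) * (\<integral>\<^sup>+x. ennreal (exp (- V y x)) * indicator A x \<partial>Leb d) \<partial>Leb d)"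
  proof (intro nn_integral_cong)
    fix y
    have "(\<integral>\<^sup>+x. ennreal (K * exp (- V y x) / Zf) * emeasure (bwd y) A \<partial>Leb d) = ennreal (K / Zf) * ennreal (Z y) * emeasure (bwd y) A"
      unfolding mass[symmetric] by (rule nn_integral_multc) measurable
    then show "(\<integral>\<^sup>+x. ennreal (K * exp (- V y x) / Zf) * emeasure (bwd y) A \<partial>Leb d)
        = ennreal (K / Zf) * (\<integral>\<^sup>+x. ennreal (exp (- V y x)) * indicator A x \<partial>Leb d)"
      by (simp only: mult.assoc bwd_mass)
  qed
  also have "\<dots> = (\<integral>\<^sup>+y. \<integral>\<^sup>+x. ennreal (K / Zf) * (ennreal (exp (- V y x)) * indicator A x) \<partial>Leb d \<partial>Leb d)"
    by (intro nn_integral_cong nn_integral_cmult[symmetric]) measurable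
  also have "\<dots> = (\<integral>\<^sup>+x. \<integral>\<^sup>+y. ennreal (K / Zf) * (ennreal (exp (- V y x)) * indicator A x) \<partial>Leb d \<partial>Leb d)"
    by (rule Fubini') measurable
  also have "\<dots> = (\<integral>\<^sup>+x. ennreal (exp (- f x) / Zf) * indicator A x \<partial>Leb d)"
  proof (intro nn_integral_cong)
    fix x
    have eq: "ennreal (K / Zf) * (ennreal (exp (- V y x)) * indicator A x)
        = (ennreal (exp (- f x) / Zf) * indicator A x) * ennreal (\<phi> x y)" for y
    proof -
      have "ennreal (K / Zf) * ennreal (exp (- V y x)) = ennreal (K / Zf * exp (- V y x))"
        using K Zf_pos by (intro ennreal_mult[symmetric]) auto
      also have "K / Zf * exp (- V y x) = exp (- f x) / Zf * \<phi> x y" using joint[of x y] by simp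
      also have "ennreal \<dots> = ennreal (exp (- f x) / Zf) * ennreal (\<phi> x y)"
        using Zf_pos \<phi>_nonneg by (intro ennreal_mult) auto
      finally show ?thesis by (simp only: mult.assoc[symmetric]) (simp only: mult_ac)
    qed
    have one: "(\<integral>\<^sup>+y. ennreal (\<phi> x y) \<partial>Leb d) = 1"
      using nn_integral_gaussian_density[of "sqrt \<eta>" d x] eta unfolding dens by simp
    have m: "(\<lambda>y. ennreal (\<phi> x y)) \<in> borel_measurable (Leb d)"
      unfolding dens[symmetric] by measurable
    show "(\<integral>\<^sup>+y. ennreal (K / Zf) * (ennreal (exp (- V y x)) * indicator A x) \<partial>Leb d) = ennreal (exp (- f x) / Zf) * indicator A x"
      unfolding eq nn_integral_cmult[OF m] one by simp
  qed
  also have "\<dots> = emeasure target A" unfolding target_eq by (rule emeasure_density[symmetric]) measurable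
  finally show "emeasure ((target \<bind> fwd) \<bind> bwd) A = emeasure target A" .
qed

lemma law_target: "law target k = target"
  by (induction k) (simp_all add: target_stationary)

lemma integral_law:
  assumes \<rho>: "prob_space \<rho>" "sets \<rho> = sets (Leb d)" and F: "bounded_obs a b F"
  shows "(\<integral>x. F x \<partial>law \<rho> k) = (\<integral>x. (round_op ^^ k) F x \<partial>\<rho>)"
  using F
proof (induction k arbitrary: F)
  case 0
  then show ?case by simp
next
  case (Suc k)
  note pk = sampler_law[OF \<rho>]
  have nn: "(\<integral>\<^sup>+x. ennreal (G x - a) \<partial>M) = ennreal ((\<integral>x. G x \<partial>M) - a)"
    if G: "bounded_obs a b G" and M: "prob_space M" "sets M = sets (Leb d)" for G M
  proof -
    interpret prob_space M by fact
    have i: "integrable M G" by (rule bounded_obs_integrable(1)[OF G M])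
    have sp: "space M = Rn d" using sets_eq_imp_space_eq[OF M(2)] by (simp add: space_Leb)
    have "(\<integral>\<^sup>+x. ennreal (G x - a) \<partial>M) = ennreal (\<integral>x. G x - a \<partial>M)"
      by (rule nn_integral_eq_integral) (use i bounded_obsD(2)[OF G] sp in auto)
    then show ?thesis using i prob_space by simp
  qed
  have L: "sets (law \<rho> k) = sets (Leb d)" by (rule pk)
  have ne: "space (law \<rho> k) \<noteq> {}" using prob_space.not_empty[OF pk(1)] .
  have f: "fwd \<in> law \<rho> k \<rightarrow>\<^sub>M subprob_algebra (Leb d)" using fwd_kernel measurable_cong_sets[OF L refl] by blast
  have s1: "sets (law \<rho> k \<bind> fwd) = sets (Leb d)" by (rule sets_bind[OF _ ne]) simp
  have b: "bwd \<in> (law \<rho> k \<bind> fwd) \<rightarrow>\<^sub>M subprob_algebra (Leb d)" using bwd_kernel measurable_cong_sets[OF s1 refl] by blast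
  note [measurable] = bounded_obsD(1)[OF Suc.prems] bounded_obsD(1)[OF bwd_op_obs[OF Suc.prems]]
  have "ennreal ((\<integral>x. F x \<partial>law \<rho> (Suc k)) - a) = (\<integral>\<^sup>+x. ennreal (F x - a) \<partial>law \<rho> (Suc k))"
    by (rule nn[OF Suc.prems pk, symmetric])
  also have "\<dots> = (\<integral>\<^sup>+y. \<integral>\<^sup>+x. ennreal (F x - a) \<partial>bwd y \<partial>(law \<rho> k \<bind> fwd))"
    unfolding proximal_law.simps by (rule nn_integral_bind[OF _ b]) measurable
  also have "\<dots> = (\<integral>\<^sup>+y. ennreal (bwd_op F y - a) \<partial>(law \<rho> k \<bind> fwd))"
    unfolding bwd_op_def by (intro nn_integral_cong nn[OF Suc.prems prob_space_bwd sets_bwd])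
  also have "\<dots> = (\<integral>\<^sup>+x. \<integral>\<^sup>+y. ennreal (bwd_op F y - a) \<partial>fwd x \<partial>law \<rho> k)"
    by (rule nn_integral_bind[OF _ f]) measurable
  also have "\<dots> = (\<integral>\<^sup>+x. ennreal (round_op F x - a) \<partial>law \<rho> k)"
    unfolding round_op_def fwd_op_def by (intro nn_integral_cong nn[OF bwd_op_obs[OF Suc.prems] prob_space_fwd sets_gaussian])
  also have "\<dots> = ennreal ((\<integral>x. round_op F x \<partial>law \<rho> k) - a)"
    by (rule nn[OF round_op_obs[OF Suc.prems] pk])
  finally have "(\<integral>x. F x \<partial>law \<rho> (Suc k)) - a = (\<integral>x. round_op F x \<partial>law \<rho> k) - a"
    using bounded_obs_integrable(2)[OF Suc.prems pk, of "Suc k"] bounded_obs_integrable(2)[OF round_op_obs[OF Suc.prems] pk, of k]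
    by (subst (asm) ennreal_inj) auto
  then show ?case using Suc.IH[OF round_op_obs[OF Suc.prems]] by (simp only: funpow_Suc_right comp_apply)
qed

text \<open>The log-Harnack inequality integrated against a coupling.\<close>

lemma entropy_dual_bound:
  assumes \<rho>: "prob_space \<rho>" "sets \<rho> = sets (Leb d)"
    and \<gamma>: "\<gamma> \<in> couplings \<rho> target"
    and cost: "(\<integral>\<^sup>+w. ennreal ((edist d (fst w) (snd w))\<^sup>2) \<partial>\<gamma>) = ennreal C" "0 \<le> C"
    and a: "0 < a" and F: "bounded_obs a b F"
  shows "(\<integral>x. ln (F x) \<partial>law \<rho> (Suc n)) \<le> ln (\<integral>x. F x \<partial>target) + C / (2 * real (Suc n) * \<eta>)"
proof -
  have g: "prob_space \<gamma>" "sets \<gamma> = sets (\<rho> \<Otimes>\<^sub>M target)" "distr \<gamma> \<rho> fst = \<rho>" "distr \<gamma> target snd = target"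
    using \<gamma> by (auto simp: couplings_def)
  interpret G: prob_space \<gamma> by fact
  interpret T: prob_space target by (rule prob_space_target)
  have sg: "sets \<gamma> = sets (Leb d \<Otimes>\<^sub>M Leb d)"
    unfolding g(2) by (intro sets_pair_measure_cong \<rho> sets_target)
  have spg: "space \<gamma> = Rn d \<times> Rn d" using sets_eq_imp_space_eq[OF sg] by (simp add: space_pair_measure space_Leb)
  have fst_m: "fst \<in> \<gamma> \<rightarrow>\<^sub>M Leb d" and snd_m: "snd \<in> \<gamma> \<rightarrow>\<^sub>M Leb d"
    using measurable_fst[of "Leb d" "Leb d"] measurable_snd[of "Leb d" "Leb d"] measurable_cong_sets[OF sg refl] by blast+
  have fst_r: "fst \<in> \<gamma> \<rightarrow>\<^sub>M \<rho>" and snd_t: "snd \<in> \<gamma> \<rightarrow>\<^sub>M target"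
    using fst_m snd_m measurable_cong_sets[OF refl \<rho>(2)] measurable_cong_sets[OF refl sets_target] by blast+
  have cost_m: "(\<lambda>w. (edist d (fst w) (snd w))\<^sup>2) \<in> borel_measurable \<gamma>"
    using measurable_edist[OF fst_m snd_m] by measurable
  have cost_i: "integrable \<gamma> (\<lambda>w. (edist d (fst w) (snd w))\<^sup>2)"
    by (rule integrableI_nonneg[OF cost_m]) (use cost in auto)
  have cost_v: "(\<integral>w. (edist d (fst w) (snd w))\<^sup>2 \<partial>\<gamma>) = C"
    using nn_integral_eq_integral[OF cost_i] cost by (simp add: ennreal_inj)
  define u w where "u = (round_op ^^ Suc n) (\<lambda>x. ln (F x))" and "w = (round_op ^^ Suc n) F"
  have u: "bounded_obs (ln a) (ln b) u" and w: "bounded_obs a b w"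
    unfolding u_def w_def by (intro round_op_iter_obs ln_obs a F)+
  have lw: "bounded_obs (ln a) (ln b) (\<lambda>x. ln (w x))" by (rule ln_obs[OF a w])
  have int_fst: "(\<integral>x. h x \<partial>\<rho>) = (\<integral>p. h (fst p) \<partial>\<gamma>)" "integrable \<gamma> (\<lambda>p. h (fst p))" if h: "bounded_obs l r h" for h l r
  proof -
    have "h \<in> borel_measurable \<rho>" using bounded_obsD(1)[OF h] measurable_cong_sets[OF \<rho>(2) refl] by blast
    then show "(\<integral>x. h x \<partial>\<rho>) = (\<integral>p. h (fst p) \<partial>\<gamma>)" "integrable \<gamma> (\<lambda>p. h (fst p))"
      using integral_distr[OF fst_r, of h] integrable_distr_eq[OF fst_r, of h] bounded_obs_integrable(1)[OF h \<rho>] by (simp_all add: g(3))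
  qed
  have int_snd: "(\<integral>x. h x \<partial>target) = (\<integral>p. h (snd p) \<partial>\<gamma>)" "integrable \<gamma> (\<lambda>p. h (snd p))" if h: "bounded_obs l r h" for h l r
  proof -
    have "h \<in> borel_measurable target" using bounded_obsD(1)[OF h] measurable_cong_sets[OF sets_target refl] by blast
    then show "(\<integral>x. h x \<partial>target) = (\<integral>p. h (snd p) \<partial>\<gamma>)" "integrable \<gamma> (\<lambda>p. h (snd p))"
      using integral_distr[OF snd_t, of h] integrable_distr_eq[OF snd_t, of h]
        bounded_obs_integrable(1)[OF h prob_space_target sets_target] by (simp_all add: g(4))
  qed
  have "(\<integral>x. ln (F x) \<partial>law \<rho> (Suc n)) = (\<integral>x. u x \<partial>\<rho>)"
    unfolding u_def by (rule integral_law[OF \<rho> ln_obs[OF a F]])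
  also have "\<dots> = (\<integral>p. u (fst p) \<partial>\<gamma>)" by (rule int_fst(1)[OF u])
  also have "\<dots> \<le> (\<integral>p. ln (w (snd p)) + (edist d (fst p) (snd p))\<^sup>2 / (2 * real (Suc n) * \<eta>) \<partial>\<gamma>)"
  proof (rule Bochner_Integration.integral_mono[OF int_fst(2)[OF u]])
    show "integrable \<gamma> (\<lambda>p. ln (w (snd p)) + (edist d (fst p) (snd p))\<^sup>2 / (2 * real (Suc n) * \<eta>))"
      using int_snd(2)[OF lw] cost_i by (intro Bochner_Integration.integrable_add integrable_divide) auto
    fix p assume "p \<in> space \<gamma>"
    then have "fst p \<in> Rn d \<and> snd p \<in> Rn d" unfolding spg mem_Times_iff .
    then have "fst p \<in> Rn d" "snd p \<in> Rn d" by blast+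
    then show "u (fst p) \<le> ln (w (snd p)) + (edist d (fst p) (snd p))\<^sup>2 / (2 * real (Suc n) * \<eta>)"
      unfolding u_def w_def by (rule log_harnack[OF a F])
  qed
  also have "\<dots> = (\<integral>p. ln (w (snd p)) \<partial>\<gamma>) + (\<integral>p. (edist d (fst p) (snd p))\<^sup>2 / (2 * real (Suc n) * \<eta>) \<partial>\<gamma>)"
    by (rule Bochner_Integration.integral_add[OF int_snd(2)[OF lw] integrable_divide]) (rule cost_i)
  also have "(\<integral>p. ln (w (snd p)) \<partial>\<gamma>) = (\<integral>x. ln (w x) \<partial>target)"
    by (rule int_snd(1)[OF lw, symmetric])
  also have "(\<integral>p. (edist d (fst p) (snd p))\<^sup>2 / (2 * real (Suc n) * \<eta>) \<partial>\<gamma>) = C / (2 * real (Suc n) * \<eta>)"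
    unfolding cost_v[symmetric] by (rule integral_divide_zero)
  also have "(\<integral>x. ln (w x) \<partial>target) \<le> ln (\<integral>x. w x \<partial>target)"
  proof -
    have e: "exp (ln (w x)) = w x" if "x \<in> space target" for x
      using bounded_obsD(2)[OF w, of x] a that sets_eq_imp_space_eq[OF sets_target] by (simp add: space_Leb)
    have "integrable target (\<lambda>x. exp (ln (w x))) \<longleftrightarrow> integrable target w"
      by (intro Bochner_Integration.integrable_cong refl e)
    then have i: "integrable target (\<lambda>x. exp (ln (w x)))"
      using bounded_obs_integrable(1)[OF w prob_space_target sets_target] by simp
    have "(\<integral>x. ln (w x) \<partial>target) \<le> ln (\<integral>x. exp (ln (w x)) \<partial>target)"
      by (rule T.jensen_exp[OF bounded_obs_integrable(1)[OF lw prob_space_target sets_target] i])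
    also have "(\<integral>x. exp (ln (w x)) \<partial>target) = (\<integral>x. w x \<partial>target)"
      by (intro Bochner_Integration.integral_cong refl e)
    finally show ?thesis .
  qed
  also have "(\<integral>x. w x \<partial>target) = (\<integral>x. F x \<partial>target)"
    unfolding w_def using integral_law[OF prob_space_target sets_target F, of "Suc n"] by (simp only: law_target)
  finally show ?thesis by simp
qed

end

context proximal
begin

lemma target_null:
  assumes "N \<in> null_sets target"
  shows "AE x in Leb d. x \<notin> N"
proof -
  have "N \<in> sets (Leb d)" "AE x in Leb d. x \<in> N \<longrightarrow> ennreal (exp (- f x) / Zf) = 0"
    using assms unfolding target_eq by (subst (asm) null_sets_density_iff; simp)+
  then show ?thesis using Zf_pos by (auto elim!: eventually_mono)
qed

lemma law_absolutely_continuous: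
  assumes \<rho>: "prob_space \<rho>" "sets \<rho> = sets (Leb d)"
  shows "absolutely_continuous target (law \<rho> (Suc n))"
  unfolding absolutely_continuous_def
proof
  fix N assume N: "N \<in> null_sets target"
  then have Ns: "N \<in> sets (Leb d)" using sets_target by auto
  have "N \<in> null_sets (Leb d)" using target_null[OF N] AE_iff_null_sets[OF Ns] by blast
  have 0: "emeasure (bwd y) N = 0" for y
    unfolding bwd_eq using target_null[OF N] Ns
    by (subst emeasure_density) (auto intro!: nn_integral_0_iff_AE[THEN iffD2] elim!: eventually_mono)
  have "emeasure (law \<rho> (Suc n)) N = (\<integral>\<^sup>+x. \<integral>\<^sup>+y. emeasure (bwd y) N \<partial>fwd x \<partial>law \<rho> n)"
    unfolding proximal_law.simps by (rule bind_steps(1)[OF sampler_law(2)[OF \<rho>] Ns])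
  then have "emeasure (law \<rho> (Suc n)) N = 0" by (simp add: 0)
  then show "N \<in> null_sets (law \<rho> (Suc n))"
    using Ns sampler_law(2)[OF \<rho>, of "Suc n"] by (intro null_setsI) auto
qed

text \<open>Apply the dual bound to \<open>min D k + e\<close>, where \<open>D\<close> is the density of \<open>\<nu>\<close> with respect to the
  target, and let \<open>k\<close> tend to infinity and then \<open>e\<close> to 0.  The bound for \<open>e = 1\<close> shows that the
  positive part of \<open>ln D\<close> is integrable; the negative part is dominated by \<open>1 / D\<close>.\<close>

lemma rel_entropy_bound:
  assumes \<rho>: "prob_space \<rho>" "sets \<rho> = sets (Leb d)"
    and fin: "W2_sq d \<rho> target < \<infinity>"
  shows "rel_entropy target (law \<rho> (Suc n)) \<le> ereal (enn2real (W2_sq d \<rho> target) / (2 * real (Suc n) * \<eta>))"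
proof -
  define \<nu> where "\<nu> = law \<rho> (Suc n)"
  interpret T: prob_space target by (rule prob_space_target)
  interpret N: prob_space \<nu> unfolding \<nu>_def by (rule sampler_law(1)[OF \<rho>])
  have s\<nu>: "sets \<nu> = sets target" unfolding \<nu>_def sampler_law(2)[OF \<rho>] sets_target ..
  have ac: "absolutely_continuous target \<nu>" unfolding \<nu>_def by (rule law_absolutely_continuous[OF \<rho>])
  obtain D where D_t: "D \<in> borel_measurable target" and RN: "AE x in target. RN_deriv target \<nu> x = ennreal (D x)"
    and pos: "AE x in \<nu>. 0 < D x" and nn: "\<And>x. 0 \<le> D x"
    using T.real_RN_deriv[OF N.finite_measure_axioms ac s\<nu>] by blast
  have D [measurable]: "D \<in> borel_measurable (Leb d)" using D_t measurable_cong_sets[OF sets_target refl] by blast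
  have D_\<nu>: "D \<in> borel_measurable \<nu>" using D_t measurable_cong_sets[OF s\<nu> refl] by blast
  note [measurable] = D_t D_\<nu>
  have dens: "\<nu> = density target (\<lambda>x. ennreal (D x))"
  proof -
    have "\<nu> = density target (RN_deriv target \<nu>)" by (rule T.density_RN_deriv[OF ac s\<nu>, symmetric])
    also have "\<dots> = density target (\<lambda>x. ennreal (D x))" by (rule density_cong) (use RN in auto)
    finally show ?thesis .
  qed
  have mass: "(\<integral>\<^sup>+x. ennreal (D x) \<partial>target) = 1"
  proof -
    have "(\<integral>\<^sup>+x. ennreal (D x) \<partial>target) = emeasure (density target (\<lambda>x. ennreal (D x))) (space target)"
      by (subst emeasure_density) (auto intro!: nn_integral_cong)
    also have "\<dots> = 1" using N.emeasure_space_1 sets_eq_imp_space_eq[OF s\<nu>] by (simp only: dens[symmetric])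
    finally show ?thesis .
  qed
  have D_int: "integrable target D" "(\<integral>x. D x \<partial>target) = 1"
  proof -
    show i: "integrable target D" by (rule integrableI_nonneg) (use mass nn in auto)
    show "(\<integral>x. D x \<partial>target) = 1" using nn_integral_eq_integral[OF i] nn mass by simp
  qed
  have sh: "integrable \<nu> (\<lambda>x. ln (D x + e)) \<and> (\<integral>x. ln (D x + e) \<partial>\<nu>) \<le> e + C / (2 * real (Suc n) * \<eta>)"
    if \<gamma>: "\<gamma> \<in> couplings \<rho> target"
      and cost: "(\<integral>\<^sup>+w. ennreal ((edist d (fst w) (snd w))\<^sup>2) \<partial>\<gamma>) = ennreal C" "0 \<le> C" and e: "0 < e" for \<gamma> C e
  proof -
    define B where "B = e + C / (2 * real (Suc n) * \<eta>)"
    define G where "G k x = min (D x) (real k) + e" for k x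
    have G: "bounded_obs e (real k + e) (G k)" for k
      unfolding G_def by (rule bounded_obsI) (use nn in auto)
    have Gm [measurable]: "G k \<in> borel_measurable \<nu>" for k unfolding G_def by measurable
    have le: "(\<integral>x. ln (G k x) \<partial>\<nu>) \<le> B" for k
    proof -
      have "(\<integral>x. ln (G k x) \<partial>\<nu>) \<le> ln (\<integral>x. G k x \<partial>target) + C / (2 * real (Suc n) * \<eta>)"
        unfolding \<nu>_def by (rule entropy_dual_bound[OF \<rho> \<gamma> cost e G])
      also have "ln (\<integral>x. G k x \<partial>target) \<le> e"
      proof -
        have "(\<integral>x. G k x \<partial>target) \<le> (\<integral>x. D x + e \<partial>target)"
          by (rule Bochner_Integration.integral_mono[OF bounded_obs_integrable(1)[OF G prob_space_target sets_target]])
             (use D_int in \<open>auto simp: G_def\<close>)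
        also have "\<dots> = 1 + e" using D_int T.prob_space by simp
        finally have "(\<integral>x. G k x \<partial>target) \<le> 1 + e" .
        moreover have "0 < (\<integral>x. G k x \<partial>target)"
          using bounded_obs_integrable(2)[OF G prob_space_target sets_target, of k] e by linarith
        ultimately have "ln (\<integral>x. G k x \<partial>target) \<le> ln (1 + e)" using e by (intro ln_mono) auto
        also have "\<dots> \<le> e" by (rule ln_add_one_self_le_self) (use e in simp)
        finally show ?thesis .
      qed
      finally show ?thesis by (simp add: B_def)
    qed
    have s\<nu>L: "sets \<nu> = sets (Leb d)" using s\<nu> sets_target by simp
    have nnG: "(\<integral>\<^sup>+x. ennreal (ln (G k x) - ln e) \<partial>\<nu>) \<le> ennreal (B - ln e)" for k
    proof -
      have i: "integrable \<nu> (\<lambda>x. ln (G k x))"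
        by (rule bounded_obs_integrable(1)[OF ln_obs[OF e G] N.prob_space_axioms s\<nu>L])
      have "(\<integral>\<^sup>+x. ennreal (ln (G k x) - ln e) \<partial>\<nu>) = ennreal (\<integral>x. ln (G k x) - ln e \<partial>\<nu>)"
        by (rule nn_integral_eq_integral) (use i e nn in \<open>auto simp: G_def intro!: AE_I2 ln_mono\<close>)
      also have "\<dots> \<le> ennreal (B - ln e)" using le[of k] i N.prob_space by (intro ennreal_leI) simp
      finally show ?thesis .
    qed
    have "(\<lambda>k. \<integral>\<^sup>+x. ennreal (ln (G k x) - ln e) \<partial>\<nu>) \<longlonglongrightarrow> (\<integral>\<^sup>+x. ennreal (ln (D x + e) - ln e) \<partial>\<nu>)"
    proof (rule nn_integral_LIMSEQ)
      show "incseq (\<lambda>k x. ennreal (ln (G k x) - ln e))"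
      proof (intro incseq_SucI le_funI ennreal_leI diff_right_mono)
        fix k x
        have "0 < G k x" using nn[of x] e by (simp add: G_def add_nonneg_pos)
        then show "ln (G k x) \<le> ln (G (Suc k) x)" by (intro ln_mono) (auto simp: G_def)
      qed
      show "(\<lambda>k. ennreal (ln (G k x) - ln e)) \<longlonglongrightarrow> ennreal (ln (D x + e) - ln e)" for x
      proof (rule tendsto_eventually)
        obtain k0 where "D x \<le> real k0" using real_arch_simple by blast
        then have "G k x = D x + e" if "k \<ge> k0" for k using that by (simp add: G_def)
        then show "\<forall>\<^sub>F k in sequentially. ennreal (ln (G k x) - ln e) = ennreal (ln (D x + e) - ln e)"
          by (intro eventually_sequentiallyI[of k0]) simp
      qed
    qed measurable
    then have up: "(\<integral>\<^sup>+x. ennreal (ln (D x + e) - ln e) \<partial>\<nu>) \<le> ennreal (B - ln e)"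
      by (rule LIMSEQ_le_const2) (use nnG in blast)
    have ge: "0 \<le> ln (D x + e) - ln e" for x using nn[of x] e by simp
    have i: "integrable \<nu> (\<lambda>x. ln (D x + e) - ln e)"
      by (rule integrableI_nonneg) (use ge up le_less_trans in \<open>auto simp: less_top[symmetric] top_unique\<close>)
    then have i2: "integrable \<nu> (\<lambda>x. ln (D x + e))"
      using Bochner_Integration.integrable_add[OF i, of "\<lambda>_. ln e"] by simp
    have "ennreal (\<integral>x. ln (D x + e) - ln e \<partial>\<nu>) \<le> ennreal (B - ln e)"
      using up nn_integral_eq_integral[OF i] ge by simp
    moreover have Bl: "0 \<le> B - ln e"
    proof -
      have "ln e \<le> e - 1" using e by (rule ln_le_minus_one)
      moreover have "0 \<le> C / (2 * real (Suc n) * \<eta>)" using cost(2) eta by simp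
      ultimately show ?thesis by (simp add: B_def)
    qed
    ultimately have "(\<integral>x. ln (D x + e) - ln e \<partial>\<nu>) \<le> B - ln e" by (simp add: ennreal_le_iff)
    then show ?thesis using i2 N.prob_space by (simp add: B_def)
  qed
  obtain \<gamma>0 where \<gamma>0: "\<gamma>0 \<in> couplings \<rho> target" "(\<integral>\<^sup>+w. ennreal ((edist d (fst w) (snd w))\<^sup>2) \<partial>\<gamma>0) < \<infinity>"
    using fin unfolding W2_sq_def INF_less_iff by blast
  define C0 where "C0 = enn2real (\<integral>\<^sup>+w. ennreal ((edist d (fst w) (snd w))\<^sup>2) \<partial>\<gamma>0)"
  have C0: "(\<integral>\<^sup>+w. ennreal ((edist d (fst w) (snd w))\<^sup>2) \<partial>\<gamma>0) = ennreal C0" "0 \<le> C0"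
    using \<gamma>0(2) by (simp_all add: C0_def)
  have i1: "integrable \<nu> (\<lambda>x. ln (D x + 1))" using sh[OF \<gamma>0(1) C0, of 1] by simp
  have inv_int: "integrable \<nu> (\<lambda>x. 1 / D x)"
  proof (rule integrableI_nonneg)
    have "(\<integral>\<^sup>+x. ennreal (1 / D x) \<partial>\<nu>) = (\<integral>\<^sup>+x. ennreal (D x) * ennreal (1 / D x) \<partial>target)"
      unfolding dens by (rule nn_integral_density) measurable
    also have "\<dots> \<le> (\<integral>\<^sup>+x. 1 \<partial>target)"
    proof (intro nn_integral_mono)
      fix x
      have "ennreal (D x) * ennreal (1 / D x) = ennreal (D x * (1 / D x))"
        by (rule ennreal_mult[symmetric]) (use nn in auto)
      also have "\<dots> \<le> 1" by simp
      finally show "ennreal (D x) * ennreal (1 / D x) \<le> 1" .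
    qed
    also have "\<dots> = 1" using T.emeasure_space_1 by simp
    finally show "(\<integral>\<^sup>+x. ennreal (1 / D x) \<partial>\<nu>) < \<infinity>" by (rule le_less_trans) simp
  qed (use nn in auto)
  have lnD: "integrable \<nu> (\<lambda>x. ln (D x))"
  proof (rule Bochner_Integration.integrable_bound[OF Bochner_Integration.integrable_add[OF i1 inv_int]])
    show "AE x in \<nu>. norm (ln (D x)) \<le> norm (ln (D x + 1) + 1 / D x)"
      using pos
    proof (rule AE_mp, intro AE_I2 impI)
      fix x assume p: "0 < D x"
      have 1: "ln (D x) \<le> ln (D x + 1)" using p by (intro ln_mono) auto
      have 2: "0 \<le> ln (D x + 1)" using p by simp
      have "ln (1 / D x) \<le> 1 / D x - 1" using p by (intro ln_le_minus_one) simp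
      then have 3: "- ln (D x) \<le> 1 / D x" using p by (simp add: ln_div)
      have 4: "0 \<le> 1 / D x" using p by simp
      show "norm (ln (D x)) \<le> norm (ln (D x + 1) + 1 / D x)" unfolding real_norm_def using 1 2 3 4 by linarith
    qed
  qed measurable
  define H where "H = (\<integral>x. ln (D x) \<partial>\<nu>)"
  have H_le: "H \<le> C / (2 * real (Suc n) * \<eta>)"
    if "\<gamma> \<in> couplings \<rho> target" "(\<integral>\<^sup>+w. ennreal ((edist d (fst w) (snd w))\<^sup>2) \<partial>\<gamma>) = ennreal C" "0 \<le> C" for \<gamma> C
  proof (rule field_le_epsilon)
    fix e :: real assume e: "e > 0"
    have "H \<le> (\<integral>x. ln (D x + e) \<partial>\<nu>)"
      unfolding H_def
    proof (rule integral_mono_AE[OF lnD])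
      show "AE x in \<nu>. ln (D x) \<le> ln (D x + e)"
        using pos by (rule AE_mp, intro AE_I2 impI ln_mono) (use e in auto)
    qed (use sh[OF that e] in blast)
    then show "H \<le> C / (2 * real (Suc n) * \<eta>) + e" using sh[OF that e] by linarith
  qed
  have AEden: "AE x in \<nu>. entropy_density (exp 1) target \<nu> x = ln (D x)"
  proof -
    have "AE x in \<nu>. RN_deriv target \<nu> x = ennreal (D x)"
      using absolutely_continuous_AE[OF s\<nu> ac RN] .
    then show ?thesis
      by (rule AE_mp, intro AE_I2 impI) (simp add: entropy_density_def log_def nn)
  qed
  have ed_m: "entropy_density (exp 1) target \<nu> \<in> borel_measurable \<nu>"
    using measurable_entropy_density[of "exp 1" target \<nu>] measurable_cong_sets[OF s\<nu> refl] by blast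
  have lnD_m: "(\<lambda>x. ln (D x)) \<in> borel_measurable \<nu>" by measurable
  have int_ed: "integrable \<nu> (entropy_density (exp 1) target \<nu>)"
    using integrable_cong_AE[OF ed_m lnD_m AEden] lnD by blast
  have KL: "KL_divergence (exp 1) target \<nu> = H"
    unfolding KL_divergence_def H_def by (rule integral_cong_AE[OF ed_m lnD_m AEden])
  have "H \<le> enn2real (W2_sq d \<rho> target) / (2 * real (Suc n) * \<eta>)"
  proof -
    have b: "2 * real (Suc n) * \<eta> > 0" using eta by simp
    have "ennreal (2 * real (Suc n) * \<eta> * H) \<le> W2_sq d \<rho> target"
      unfolding W2_sq_def
    proof (rule INF_greatest)
      fix \<gamma> assume \<gamma>: "\<gamma> \<in> couplings \<rho> target"
      define I where "I = (\<integral>\<^sup>+w. ennreal ((edist d (fst w) (snd w))\<^sup>2) \<partial>\<gamma>)"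
      show "ennreal (2 * real (Suc n) * \<eta> * H) \<le> (\<integral>\<^sup>+w. ennreal ((edist d (fst w) (snd w))\<^sup>2) \<partial>\<gamma>)"
      proof (cases "I = \<infinity>")
        case False
        then have I: "I = ennreal (enn2real I)" by (simp add: less_top)
        from H_le[OF \<gamma>, of "enn2real I"] I have "H \<le> enn2real I / (2 * real (Suc n) * \<eta>)" by (simp add: I_def)
        then have "2 * real (Suc n) * \<eta> * H \<le> enn2real I" using b by (simp add: pos_le_divide_eq mult.commute)
        then have "ennreal (2 * real (Suc n) * \<eta> * H) \<le> ennreal (enn2real I)" by (rule ennreal_leI)
        also have "\<dots> = I" by (rule I[symmetric])
        finally show ?thesis by (simp only: I_def)
      qed (simp add: I_def)
    qed
    then have "enn2real (ennreal (2 * real (Suc n) * \<eta> * H)) \<le> enn2real (W2_sq d \<rho> target)"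
      using fin by (intro enn2real_mono) auto
    then have "2 * real (Suc n) * \<eta> * H \<le> enn2real (W2_sq d \<rho> target)"
    proof (cases "0 \<le> 2 * real (Suc n) * \<eta> * H")
      case False
      then show ?thesis using enn2real_nonneg[of "W2_sq d \<rho> target"] by linarith
    qed simp
    then show ?thesis using b by (simp add: pos_le_divide_eq mult.commute)
  qed
  then show ?thesis
    unfolding rel_entropy_def \<nu>_def[symmetric] using ac int_ed by (simp add: KL)
qed

lemma sampler_complexity:
  assumes \<rho>: "prob_space \<rho>" "sets \<rho> = sets (Leb d)" and fin: "W2_sq d \<rho> target < \<infinity>"
    and \<epsilon>: "\<epsilon> > 0" and m: "m > 0"
    and c: "\<beta> * \<eta> * real d = c"
    and low: "ennreal m \<le> ennreal (\<beta> * real d / \<epsilon>) * W2_sq d \<rho> target"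
  shows "\<exists>k. distr (proximal_sampler d f \<beta> \<eta> \<rho> k) (Leb d) fst = law \<rho> k
    \<and> rel_entropy target (law \<rho> k) \<le> ereal \<epsilon>
    \<and> (\<integral>\<^sup>+w. snd w \<partial>proximal_sampler d f \<beta> \<eta> \<rho> k)
        \<le> ennreal (4 * (1 / (2 * c) + 1 / m)) * (ennreal (\<beta> * real d / \<epsilon>) * W2_sq d \<rho> target)"
proof -
  define w where "w = enn2real (W2_sq d \<rho> target)"
  have w: "W2_sq d \<rho> target = ennreal w" "0 \<le> w" unfolding w_def using fin by simp_all
  have cpos: "0 < c" using c beta eta dim by auto
  define Q where "Q = \<beta> * real d / \<epsilon> * w"
  have QW: "ennreal (\<beta> * real d / \<epsilon>) * W2_sq d \<rho> target = ennreal Q"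
    unfolding w(1) Q_def by (rule ennreal_mult[symmetric]) (use beta \<epsilon> w(2) in auto)
  have "0 \<le> Q" unfolding Q_def using beta \<epsilon> w(2) by simp
  then have mQ: "m \<le> Q" using low unfolding QW by (simp add: ennreal_le_iff)
  have Q: "w / (2 * \<eta> * \<epsilon>) = Q / (2 * c)"
    unfolding Q_def c[symmetric] using beta dim \<epsilon> eta by (simp add: field_simps)
  have Qpos: "0 < Q / (2 * c)" using mQ m cpos by simp
  define k where "k = nat \<lceil>Q / (2 * c)\<rceil>"
  have k: "Q / (2 * c) \<le> real k" "real k \<le> Q / (2 * c) + 1" "0 < k"
    unfolding k_def using Qpos by linarith+
  then obtain n where n: "k = Suc n" using gr0_implies_Suc by blast
  have "rel_entropy target (law \<rho> k) \<le> ereal (w / (2 * real k * \<eta>))"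
    using rel_entropy_bound[OF \<rho> fin, of n] by (simp only: n w_def)
  also have "w / (2 * real k * \<eta>) \<le> \<epsilon>"
  proof -
    have "w / (2 * \<eta> * \<epsilon>) \<le> real k" using k(1) Q by simp
    then have "w \<le> real k * (2 * \<eta> * \<epsilon>)" using eta \<epsilon> by (simp add: pos_divide_le_eq)
    then show ?thesis using k(3) eta by (simp add: pos_divide_le_eq algebra_simps)
  qed
  finally have entropy: "rel_entropy target (law \<rho> k) \<le> ereal \<epsilon>" by simp
  \<comment> \<open>Rounding up costs one more round, which is at most \<open>Q / m\<close> rounds.\<close>
  have "1 \<le> Q / m" using mQ m by simp
  then have "4 * real k \<le> 4 * (Q / (2 * c) + Q / m)" using k(2) by simp
  also have "\<dots> = 4 * (1 / (2 * c) + 1 / m) * Q" by (simp add: algebra_simps)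
  finally have "ennreal (4 * real k) \<le> ennreal (4 * (1 / (2 * c) + 1 / m) * Q)" by (rule ennreal_leI)
  also have "\<dots> = ennreal (4 * (1 / (2 * c) + 1 / m)) * ennreal Q"
    by (rule ennreal_mult) (use cpos mQ m in auto)
  finally have "ennreal (4 * real k) \<le> ennreal (4 * (1 / (2 * c) + 1 / m)) * ennreal Q" .
  with sampler_correct[OF \<rho>, of k] entropy show ?thesis
    unfolding QW by (intro exI[of _ k]) (auto intro: order_trans)
qed

end

theorem corollary6:
  shows "\<exists>c0::real. c0 > 0 \<and> (\<forall>c::real. 0 < c \<and> c \<le> c0 \<longrightarrow>
    (\<forall>m::real. m > 0 \<longrightarrow> (\<exists>C::real. C > 0 \<and>
      (\<forall>(d::nat) (f::(nat \<Rightarrow> real) \<Rightarrow> real) (\<beta>::real) (\<epsilon>::real) (\<rho>0::(nat \<Rightarrow> real) measure) (\<eta>::real).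
        d \<ge> 1 \<longrightarrow> \<beta> > 0 \<longrightarrow> \<epsilon> > 0 \<longrightarrow> \<eta> = c / (\<beta> * real d) \<longrightarrow>
        convex_fun d f \<longrightarrow> smooth_fun d \<beta> f \<longrightarrow>
        integrable (Leb d) (\<lambda>x. exp (- f x)) \<longrightarrow>
        integrable (gibbs d f) (\<lambda>x. (L2_set x {..<d})\<^sup>2) \<longrightarrow>
        prob_space \<rho>0 \<longrightarrow> sets \<rho>0 = sets (Leb d) \<longrightarrow>
        W2_sq d \<rho>0 (gibbs d f) < \<infinity> \<longrightarrow>
        ennreal (\<beta> * real d / \<epsilon>) * W2_sq d \<rho>0 (gibbs d f) \<ge> ennreal m \<longrightarrow>
        (\<exists>k::nat.
           distr (proximal_sampler d f \<beta> \<eta> \<rho>0 k) (Leb d) fst = proximal_law d f \<eta> \<rho>0 k \<and>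
           rel_entropy (gibbs d f) (proximal_law d f \<eta> \<rho>0 k) \<le> ereal \<epsilon> \<and>
           (\<integral>\<^sup>+p. snd p \<partial>(proximal_sampler d f \<beta> \<eta> \<rho>0 k))
             \<le> ennreal C * (ennreal (\<beta> * real d / \<epsilon>) * W2_sq d \<rho>0 (gibbs d f)))))))"
proof (rule exI[of _ "1 / 8"], intro conjI allI impI, goal_cases)
  case 1
  show ?case by simp
next
  case c: (2 c m)
  show ?case
  proof (rule exI[of _ "4 * (1 / (2 * c) + 1 / m)"], intro conjI allI impI, goal_cases)
    case 1
    show ?case using c by (simp add: add_pos_pos)
  next
    case (2 d f \<beta> \<epsilon> \<rho>0 \<eta>)
    have "\<eta> > 0" "\<beta> * \<eta> * real d = c" using 2(1,2,4) c by simp_all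
    then interpret proximal d f \<beta> \<eta>
      by unfold_locales (use 2 c in auto)
    show ?case
      by (rule sampler_complexity[OF 2(9,10,11,3) c(2) \<open>\<beta> * \<eta> * real d = c\<close> 2(12)])
  qed
qed

end
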